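(* Let $\mathfrak g$ be a restricted Lie algebra of dimension $n$, $M$ a finite dimensional $\mathfrak u(\mathfrak g)$-module, $r,j$ positive integers with $r<n$ and $j\le(p-1)r$, $X\subset\mathbb E(r,\mathfrak g)$ a locally closed subset, and $W=\overline X$ the closure of $X$. Then for every subset $\Sigma\subset\{1,\dots,n\}$ of cardinality $r$, the restriction of $\mathcal{I}m^{j,X}(M)\subset M\otimes\mathcal O_X$ to $X\cap\mathcal U_\Sigma\subset X$ equals the restriction of $\mathcal{I}m^{j,W_\Sigma}(M)\subset M\otimes\mathcal O_{W_\Sigma}$ to $X\cap\mathcal U_\Sigma\subset W_\Sigma$. Likewise, the restriction of $\mathcal{K}er^{j,X}(M)\subset M\otimes\mathcal O_X$ to $X\cap\mathcal U_\Sigma$ equals the restriction of $\mathcal{K}er^{j,W_\Sigma}(M)\subset M\otimes\mathcal O_{W_\Sigma}$ to $X\cap\mathcal U_\Sigma$.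
   Context: Let $k$ be an algebraically closed field of characteristic $p>0$. Lie algebras are finite dimensional restricted Lie algebras over $k$ with $p$-operation $(-)^{[p]}$; $\mathfrak u(\mathfrak g)$ is the restricted enveloping algebra. An elementary subalgebra of $\mathfrak g$ is an abelian Lie subalgebra $\epsilon$ with $x^{[p]}=0$ for all $x\in\epsilon$. $\mathbb E(r,\mathfrak g)\subset\operatorname{Grass}(r,\mathfrak g)$ is the closed subvariety of $r$-dimensional elementary subalgebras. Fix a basis $x_1,\dots,x_n$ of $\mathfrak g$, identifying $\operatorname{Grass}(r,\mathfrak g)$ with $\operatorname{Grass}(r,n)$. Sheaves by descent. Let $\mathcal C^o$ be the quasi-projective variety of linearly independent $r$-tuples $(X_1,\dots,X_r)$ of pairwise commuting elements of $\mathfrak g$ with $X_s^{[p]}=0$; sending a tuple to its span makes $\mathcal C^o\to\mathbb E(r,\mathfrak g)$ a $\mathrm{GL}_r$-torsor. Let $Y_{i,s}$ be the function on $\mathcal C^o$ giving the $i$-th coordinate of $X_s$. For a locally closed $X\subset\mathbb E(r,\mathfrak g)$ let $q:\widetilde X\to X$ be the restriction of this torsor and let $\Theta_s:M\otimes\mathcal O_{\widetilde X}\to M\otimes\mathcal O_{\widetilde X}$, $m\otimes f\mapsto\sum_ix_im\otimes Y_{i,s}f$. The sum of the images of all $\Theta_1^{j_1}\cdots\Theta_r^{j_r}$ with $j_1+\dots+j_r=j$, $j_\ell\ge0$, and the intersection of the kernels of these operators, are $\mathrm{GL}_r$-invariant coherent subsheaves of $M\otimes\mathcal O_{\widetilde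 X}$; by descent along $q$ they are the pull-backs of unique coherent subsheaves $\mathcal{I}m^{j,X}(M)$ and $\mathcal{K}er^{j,X}(M)$ of $M\otimes\mathcal O_X$. Sheaves by charts. For $\Sigma=\{i_1<\dots<i_r\}\subset\{1,\dots,n\}$, $\mathcal U_\Sigma\subset\operatorname{Grass}(r,n)$ is the affine open subset of $r$-planes projecting isomorphically onto the coordinates indexed by $\Sigma$. Each $L\in\mathcal U_\Sigma$ is the column span of a unique $n\times r$ matrix whose $r\times r$ submatrix with rows indexed by $\Sigma$ is the identity; let $Y^\Sigma_{i,s}\in k[\mathcal U_\Sigma]$ be its $(i,s)$ entry (so $Y^\Sigma_{i_s,s}=1$ and $Y^\Sigma_{i_{s'},s}=0$ for $s'\ne s$). For a closed subset $W\subset\mathbb E(r,\mathfrak g)$ let $W_\Sigma=W\cap\mathcal U_\Sigma$, let $Y^{W,\Sigma}_{i,s}$ be the restriction of $Y^\Sigma_{i,s}$ to $W_\Sigma$, and let $\Theta_s^{W,\Sigma}=\sum_ix_i\otimes Y_{i,s}^{W,\Sigma}$ acting on $M\otimes k[W_\Sigma]$. Then $\mathcal{I}m^{j,W_\Sigma}(M)$ (resp. $\mathcal{K}er^{j,W_\Sigma}(M)$) is the $k[W_\Sigma]$-submodule of $M\otimes k[W_\Sigma]$ that is the sum of the images (resp. the intersection of the kernels) of all $(\Theta_1^{W,\Sigma})^{j_1}\cdots(\Theta_r^{W,\Sigma})^{j_r}$ with $j_1+\dots+j_r=j$, $j_\ell\geq 0$, identified with a coherent subsheaf of $M\otimes\mathcal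 O_{W_\Sigma}$. *)

theory Defs
  imports
    "HOL-Analysis.Abstract_Topology"
    "HOL-Library.Function_Algebras"
    "HOL-Computational_Algebra.Polynomial"
    "HOL-Algebra.QuotRing"
begin

section \<open>Varieties as spaces with charts\<close>

text \<open>
  The ground field is algebraically closed and all varieties are reduced, so regular functions are
  honest functions on points. A space is described by an atlas: a set of pairs \<open>(V, C)\<close>, with \<open>V\<close> an
  affine chart and \<open>C\<close> a set of coordinate functions identifying \<open>V\<close> with an affine space.
\<close>

type_synonym ('x, 'k) atlas = "('x set \<times> ('x \<Rightarrow> 'k) set) set"

inductive_set poly_funs :: "('x \<Rightarrow> 'k::comm_ring_1) set \<Rightarrow> ('x \<Rightarrow> 'k) set"
  for C :: "('x \<Rightarrow> 'k) set" where
  const: "(\<lambda>_. c) \<in> poly_funs C"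
| coord: "f \<in> C \<Longrightarrow> f \<in> poly_funs C"
| add: "f \<in> poly_funs C \<Longrightarrow> g \<in> poly_funs C \<Longrightarrow> (\<lambda>x. f x + g x) \<in> poly_funs C"
| mult: "f \<in> poly_funs C \<Longrightarrow> g \<in> poly_funs C \<Longrightarrow> (\<lambda>x. f x * g x) \<in> poly_funs C"

text \<open>The Zariski topology glued from the charts: open means open in every chart.\<close>

definition zariski_open :: "('x, 'k::field) atlas \<Rightarrow> 'x set \<Rightarrow> bool" where
  "zariski_open \<A> T \<longleftrightarrow> T \<subseteq> \<Union>(fst ` \<A>) \<and>
     (\<forall>(V, C)\<in>\<A>. \<exists>S\<subseteq>poly_funs C. T \<inter> V = {x \<in> V. \<exists>f\<in>S. f x \<noteq> 0})"

lemma zariski_openI: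
  assumes "T \<subseteq> \<Union>(fst ` \<A>)"
    and "\<And>V C. (V, C) \<in> \<A> \<Longrightarrow> \<exists>S\<subseteq>poly_funs C. T \<inter> V = {x \<in> V. \<exists>f\<in>S. f x \<noteq> 0}"
  shows "zariski_open \<A> T"
  unfolding zariski_open_def
proof (intro conjI ballI)
  fix VC assume "VC \<in> \<A>"
  then show "case VC of (V, C) \<Rightarrow> \<exists>S\<subseteq>poly_funs C. T \<inter> V = {x \<in> V. \<exists>f\<in>S. f x \<noteq> 0}"
    by (cases VC) (simp only: prod.case, rule assms(2))
qed (rule assms(1))

lemma zariski_openD:
  assumes "zariski_open \<A> T"
  shows "T \<subseteq> \<Union>(fst ` \<A>)"
    and "(V, C) \<in> \<A> \<Longrightarrow> \<exists>S\<subseteq>poly_funs C. T \<inter> V = {x \<in> V. \<exists>f\<in>S. f x \<noteq> 0}"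
  using assms unfolding zariski_open_def by (blast, fast)

lemma istopology_zariski_open: "istopology (zariski_open \<A>)"
  unfolding istopology_def
proof (intro conjI allI impI)
  fix T T' assume T: "zariski_open \<A> T" and T': "zariski_open \<A> T'"
  have "\<exists>S\<subseteq>poly_funs C. T \<inter> T' \<inter> V = {x \<in> V. \<exists>f\<in>S. f x \<noteq> 0}" if VC: "(V, C) \<in> \<A>" for V C
  proof -
    obtain S where S: "S \<subseteq> poly_funs C" "T \<inter> V = {x \<in> V. \<exists>f\<in>S. f x \<noteq> 0}"
      using zariski_openD(2)[OF T VC] by blast
    obtain S' where S': "S' \<subseteq> poly_funs C" "T' \<inter> V = {x \<in> V. \<exists>f\<in>S'. f x \<noteq> 0}"
      using zariski_openD(2)[OF T' VC] by blast
    let ?P = "{(\<lambda>x. f x * g x) | f g. f \<in> S \<and> g \<in> S'}"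
    have "?P \<subseteq> poly_funs C" using S(1) S'(1) by (blast intro: poly_funs.mult)
    moreover have "T \<inter> T' \<inter> V = {x \<in> V. \<exists>f\<in>?P. f x \<noteq> 0}"
    proof -
      have "T \<inter> T' \<inter> V = (T \<inter> V) \<inter> (T' \<inter> V)" by blast
      also have "\<dots> = {x \<in> V. (\<exists>f\<in>S. f x \<noteq> 0) \<and> (\<exists>g\<in>S'. g x \<noteq> 0)}"
        unfolding S(2) S'(2) by blast
      also have "\<dots> = {x \<in> V. \<exists>h\<in>?P. h x \<noteq> 0}"
      proof (intro Collect_cong conj_cong refl iffI)
        fix x assume "(\<exists>f\<in>S. f x \<noteq> 0) \<and> (\<exists>g\<in>S'. g x \<noteq> 0)"
        then obtain f g where "f \<in> S" "g \<in> S'" "f x * g x \<noteq> 0" by auto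
        then show "\<exists>h\<in>?P. h x \<noteq> 0" by (intro bexI[of _ "\<lambda>x. f x * g x"]) auto
      next
        fix x assume "\<exists>h\<in>?P. h x \<noteq> 0"
        then obtain f g where "f \<in> S" "g \<in> S'" "f x * g x \<noteq> 0" by auto
        then show "(\<exists>f\<in>S. f x \<noteq> 0) \<and> (\<exists>g\<in>S'. g x \<noteq> 0)" by auto
      qed
      finally show ?thesis .
    qed
    ultimately show ?thesis by blast
  qed
  then show "zariski_open \<A> (T \<inter> T')"
    using zariski_openD(1)[OF T] by (intro zariski_openI) blast+
next
  fix K assume K: "\<forall>T\<in>K. zariski_open \<A> T"
  have "\<exists>S\<subseteq>poly_funs C. \<Union>K \<inter> V = {x \<in> V. \<exists>f\<in>S. f x \<noteq> 0}" if VC: "(V, C) \<in> \<A>" for V C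
  proof -
    let ?S = "{f \<in> poly_funs C. \<forall>y\<in>V. f y \<noteq> 0 \<longrightarrow> y \<in> \<Union>K}"
    have "\<exists>f\<in>?S. f y \<noteq> 0" if "y \<in> V" "y \<in> T" "T \<in> K" for y T
    proof -
      obtain S where S: "S \<subseteq> poly_funs C" "T \<inter> V = {x \<in> V. \<exists>f\<in>S. f x \<noteq> 0}"
        using zariski_openD(2)[OF K[rule_format, OF \<open>T \<in> K\<close>] VC] by blast
      have "y \<in> T \<inter> V" using that by blast
      then obtain f where f: "f \<in> S" "f y \<noteq> 0" unfolding S(2) by blast
      have "z \<in> \<Union>K" if "z \<in> V" "f z \<noteq> 0" for z
      proof -
        have "z \<in> T \<inter> V" unfolding S(2) using f(1) that by blast
        then show ?thesis using \<open>T \<in> K\<close> by blast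
      qed
      then show ?thesis using f S(1) by blast
    qed
    then have "\<Union>K \<inter> V = {y \<in> V. \<exists>f\<in>?S. f y \<noteq> 0}" by blast
    then show ?thesis by (intro exI[of _ ?S] conjI) auto
  qed
  moreover have "\<Union>K \<subseteq> \<Union>(fst ` \<A>)"
    using zariski_openD(1) K by (intro Union_least) blast
  ultimately show "zariski_open \<A> (\<Union>K)" by (intro zariski_openI) blast+
qed

definition zariski :: "('x, 'k::field) atlas \<Rightarrow> 'x topology" where
  "zariski \<A> = topology (zariski_open \<A>)"

lemma openin_zariski: "openin (zariski \<A>) T \<longleftrightarrow> zariski_open \<A> T"
  unfolding zariski_def by (simp only: topology_inverse'[OF istopology_zariski_open])

abbreviation zar_on :: "('x, 'k::field) atlas \<Rightarrow> 'x set \<Rightarrow> 'x topology" where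
  "zar_on \<A> X \<equiv> subtopology (zariski \<A>) X"

definition locally_closed_in :: "'x topology \<Rightarrow> 'x set \<Rightarrow> bool" where
  "locally_closed_in T X \<longleftrightarrow> (\<exists>A B. openin T A \<and> closedin T B \<and> X = A \<inter> B)"

text \<open>Sections over \<open>U\<close> are stored as total functions vanishing outside \<open>U\<close>.\<close>

definition restr :: "'x set \<Rightarrow> ('x \<Rightarrow> 'a::zero) \<Rightarrow> 'x \<Rightarrow> 'a" where
  "restr V s = (\<lambda>x. if x \<in> V then s x else 0)"

text \<open>
  Regular functions on a locally closed subset \<open>U\<close> with its reduced structure. An open subset of a
  locally closed \<open>X\<close> is itself locally closed, and its regular functions do not depend on \<open>X\<close>.
\<close>

definition regular_funs :: "('x, 'k::field) atlas \<Rightarrow> 'x set \<Rightarrow> ('x \<Rightarrow> 'k) set" where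
  "regular_funs \<A> U = {f. (\<forall>x. x \<notin> U \<longrightarrow> f x = 0) \<and>
     (\<forall>x\<in>U. \<exists>(V, C)\<in>\<A>. \<exists>T. openin (zariski \<A>) T \<and> x \<in> T \<inter> V \<and>
        (\<exists>P\<in>poly_funs C. \<exists>Q\<in>poly_funs C. \<forall>y\<in>T \<inter> V \<inter> U. Q y \<noteq> 0 \<and> f y = P y / Q y))}"

text \<open>
  \<open>M \<otimes> R\<close> for a ring \<open>R\<close> of functions and a finite-dimensional vector space \<open>M\<close>, realised
  as \<open>M\<close>-valued functions: \<open>m \<otimes> f\<close> is \<open>\<lambda>x. f x \<cdot> m\<close>. With \<open>R = regular_funs \<A> U\<close> these are the
  sections of \<open>M \<otimes> \<O>\<close> over \<open>U\<close>.
\<close>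

definition tens :: "('k \<Rightarrow> 'm \<Rightarrow> 'm::ab_group_add) \<Rightarrow> ('x \<Rightarrow> 'k) set \<Rightarrow> ('x \<Rightarrow> 'm) set" where
  "tens sM R = {(\<lambda>x. \<Sum>i<N. sM (f i x) (m i)) | N f m. \<forall>i<(N::nat). f i \<in> R}"


section \<open>Sheaves\<close>

text \<open>
  A sheaf on \<open>X\<close> is a function assigning to each open subset of \<open>X\<close> its set of sections, and, to make
  equality of sheaves extensional, the empty set to everything else. The value group \<open>'m\<close> is that of
  the ambient free sheaf \<open>M \<otimes> \<O>\<close>.
\<close>

type_synonym ('x, 'm) sheaf = "'x set \<Rightarrow> ('x \<Rightarrow> 'm) set"

definition restrict_sheaf ::
  "('x, 'k::field) atlas \<Rightarrow> 'x set \<Rightarrow> ('x, 'm) sheaf \<Rightarrow> ('x, 'm) sheaf" where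
  "restrict_sheaf \<A> T F = (\<lambda>V. if openin (zar_on \<A> T) V then F V else {})"

definition submodule_sheaf ::
  "('k::field \<Rightarrow> 'm \<Rightarrow> 'm::ab_group_add) \<Rightarrow> ('x, 'k) atlas \<Rightarrow> 'x set \<Rightarrow> ('x, 'm) sheaf \<Rightarrow> bool" where
  "submodule_sheaf sM \<A> X F \<longleftrightarrow>
     (\<forall>U. \<not> openin (zar_on \<A> X) U \<longrightarrow> F U = {}) \<and>
     (\<forall>U. openin (zar_on \<A> X) U \<longrightarrow>
        F U \<subseteq> tens sM (regular_funs \<A> U) \<and>
        0 \<in> F U \<and>
        (\<forall>s\<in>F U. \<forall>t\<in>F U. s + t \<in> F U) \<and>
        (\<forall>a\<in>regular_funs \<A> U. \<forall>s\<in>F U. (\<lambda>x. sM (a x) (s x)) \<in> F U) \<and>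
        (\<forall>V s. openin (zar_on \<A> X) V \<and> V \<subseteq> U \<and> s \<in> F U \<longrightarrow> restr V s \<in> F V) \<and>
        (\<forall>s\<in>tens sM (regular_funs \<A> U).
           (\<forall>x\<in>U. \<exists>V. openin (zar_on \<A> X) V \<and> x \<in> V \<and> V \<subseteq> U \<and> restr V s \<in> F V) \<longrightarrow> s \<in> F U))"

definition finite_type ::
  "('k::field \<Rightarrow> 'm \<Rightarrow> 'm::ab_group_add) \<Rightarrow> ('x, 'k) atlas \<Rightarrow> 'x set \<Rightarrow> ('x, 'm) sheaf \<Rightarrow> bool" where
  "finite_type sM \<A> X F \<longleftrightarrow>
     (\<forall>x\<in>X. \<exists>U. openin (zar_on \<A> X) U \<and> x \<in> U \<and>
        (\<exists>(N::nat) s. (\<forall>i<N. s i \<in> F U) \<and>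
           (\<forall>V t. openin (zar_on \<A> X) V \<and> V \<subseteq> U \<and> t \<in> F V \<longrightarrow>
              (\<forall>y\<in>V. \<exists>V' a. openin (zar_on \<A> X) V' \<and> y \<in> V' \<and> V' \<subseteq> V \<and>
                 (\<forall>i<N. a i \<in> regular_funs \<A> V') \<and>
                 restr V' t = (\<lambda>z. \<Sum>i<N. sM (a i z) (s i z))))))"

text \<open>
  The sheaf on \<open>U\<close> of relations between sections \<open>s 0, \<dots>, s (N - 1)\<close>, a subsheaf of the free sheaf
  of rank \<open>N\<close>; an \<open>N\<close>-tuple is a function on \<open>nat\<close> vanishing from \<open>N\<close> on.
\<close>

definition relation_sheaf ::
  "('k::field \<Rightarrow> 'm \<Rightarrow> 'm::ab_group_add) \<Rightarrow> ('x, 'k) atlas \<Rightarrow> 'x set \<Rightarrow> nat \<Rightarrow> (nat \<Rightarrow> 'x \<Rightarrow> 'm)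
     \<Rightarrow> ('x, nat \<Rightarrow> 'k) sheaf" where
  "relation_sheaf sM \<A> U N s = (\<lambda>V. if openin (zar_on \<A> U) V then
     {a. (\<forall>i<N. (\<lambda>z. a z i) \<in> regular_funs \<A> V) \<and> (\<forall>i\<ge>N. \<forall>z. a z i = 0) \<and>
         (\<forall>z\<in>V. (\<Sum>i<N. sM (a z i) (s i z)) = 0)}
     else {})"

text \<open>Coherence in Serre's sense: finite type, and all relation sheaves are of finite type.\<close>

definition coherent_subsheaf ::
  "('k::field \<Rightarrow> 'm \<Rightarrow> 'm::ab_group_add) \<Rightarrow> ('x, 'k) atlas \<Rightarrow> 'x set \<Rightarrow> ('x, 'm) sheaf \<Rightarrow> bool" where
  "coherent_subsheaf sM \<A> X F \<longleftrightarrow>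
     submodule_sheaf sM \<A> X F \<and> finite_type sM \<A> X F \<and>
     (\<forall>U N s. openin (zar_on \<A> X) U \<and> (\<forall>i<N. s i \<in> F U) \<longrightarrow>
        finite_type (\<lambda>c v i. c * v i) \<A> U (relation_sheaf sM \<A> U N s))"

text \<open>
  Pull-back of a subsheaf of \<open>M \<otimes> \<O>\<^sub>X\<close> along \<open>q : Y \<rightarrow> X\<close>, as a subsheaf of \<open>M \<otimes> \<O>\<^sub>Y\<close>: the image
  of \<open>q\<^sup>*F \<rightarrow> q\<^sup>*(M \<otimes> \<O>\<^sub>X) = M \<otimes> \<O>\<^sub>Y\<close>. For flat \<open>q\<close>, in particular for a torsor, that map is
  injective, so this is \<open>q\<^sup>*F\<close> itself.
\<close>

definition pullback_subsheaf ::
  "('k::field \<Rightarrow> 'm \<Rightarrow> 'm::ab_group_add) \<Rightarrow> ('x, 'k) atlas \<Rightarrow> 'x set \<Rightarrow> ('y, 'k) atlas \<Rightarrow> 'y set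
     \<Rightarrow> ('y \<Rightarrow> 'x) \<Rightarrow> ('x, 'm) sheaf \<Rightarrow> ('y, 'm) sheaf" where
  "pullback_subsheaf sM \<A> X \<B> Y q F = (\<lambda>V. if openin (zar_on \<B> Y) V then
     {t \<in> tens sM (regular_funs \<B> V). \<forall>y\<in>V. \<exists>V' U.
        openin (zar_on \<B> Y) V' \<and> y \<in> V' \<and> V' \<subseteq> V \<and> openin (zar_on \<A> X) U \<and> q ` V' \<subseteq> U \<and>
        (\<exists>(N::nat) a s. (\<forall>i<N. a i \<in> regular_funs \<B> V' \<and> s i \<in> F U) \<and>
           restr V' t = (\<lambda>z. \<Sum>i<N. sM (a i z) (s i (q z))))}
     else {})"

definition descend ::
  "('k::field \<Rightarrow> 'm \<Rightarrow> 'm::ab_group_add) \<Rightarrow> ('x, 'k) atlas \<Rightarrow> 'x set \<Rightarrow> ('y, 'k) atlas \<Rightarrow> 'y set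
     \<Rightarrow> ('y \<Rightarrow> 'x) \<Rightarrow> ('y, 'm) sheaf \<Rightarrow> ('x, 'm) sheaf" where
  "descend sM \<A> X \<B> Y q G =
     (THE F. coherent_subsheaf sM \<A> X F \<and> pullback_subsheaf sM \<A> X \<B> Y q F = G)"

text \<open>
  The coordinate ring of the closed subset \<open>Z\<close> of the chart with coordinates \<open>C\<close>, and the sheaf on
  \<open>Z\<close> associated with a submodule \<open>N\<close> of \<open>M \<otimes> k[Z]\<close>, whose sections are locally fractions
  \<open>m / g\<close> with \<open>m \<in> N\<close> and \<open>g \<in> k[Z]\<close>.
\<close>

definition coord_ring :: "('x \<Rightarrow> 'k::field) set \<Rightarrow> 'x set \<Rightarrow> ('x \<Rightarrow> 'k) set" where
  "coord_ring C Z = restr Z ` poly_funs C"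

definition assoc_sheaf ::
  "('k::field \<Rightarrow> 'm \<Rightarrow> 'm::ab_group_add) \<Rightarrow> ('x, 'k) atlas \<Rightarrow> 'x set \<Rightarrow> ('x \<Rightarrow> 'k) set
     \<Rightarrow> ('x \<Rightarrow> 'm) set \<Rightarrow> ('x, 'm) sheaf" where
  "assoc_sheaf sM \<A> Z R N = (\<lambda>V. if openin (zar_on \<A> Z) V then
     {t. (\<forall>z. z \<notin> V \<longrightarrow> t z = 0) \<and>
         (\<forall>y\<in>V. \<exists>V' m g. openin (zar_on \<A> Z) V' \<and> y \<in> V' \<and> V' \<subseteq> V \<and> m \<in> N \<and> g \<in> R \<and>
            (\<forall>z\<in>V'. g z \<noteq> 0 \<and> t z = sM (inverse (g z)) (m z)))}
     else {})"


section \<open>The operators \<open>\<Theta>\<close>\<close>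

definition multi_exps :: "nat \<Rightarrow> nat \<Rightarrow> (nat \<Rightarrow> nat) set" where
  "multi_exps r j = {J. (\<forall>l. l \<notin> {1..r} \<longrightarrow> J l = 0) \<and> (\<Sum>l=1..r. J l) = j}"

text \<open>\<open>\<theta>\<^sub>1\<^bsup>J 1\<^esup> \<circ> \<dots> \<circ> \<theta>\<^sub>r\<^bsup>J r\<^esup>\<close>\<close>

definition op_monomial :: "(nat \<Rightarrow> 'a \<Rightarrow> 'a) \<Rightarrow> nat \<Rightarrow> (nat \<Rightarrow> nat) \<Rightarrow> 'a \<Rightarrow> 'a" where
  "op_monomial \<theta> r J = foldr (\<lambda>l g. (\<theta> l ^^ J l) \<circ> g) [1..<Suc r] id"

definition im_module ::
  "(nat \<Rightarrow> ('x \<Rightarrow> 'm) \<Rightarrow> 'x \<Rightarrow> 'm::ab_group_add) \<Rightarrow> nat \<Rightarrow> nat \<Rightarrow> ('x \<Rightarrow> 'm) set \<Rightarrow> ('x \<Rightarrow> 'm) set" where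
  "im_module \<theta> r j A =
     {(\<Sum>J\<in>multi_exps r j. op_monomial \<theta> r J (f J)) | f. \<forall>J\<in>multi_exps r j. f J \<in> A}"

definition ker_module ::
  "(nat \<Rightarrow> ('x \<Rightarrow> 'm) \<Rightarrow> 'x \<Rightarrow> 'm::ab_group_add) \<Rightarrow> nat \<Rightarrow> nat \<Rightarrow> ('x \<Rightarrow> 'm) set \<Rightarrow> ('x \<Rightarrow> 'm) set" where
  "ker_module \<theta> r j A = {f \<in> A. \<forall>J\<in>multi_exps r j. op_monomial \<theta> r J f = 0}"

definition im_sheaf ::
  "('k::field \<Rightarrow> 'm \<Rightarrow> 'm::ab_group_add) \<Rightarrow> ('x, 'k) atlas \<Rightarrow> 'x set
     \<Rightarrow> (nat \<Rightarrow> ('x \<Rightarrow> 'm) \<Rightarrow> 'x \<Rightarrow> 'm) \<Rightarrow> nat \<Rightarrow> nat \<Rightarrow> ('x, 'm) sheaf" where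
  "im_sheaf sM \<A> X \<theta> r j = (\<lambda>V. if openin (zar_on \<A> X) V then
     {t \<in> tens sM (regular_funs \<A> V). \<forall>y\<in>V. \<exists>V'. openin (zar_on \<A> X) V' \<and> y \<in> V' \<and> V' \<subseteq> V \<and>
        restr V' t \<in> im_module \<theta> r j (tens sM (regular_funs \<A> V'))}
     else {})"

definition ker_sheaf ::
  "('k::field \<Rightarrow> 'm \<Rightarrow> 'm::ab_group_add) \<Rightarrow> ('x, 'k) atlas \<Rightarrow> 'x set
     \<Rightarrow> (nat \<Rightarrow> ('x \<Rightarrow> 'm) \<Rightarrow> 'x \<Rightarrow> 'm) \<Rightarrow> nat \<Rightarrow> nat \<Rightarrow> ('x, 'm) sheaf" where
  "ker_sheaf sM \<A> X \<theta> r j = (\<lambda>V. if openin (zar_on \<A> X) V then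
     ker_module \<theta> r j (tens sM (regular_funs \<A> V)) else {})"


section \<open>Restricted Lie algebras and restricted enveloping algebras\<close>

text \<open>The coefficient of \<open>t\<^sup>i\<close> in \<open>(ad (t x + y))\<^sup>m (x)\<close>.\<close>

fun ad_coeff :: "('g \<Rightarrow> 'g \<Rightarrow> 'g::ab_group_add) \<Rightarrow> 'g \<Rightarrow> 'g \<Rightarrow> nat \<Rightarrow> nat \<Rightarrow> 'g" where
  "ad_coeff br x y 0 i = (if i = 0 then x else 0)"
| "ad_coeff br x y (Suc m) i =
     (if i = 0 then 0 else br x (ad_coeff br x y m (i - 1))) + br y (ad_coeff br x y m i)"

text \<open>
  The \<open>i\<close>-th correction term in \<open>pm_add\<close> is Jacobson's \<open>s\<^sub>i(x, y)\<close>: \<open>i s\<^sub>i(x, y)\<close> is the coefficient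
  of \<open>t\<^bsup>i-1\<^esup>\<close> in \<open>(ad (t x + y))\<^bsup>p-1\<^esup> (x)\<close>.
\<close>

locale restricted_lie_algebra = vector_space sG
  for sG :: "'k::field \<Rightarrow> 'g::ab_group_add \<Rightarrow> 'g" +
  fixes br :: "'g \<Rightarrow> 'g \<Rightarrow> 'g" and pm :: "'g \<Rightarrow> 'g"
  assumes char_pos: "CHAR('k) > 0"
    and br_linear_left: "\<And>y. Vector_Spaces.linear sG sG (\<lambda>x. br x y)"
    and br_linear_right: "\<And>x. Vector_Spaces.linear sG sG (br x)"
    and br_alternating: "\<And>x. br x x = 0"
    and jacobi: "\<And>x y z. br x (br y z) + br y (br z x) + br z (br x y) = 0"
    and pm_scale: "\<And>c x. pm (sG c x) = sG (c ^ CHAR('k)) (pm x)"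
    and pm_ad: "\<And>x y. br (pm x) y = (br x ^^ CHAR('k)) y"
    and pm_add: "\<And>x y. pm (x + y) = pm x + pm y +
      (\<Sum>i=1..CHAR('k) - 1. sG (inverse (of_nat i)) (ad_coeff br x y (CHAR('k) - 1) (i - 1)))"

text \<open>
  The tensor algebra of \<open>\<gg>\<close> is presented as the free associative algebra on the set \<open>\<gg>\<close>
  (finitely supported functions on words, with convolution) modulo linearity of the generators.
\<close>

definition free_algebra :: "('g list \<Rightarrow> 'k::field) ring" where
  "free_algebra = \<lparr>carrier = {f. finite {w. f w \<noteq> 0}},
     mult = (\<lambda>f g w. \<Sum>i\<le>length w. f (take i w) * g (drop i w)),
     one = (\<lambda>w. if w = [] then 1 else 0),
     zero = (\<lambda>_. 0),
     add = (\<lambda>f g w. f w + g w)\<rparr>"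

definition word :: "'k::field \<Rightarrow> 'g list \<Rightarrow> 'g list \<Rightarrow> 'k" where
  "word c v = (\<lambda>w. if w = v then c else 0)"

lemma finite_support_conv:
  fixes f g :: "'g list \<Rightarrow> 'k::field"
  assumes "finite {w. f w \<noteq> 0}" "finite {w. g w \<noteq> 0}"
  shows "finite {w. (\<Sum>i\<le>length w. f (take i w) * g (drop i w)) \<noteq> 0}"
proof (rule finite_subset)
  show "finite ((\<lambda>(u, v). u @ v) ` ({w. f w \<noteq> 0} \<times> {w. g w \<noteq> 0}))" using assms by simp
  show "{w. (\<Sum>i\<le>length w. f (take i w) * g (drop i w)) \<noteq> 0}
    \<subseteq> (\<lambda>(u, v). u @ v) ` ({w. f w \<noteq> 0} \<times> {w. g w \<noteq> 0})"
  proof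
    fix w assume "w \<in> {w. (\<Sum>i\<le>length w. f (take i w) * g (drop i w)) \<noteq> 0}"
    then have "\<not> (\<forall>i\<in>{..length w}. f (take i w) * g (drop i w) = 0)"
      using sum.neutral[of "{..length w}" "\<lambda>i. f (take i w) * g (drop i w)"] by blast
    then obtain i where "f (take i w) \<noteq> 0" "g (drop i w) \<noteq> 0" by auto
    then show "w \<in> (\<lambda>(u, v). u @ v) ` ({w. f w \<noteq> 0} \<times> {w. g w \<noteq> 0})"
      by (intro image_eqI[of _ _ "(take i w, drop i w)"]) auto
  qed
qed

lemma conv_assoc:
  fixes f g h :: "'g list \<Rightarrow> 'k::field"
  shows "(\<Sum>i\<le>length w. (\<Sum>k\<le>length (take i w). f (take k (take i w)) * g (drop k (take i w))) * h (drop i w))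
    = (\<Sum>k\<le>length w. f (take k w) *
        (\<Sum>l\<le>length (drop k w). g (take l (drop k w)) * h (drop l (drop k w))))"
    (is "?L = ?R")
proof -
  let ?n = "length w"
  have "?L = (\<Sum>i\<le>?n. \<Sum>k\<le>i. f (take k w) * g (drop k (take i w)) * h (drop i w))"
    by (intro sum.cong refl) (auto simp: sum_distrib_right min_def intro!: sum.cong)
  also have "\<dots> = (\<Sum>(i, k)\<in>Sigma {..?n} (\<lambda>i. {..i}). f (take k w) * g (drop k (take i w)) * h (drop i w))"
    by (simp add: sum.Sigma)
  also have "\<dots> = (\<Sum>(k, l)\<in>Sigma {..?n} (\<lambda>k. {..?n - k}).
      f (take k w) * (g (take l (drop k w)) * h (drop l (drop k w))))"
    by (rule sum.reindex_bij_witness[of _ "\<lambda>(k, l). (k + l, k)" "\<lambda>(i, k). (k, i - k)"])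
       (auto simp: drop_take add.commute mult.assoc)
  also have "\<dots> = ?R"
    by (simp add: sum.Sigma[symmetric] sum_distrib_left)
  finally show ?thesis .
qed

lemma ring_free_algebra: "ring (free_algebra :: ('g list \<Rightarrow> 'k::field) ring)"
proof (rule ringI)
  let ?A = "free_algebra :: ('g list \<Rightarrow> 'k::field) ring"
  have add_closed: "finite {w. f w + g w \<noteq> 0}"
    if "finite {w. f w \<noteq> 0}" "finite {w. g w \<noteq> 0}" for f g :: "'g list \<Rightarrow> 'k"
    by (rule finite_subset[OF _ finite_UnI[OF that]]) auto
  show "abelian_group ?A"
  proof (rule abelian_groupI)
    fix f assume "f \<in> carrier ?A"
    then show "\<exists>g\<in>carrier ?A. g \<oplus>\<^bsub>?A\<^esub> f = \<zero>\<^bsub>?A\<^esub>"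
      by (intro bexI[of _ "\<lambda>w. - f w"]) (auto simp: free_algebra_def)
  qed (use add_closed in \<open>auto simp: free_algebra_def add.assoc add.commute\<close>)
  show "Group.monoid ?A"
  proof (rule Group.monoidI)
    fix f assume "f \<in> carrier ?A"
    have "(\<Sum>i\<le>length w. (if take i w = [] then 1 else 0) * f (drop i w)) = f w" for w
    proof -
      have "(\<Sum>i\<le>length w. (if take i w = [] then 1 else 0) * f (drop i w))
        = (\<Sum>i\<le>length w. if i = 0 then f w else 0)"
        by (rule sum.cong) auto
      then show ?thesis by simp
    qed
    then show "\<one>\<^bsub>?A\<^esub> \<otimes>\<^bsub>?A\<^esub> f = f" by (simp add: free_algebra_def)
    have "(\<Sum>i\<le>length w. f (take i w) * (if drop i w = [] then 1 else 0)) = f w" for w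
    proof -
      have "(\<Sum>i\<le>length w. f (take i w) * (if drop i w = [] then 1 else 0))
        = (\<Sum>i\<le>length w. if i = length w then f w else 0)"
        by (rule sum.cong) auto
      then show ?thesis by simp
    qed
    then show "f \<otimes>\<^bsub>?A\<^esub> \<one>\<^bsub>?A\<^esub> = f" by (simp add: free_algebra_def)
  next
    fix f g h
    show "f \<otimes>\<^bsub>?A\<^esub> g \<otimes>\<^bsub>?A\<^esub> h = f \<otimes>\<^bsub>?A\<^esub> (g \<otimes>\<^bsub>?A\<^esub> h)"
      unfolding free_algebra_def by (simp only: monoid.simps) (rule ext, rule conv_assoc)
  next
    fix f g assume "f \<in> carrier ?A" "g \<in> carrier ?A"
    then show "f \<otimes>\<^bsub>?A\<^esub> g \<in> carrier ?A"
      by (simp add: free_algebra_def finite_support_conv)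
  next
    show "\<one>\<^bsub>?A\<^esub> \<in> carrier ?A" by (simp add: free_algebra_def)
  qed
qed (auto simp: free_algebra_def sum.distrib distrib_left distrib_right)

definition endo_ring :: "('k::field \<Rightarrow> 'm \<Rightarrow> 'm::ab_group_add) \<Rightarrow> ('m \<Rightarrow> 'm) ring" where
  "endo_ring sM = \<lparr>carrier = {f. Vector_Spaces.linear sM sM f}, mult = (\<circ>), one = id,
     zero = (\<lambda>_. 0), add = (\<lambda>f g v. f v + g v)\<rparr>"

context restricted_lie_algebra
begin

text \<open>
  Linearity of the generators, \<open>x y - y x = [x, y]\<close>, and \<open>x\<^sup>p = x\<^bsup>[p]\<^esup>\<close>.
\<close>

definition enveloping_relations :: "('g list \<Rightarrow> 'k) set" where
  "enveloping_relations =
     {word 1 [x + y] - word 1 [x] - word 1 [y] | x y. True} \<union>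
     {word 1 [sG c x] - word c [x] | c x. True} \<union>
     {word 1 [x, y] - word 1 [y, x] - word 1 [br x y] | x y. True} \<union>
     {word 1 (replicate CHAR('k) x) - word 1 [pm x] | x. True}"

definition enveloping_ideal :: "('g list \<Rightarrow> 'k) set" where
  "enveloping_ideal = genideal free_algebra enveloping_relations"

definition restricted_enveloping_algebra :: "('g list \<Rightarrow> 'k) set ring" where
  "restricted_enveloping_algebra = free_algebra Quot enveloping_ideal"

text \<open>The image in \<open>\<uu>(\<gg>)\<close> of the word \<open>v\<close> with coefficient \<open>c\<close>.\<close>

definition u_word :: "'k \<Rightarrow> 'g list \<Rightarrow> ('g list \<Rightarrow> 'k) set" where
  "u_word c v = enveloping_ideal +>\<^bsub>free_algebra\<^esub> word c v"

end

text \<open>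
  A module over \<open>\<uu>(\<gg>)\<close> is an algebra homomorphism \<open>\<rho>\<close> to the endomorphisms of a vector space. The
  vectors \<open>x 1, \<dots>, x n\<close> are the fixed basis of \<open>\<gg>\<close>.
\<close>

locale restricted_module = restricted_lie_algebra sG br pm
  for sG :: "'k::field \<Rightarrow> 'g::ab_group_add \<Rightarrow> 'g" and br pm +
  fixes x :: "nat \<Rightarrow> 'g" and n :: nat
    and sM :: "'k \<Rightarrow> 'm::ab_group_add \<Rightarrow> 'm"
    and \<rho> :: "('g list \<Rightarrow> 'k) set \<Rightarrow> 'm \<Rightarrow> 'm"
  assumes basis_inj: "inj_on x {1..n}"
    and basis: "finite_dimensional_vector_space sG (x ` {1..n})"
    and M_fin_dim: "\<exists>B. finite_dimensional_vector_space sM B"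
    and \<rho>_hom: "\<rho> \<in> ring_hom restricted_enveloping_algebra (endo_ring sM)"
    and \<rho>_scalar: "\<And>c. \<rho> (u_word c []) = sM c"
begin

definition act :: "'g \<Rightarrow> 'm \<Rightarrow> 'm" where
  "act a = \<rho> (u_word 1 [a])"

definition coord :: "nat \<Rightarrow> 'g \<Rightarrow> 'k" where
  "coord i v = representation (x ` {1..n}) v (x i)"

definition Theta :: "(nat \<Rightarrow> nat \<Rightarrow> 'x \<Rightarrow> 'k) \<Rightarrow> nat \<Rightarrow> ('x \<Rightarrow> 'm) \<Rightarrow> 'x \<Rightarrow> 'm" where
  "Theta Y s f = (\<lambda>z. \<Sum>i=1..n. sM (Y i s z) (act (x i) (f z)))"


section \<open>Grassmannian and elementary subalgebras\<close>

definition Grass :: "nat \<Rightarrow> 'g set set" where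
  "Grass r = {L. subspace L \<and> dim L = r}"

definition elementary :: "'g set \<Rightarrow> bool" where
  "elementary L \<longleftrightarrow> subspace L \<and> (\<forall>a\<in>L. \<forall>b\<in>L. br a b = 0) \<and> (\<forall>a\<in>L. pm a = 0)"

definition Elem :: "nat \<Rightarrow> 'g set set" where
  "Elem r = {L \<in> Grass r. elementary L}"

definition chart :: "nat \<Rightarrow> nat set \<Rightarrow> 'g set set" where
  "chart r S = {L \<in> Grass r. bij_betw (\<lambda>v. restrict (\<lambda>i. coord i v) S) L (S \<rightarrow>\<^sub>E UNIV)}"

text \<open>\<open>idx S s\<close> is the \<open>s\<close>-th smallest element \<open>i\<^sub>s\<close> of \<open>S\<close>, counted from 1.\<close>

definition idx :: "nat set \<Rightarrow> nat \<Rightarrow> nat" where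
  "idx S s = sorted_list_of_set S ! (s - 1)"

text \<open>The \<open>n \<times> r\<close> matrix with identity block in the rows indexed by \<open>S\<close> and column span \<open>L\<close>.\<close>

definition chart_matrix :: "nat \<Rightarrow> nat set \<Rightarrow> 'g set \<Rightarrow> nat \<Rightarrow> nat \<Rightarrow> 'k" where
  "chart_matrix r S L = (THE A.
     (\<forall>i s. i \<notin> {1..n} \<or> s \<notin> {1..r} \<longrightarrow> A i s = 0) \<and>
     (\<forall>s\<in>{1..r}. \<forall>s'\<in>{1..r}. A (idx S s') s = (if s' = s then 1 else 0)) \<and>
     L = span ((\<lambda>s. \<Sum>i=1..n. sG (A i s) (x i)) ` {1..r}))"

definition chart_coords :: "nat \<Rightarrow> nat set \<Rightarrow> ('g set \<Rightarrow> 'k) set" where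
  "chart_coords r S = {\<lambda>L. chart_matrix r S L i s | i s. i \<in> {1..n} \<and> s \<in> {1..r}}"

definition Grass_atlas :: "nat \<Rightarrow> ('g set, 'k) atlas" where
  "Grass_atlas r = {(chart r S, chart_coords r S) | S. S \<subseteq> {1..n} \<and> card S = r}"

definition Elem_top :: "nat \<Rightarrow> 'g set topology" where
  "Elem_top r = zar_on (Grass_atlas r) (Elem r)"


section \<open>The torsor and the sheaves defined by descent\<close>

text \<open>An \<open>r\<close>-tuple is a function on \<open>nat\<close> vanishing outside \<open>{1..r}\<close>.\<close>

definition tuple_space :: "nat \<Rightarrow> (nat \<Rightarrow> 'g) set" where
  "tuple_space r = {T. \<forall>s. s \<notin> {1..r} \<longrightarrow> T s = 0}"

definition tuple_coord :: "nat \<Rightarrow> nat \<Rightarrow> (nat \<Rightarrow> 'g) \<Rightarrow> 'k" where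
  "tuple_coord i s T = coord i (T s)"

definition tuple_atlas :: "nat \<Rightarrow> (nat \<Rightarrow> 'g, 'k) atlas" where
  "tuple_atlas r = {(tuple_space r, {tuple_coord i s | i s. i \<in> {1..n} \<and> s \<in> {1..r}})}"

definition comm_tuples :: "nat \<Rightarrow> (nat \<Rightarrow> 'g) set" where
  "comm_tuples r = {T \<in> tuple_space r. inj_on T {1..r} \<and> independent (T ` {1..r}) \<and>
     (\<forall>s\<in>{1..r}. \<forall>t\<in>{1..r}. br (T s) (T t) = 0) \<and> (\<forall>s\<in>{1..r}. pm (T s) = 0)}"

definition quot :: "nat \<Rightarrow> (nat \<Rightarrow> 'g) \<Rightarrow> 'g set" where
  "quot r T = span (T ` {1..r})"

definition tilde :: "nat \<Rightarrow> 'g set set \<Rightarrow> (nat \<Rightarrow> 'g) set" where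
  "tilde r X = {T \<in> comm_tuples r. quot r T \<in> X}"

definition Im_descent :: "nat \<Rightarrow> nat \<Rightarrow> 'g set set \<Rightarrow> ('g set, 'm) sheaf" where
  "Im_descent r j X = descend sM (Grass_atlas r) X (tuple_atlas r) (tilde r X) (quot r)
     (im_sheaf sM (tuple_atlas r) (tilde r X) (Theta tuple_coord) r j)"

definition Ker_descent :: "nat \<Rightarrow> nat \<Rightarrow> 'g set set \<Rightarrow> ('g set, 'm) sheaf" where
  "Ker_descent r j X = descend sM (Grass_atlas r) X (tuple_atlas r) (tilde r X) (quot r)
     (ker_sheaf sM (tuple_atlas r) (tilde r X) (Theta tuple_coord) r j)"


section \<open>The sheaves defined by charts\<close>

definition chart_fun :: "nat \<Rightarrow> nat set \<Rightarrow> 'g set set \<Rightarrow> nat \<Rightarrow> nat \<Rightarrow> 'g set \<Rightarrow> 'k" where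
  "chart_fun r S Z i s = restr Z (\<lambda>L. chart_matrix r S L i s)"

text \<open>In the following two definitions \<open>W\<close> is closed in \<open>Elem r\<close>, and the sheaves live on
  \<open>W\<^sub>S = W \<inter> chart r S\<close>.\<close>

definition Im_chart :: "nat \<Rightarrow> nat \<Rightarrow> nat set \<Rightarrow> 'g set set \<Rightarrow> ('g set, 'm) sheaf" where
  "Im_chart r j S W = (let Z = W \<inter> chart r S; R = coord_ring (chart_coords r S) Z in
     assoc_sheaf sM (Grass_atlas r) Z R
       (im_module (Theta (chart_fun r S Z)) r j (tens sM R)))"

definition Ker_chart :: "nat \<Rightarrow> nat \<Rightarrow> nat set \<Rightarrow> 'g set set \<Rightarrow> ('g set, 'm) sheaf" where
  "Ker_chart r j S W = (let Z = W \<inter> chart r S; R = coord_ring (chart_coords r S) Z in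
     assoc_sheaf sM (Grass_atlas r) Z R
       (ker_module (Theta (chart_fun r S Z)) r j (tens sM R)))"

end

end

theory Submission
  imports Defs "Jordan_Normal_Form.Determinant"
begin

text \<open>
  Over the chart of \<open>S\<close> the torsor \<open>q\<close> has the section \<open>\<sigma>\<close> that sends \<open>L\<close> to its basis with the
  identity matrix in the rows \<open>S\<close>, and the operators of the chart at \<open>L\<close> are the operators of the
  torsor at \<open>\<sigma> L\<close>. So it has to be shown that the descended sheaves are obtained by pulling back along
  \<open>\<sigma>\<close>, and that the sections found in this way are, locally, fractions of sections over the closed set
  \<open>W\<close>.

  A sheaf \<open>F\<close> with pull-back \<open>G\<close> must consist of the sections \<open>t\<close> of \<open>M \<otimes> \<O>\<close> for which \<open>t \<circ> q\<close> lies in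
  \<open>G\<close> (\<open>pullback_determines\<close>): an expression of \<open>t \<circ> q\<close> through sections of \<open>F\<close> turns into an expression
  of \<open>t\<close> when it is pulled back along a local section of \<open>q\<close>. This candidate \<open>desc G\<close> has the pull-back
  \<open>G\<close> as soon as the sections of \<open>G\<close> are, locally, combinations of pull-backs (\<open>descend_eq_desc\<close>). Every
  basis \<open>T\<close> of \<open>L\<close> is of the form \<open>\<sigma> L \<cdot> g\<close> with an invertible matrix \<open>g\<close>. For the image sheaf one
  expands a monomial of degree \<open>j\<close> in \<open>T\<close> into monomials of degree \<open>j\<close> in \<open>\<sigma> L\<close>, with polynomials in
  \<open>g\<close> as coefficients (\<open>mon_tmul\<close>); here it matters that the elements of \<open>L\<close> commute and hence act by
  commuting operators. For the kernel sheaf one writes a section as a fraction with a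
  polynomial numerator \<open>p\<close>. As a function of \<open>g\<close>, the value \<open>p (\<sigma> L \<cdot> g)\<close> can be interpolated: it is a
  combination of the values at finitely many matrices \<open>g\<^sub>l\<close>, with coefficients independent of \<open>L\<close>. If
  \<open>\<sigma> L \<cdot> g\<^sub>l\<close> is in the domain of the section, then \<open>p (\<sigma> L \<cdot> g\<^sub>l)\<close> is in the kernel
  (\<open>Ker_tilde_generated\<close>).

  The descended sheaf is also required to be coherent. The image sheaf is generated on a chart by the
  images of constant sections. The kernel sheaf, and all sheaves of relations, consist of the sections
  of a free sheaf with values in given subspaces of the fibres. Such a sheaf is of finite type
  (\<open>finite_type_pointwise\<close>), because by Hilbert's basis theorem its polynomial sections over a chart form
  a finitely generated module.

  Finally, over a chart finitely many regular functions have, locally, a common denominator, and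
  the numerators are polynomials in the coordinates of the chart, so they are defined on all of \<open>W\<close>. For
  the image sheaf this is all that is needed (\<open>Im_chart_eq\<close>). For the kernel sheaf the numerator is first
  multiplied with a polynomial that vanishes outside the domain of the section, so that it lies in the kernel
  over all of \<open>W\<close> (\<open>Ker_chart_eq\<close>). The domain is open in \<open>W\<close> since \<open>X\<close> is locally closed.
\<close>


section \<open>Polynomial functions\<close>

lemma poly_funs_sum:
  assumes "\<And>i. i \<in> I \<Longrightarrow> f i \<in> poly_funs C"
  shows "(\<lambda>x. \<Sum>i\<in>I. f i x) \<in> poly_funs C"
  using assms
  by (induction I rule: infinite_finite_induct) (auto intro: poly_funs.intros)

lemma poly_funs_prod:
  assumes "\<And>i. i \<in> I \<Longrightarrow> f i \<in> poly_funs C"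
  shows "(\<lambda>x. \<Prod>i\<in>I. f i x) \<in> poly_funs C"
  using assms
  by (induction I rule: infinite_finite_induct) (auto intro: poly_funs.intros)

lemma poly_funs_power: "f \<in> poly_funs C \<Longrightarrow> (\<lambda>x. f x ^ m) \<in> poly_funs C"
  by (induction m) (auto intro: poly_funs.intros)

lemma poly_funs_minus: "f \<in> poly_funs C \<Longrightarrow> (\<lambda>x. - f x) \<in> poly_funs C"
  using poly_funs.mult[OF poly_funs.const[of "-1"]] by fastforce

text \<open>
  Changes of charts and morphisms are given by fractions with a common denominator \<open>D\<close>; a power of \<open>D\<close>
  that bounds the degree clears the denominators after the substitution.
\<close>

lemma poly_funs_frac:
  fixes D :: "'y \<Rightarrow> 'k::field"
  assumes D: "D \<in> poly_funs C" "\<And>x. x \<in> E \<Longrightarrow> D x \<noteq> 0"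
    and coord: "\<And>c. c \<in> C' \<Longrightarrow> \<exists>P\<in>poly_funs C. \<forall>x\<in>E. c (\<phi> x) = P x / D x"
    and f: "f \<in> poly_funs C'"
  shows "\<exists>P\<in>poly_funs C. \<exists>m. \<forall>x\<in>E. f (\<phi> x) = P x / D x ^ m"
  using f
proof induction
  case (const c)
  show ?case by (intro bexI[of _ "\<lambda>_. c"] exI[of _ 0]) (auto intro: poly_funs.const)
next
  case (coord c)
  then obtain P where "P \<in> poly_funs C" "\<forall>x\<in>E. c (\<phi> x) = P x / D x" using assms(3) by blast
  then show ?case by (intro bexI[of _ P] exI[of _ 1]) auto
next
  case (add f g)
  then obtain P m P' m' where P: "P \<in> poly_funs C" "\<forall>x\<in>E. f (\<phi> x) = P x / D x ^ m"
    "P' \<in> poly_funs C" "\<forall>x\<in>E. g (\<phi> x) = P' x / D x ^ m'" by blast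
  have "(\<lambda>x. P x * D x ^ m' + P' x * D x ^ m) \<in> poly_funs C"
    using P D by (intro poly_funs.add poly_funs.mult poly_funs_power) auto
  moreover have "f (\<phi> x) + g (\<phi> x) = (P x * D x ^ m' + P' x * D x ^ m) / D x ^ (m + m')"
    if "x \<in> E" for x using that P D(2)[of x] by (simp add: field_simps power_add)
  ultimately show ?case by (intro bexI exI[of _ "m + m'"]) auto
next
  case (mult f g)
  then obtain P m P' m' where P: "P \<in> poly_funs C" "\<forall>x\<in>E. f (\<phi> x) = P x / D x ^ m"
    "P' \<in> poly_funs C" "\<forall>x\<in>E. g (\<phi> x) = P' x / D x ^ m'" by blast
  have "(\<lambda>x. P x * P' x) \<in> poly_funs C"
    using P by (intro poly_funs.mult) auto
  moreover have "f (\<phi> x) * g (\<phi> x) = (P x * P' x) / D x ^ (m + m')"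
    if "x \<in> E" for x using that P D(2)[of x] by (simp add: field_simps power_add)
  ultimately show ?case by (intro bexI exI[of _ "m + m'"]) auto
qed


section \<open>Polynomial functions form a Noetherian ring\<close>

definition subring_on :: "'r::comm_ring_1 set \<Rightarrow> bool" where
  "subring_on R \<longleftrightarrow> 0 \<in> R \<and> 1 \<in> R \<and> (\<forall>a\<in>R. \<forall>b\<in>R. a + b \<in> R \<and> a * b \<in> R) \<and> (\<forall>a\<in>R. - a \<in> R)"

text \<open>
  The basis theorem passes from a ring \<open>R\<close> to \<open>R[f]\<close>. Rings are therefore sets of elements of one ring
  type, and spans and submodules are taken with respect to such a set of scalars.
\<close>

definition tuple_scale :: "'r::comm_ring_1 \<Rightarrow> (nat \<Rightarrow> 'r) \<Rightarrow> nat \<Rightarrow> 'r" where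
  "tuple_scale c v = (\<lambda>i. c * v i)"

lemma tuple_scale_apply: "tuple_scale c v i = c * v i"
  by (simp add: tuple_scale_def)

inductive_set rspan :: "('r \<Rightarrow> 'v \<Rightarrow> 'v::ab_group_add) \<Rightarrow> 'r set \<Rightarrow> 'v set \<Rightarrow> 'v set"
  for sc R G where
  zero: "0 \<in> rspan sc R G"
| step: "a \<in> R \<Longrightarrow> g \<in> G \<Longrightarrow> v \<in> rspan sc R G \<Longrightarrow> sc a g + v \<in> rspan sc R G"

definition submod :: "('r \<Rightarrow> 'v \<Rightarrow> 'v::ab_group_add) \<Rightarrow> 'r set \<Rightarrow> 'v set \<Rightarrow> bool" where
  "submod sc R N \<longleftrightarrow> 0 \<in> N \<and> (\<forall>u\<in>N. \<forall>v\<in>N. u + v \<in> N) \<and> (\<forall>a\<in>R. \<forall>v\<in>N. sc a v \<in> N)"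

definition noetherian_on :: "'r::comm_ring_1 set \<Rightarrow> bool" where
  "noetherian_on R \<longleftrightarrow> (\<forall>I. I \<subseteq> R \<and> submod (*) R I \<longrightarrow> (\<exists>G. finite G \<and> G \<subseteq> I \<and> I \<subseteq> rspan (*) R G))"

lemma noetherian_onD:
  assumes "noetherian_on R" "submod (*) R I" "I \<subseteq> R"
  obtains G where "finite G" "G \<subseteq> I" "I \<subseteq> rspan (*) R G"
proof -
  have "\<exists>G. finite G \<and> G \<subseteq> I \<and> I \<subseteq> rspan (*) R G"
    by (rule mp[OF spec[OF assms(1)[unfolded noetherian_on_def]]]) (simp only: assms(2,3) simp_thms)
  then show ?thesis using that by (elim exE conjE) 
qed

lemma rspan_add:
  assumes "u \<in> rspan sc R G" "v \<in> rspan sc R G"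
  shows "u + v \<in> rspan sc R G"
  using assms by induction (auto simp: add.assoc intro: rspan.step)

lemma rspan_mono: "v \<in> rspan sc R G \<Longrightarrow> R \<subseteq> R' \<Longrightarrow> G \<subseteq> G' \<Longrightarrow> v \<in> rspan sc R' G'"
  by (induction rule: rspan.induct) (auto intro: rspan.intros)

lemma rspan_scale:
  fixes R :: "'r::comm_ring_1 set"
  assumes "v \<in> rspan (*) R G" "a \<in> R" "subring_on R"
  shows "a * v \<in> rspan (*) R G"
  using assms(1)
proof induction
  case (step b g v)
  have "(a * b) * g + a * v \<in> rspan (*) R G"
    using assms(2,3) step unfolding subring_on_def by (intro rspan.step) auto
  then show ?case by (simp add: algebra_simps)
qed (auto intro: rspan.zero)

lemma rspan_submod:
  assumes "submod sc R N" "G \<subseteq> N" "v \<in> rspan sc R G"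
  shows "v \<in> N"
  using assms(3) assms(1,2) by induction (auto simp: submod_def)

lemma rspan_sum:
  fixes sc :: "'r::comm_ring_1 \<Rightarrow> 'v \<Rightarrow> 'v::ab_group_add"
  assumes "v \<in> rspan sc R G" "finite G" "subring_on R"
    and "\<And>v. sc 0 v = 0" "\<And>a b v. sc (a + b) v = sc a v + sc b v"
  shows "\<exists>c. (\<forall>g. c g \<in> R) \<and> v = (\<Sum>g\<in>G. sc (c g) g)"
  using assms(1)
proof induction
  case zero
  show ?case using assms by (intro exI[of _ "\<lambda>_. 0"]) (auto simp: subring_on_def)
next
  case (step a g v)
  then obtain c where c: "\<forall>g. c g \<in> R" "v = (\<Sum>g\<in>G. sc (c g) g)" by blast
  have "sc a g = (\<Sum>h\<in>G. sc (if h = g then a else 0) h)"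
    using assms(2,4) step by (simp add: if_distrib[of "\<lambda>a. sc a _"] cong: if_cong)
  then have "sc a g + v = (\<Sum>h\<in>G. sc ((if h = g then a else 0) + c h) h)"
    by (simp add: assms(5) sum.distrib c(2))
  then show ?case using c step assms(3)
    by (intro exI[of _ "\<lambda>h. (if h = g then a else 0) + c h"]) (auto simp: subring_on_def)
qed

text \<open>
  The recursion splits off the leading term of a polynomial in \<open>f\<close> of degree less than \<open>d\<close>; the
  representation need not be unique.
\<close>

primrec deg_less :: "'r::comm_ring_1 set \<Rightarrow> 'r \<Rightarrow> nat \<Rightarrow> 'r set" where
  "deg_less R f 0 = {0}"
| "deg_less R f (Suc d) = {a * f ^ d + y | a y. a \<in> R \<and> y \<in> deg_less R f d}"

context
  fixes R :: "'r::comm_ring_1 set" and f :: 'r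
  assumes R: "subring_on R"
begin

lemma R_closed: "0 \<in> R" "1 \<in> R" "a \<in> R \<Longrightarrow> b \<in> R \<Longrightarrow> a + b \<in> R" "a \<in> R \<Longrightarrow> b \<in> R \<Longrightarrow> a * b \<in> R"
  "a \<in> R \<Longrightarrow> - a \<in> R"
  using R by (auto simp: subring_on_def)

lemma deg_less_zero: "0 \<in> deg_less R f d"
proof (induction d)
  case (Suc d)
  have "0 = 0 * f ^ d + (0::'r)" by simp
  then show ?case using Suc R_closed(1) unfolding deg_less.simps by blast
qed simp

lemma deg_less_Suc: "y \<in> deg_less R f d \<Longrightarrow> y \<in> deg_less R f (Suc d)"
proof -
  assume "y \<in> deg_less R f d"
  moreover have "y = 0 * f ^ d + y" by simp
  ultimately show ?thesis using R_closed(1) unfolding deg_less.simps by blast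
qed

lemma deg_less_mono: "d \<le> e \<Longrightarrow> y \<in> deg_less R f d \<Longrightarrow> y \<in> deg_less R f e"
  by (induction rule: dec_induct) (auto intro: deg_less_Suc simp del: deg_less.simps)

lemma deg_less_add: "y \<in> deg_less R f d \<Longrightarrow> z \<in> deg_less R f d \<Longrightarrow> y + z \<in> deg_less R f d"
proof (induction d arbitrary: y z)
  case (Suc d)
  then obtain a b y' z' where "y = a * f ^ d + y'" "z = b * f ^ d + z'" "a \<in> R" "b \<in> R"
    "y' \<in> deg_less R f d" "z' \<in> deg_less R f d" by auto
  moreover from this have "y + z = (a + b) * f ^ d + (y' + z')" by (simp add: algebra_simps)
  ultimately show ?case using Suc.IH R_closed(3) by (simp only: deg_less.simps) blast
qed simp

lemma deg_less_scale: "y \<in> deg_less R f d \<Longrightarrow> c \<in> R \<Longrightarrow> c * y \<in> deg_less R f d"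
proof (induction d arbitrary: y)
  case (Suc d)
  then obtain a y' where "y = a * f ^ d + y'" "a \<in> R" "y' \<in> deg_less R f d" by auto
  moreover from this have "c * y = (c * a) * f ^ d + c * y'" by (simp add: algebra_simps)
  ultimately show ?case using Suc R_closed(4) by (simp only: deg_less.simps) blast
qed simp

lemma deg_less_shift: "y \<in> deg_less R f d \<Longrightarrow> f ^ m * y \<in> deg_less R f (d + m)"
proof (induction d arbitrary: y)
  case (Suc d)
  then obtain a y' where "y = a * f ^ d + y'" "a \<in> R" "y' \<in> deg_less R f d" by auto
  moreover from this have "f ^ m * y = a * f ^ (d + m) + f ^ m * y'"
    by (simp add: algebra_simps power_add)
  ultimately show ?case using Suc by (simp only: deg_less.simps add_Suc) blast
qed (simp add: deg_less_zero)

lemma deg_less_mult: "y \<in> deg_less R f d \<Longrightarrow> z \<in> deg_less R f e \<Longrightarrow> z * y \<in> deg_less R f (d + e)"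
proof (induction e arbitrary: z)
  case (Suc e)
  then obtain a z' where z: "z = a * f ^ e + z'" "a \<in> R" "z' \<in> deg_less R f e" by auto
  have "f ^ e * (a * y) \<in> deg_less R f (d + e)"
    using deg_less_shift deg_less_scale z Suc.prems by blast
  moreover have "z' * y \<in> deg_less R f (d + e)" using Suc z by blast
  moreover have "z * y = f ^ e * (a * y) + z' * y" unfolding z(1) by (simp add: algebra_simps)
  ultimately show ?case 
    unfolding add_Suc_right by (simp only: deg_less_add deg_less_Suc)
qed (simp add: deg_less_zero)

text \<open>
  Hilbert's basis theorem. The leading coefficients of the elements of degree \<open>d\<close> of an ideal \<open>I\<close> form
  an ideal of \<open>R\<close> which grows with \<open>d\<close> and is constant from some \<open>D\<close> on. Elements of \<open>I\<close> whose
  leading coefficients generate these ideals for \<open>d \<le> D\<close> generate \<open>I\<close>, since with their help the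
  degree of an element of \<open>I\<close> can be lowered until it vanishes.
\<close>

lemma hilbert_basis:
  assumes noeth: "noetherian_on R" and R': "subring_on R'" "R \<subseteq> R'" "f \<in> R'"
    and R'_deg: "\<And>y. y \<in> R' \<Longrightarrow> \<exists>d. y \<in> deg_less R f d"
  shows "noetherian_on R'"
  unfolding noetherian_on_def
proof (intro allI impI)
  fix I assume "I \<subseteq> R' \<and> submod (*) R' I"
  then have IR: "I \<subseteq> R'" and I: "submod (*) R' I" by auto
  have f_pow: "f ^ m \<in> R'" for m using R' by (induction m) (auto simp: subring_on_def)
  have I_diff: "u - v \<in> I" if "u \<in> I" "v \<in> I" for u v
  proof -
    have "-1 * v \<in> I" using I R'(1) that unfolding submod_def subring_on_def by blast
    then show ?thesis using I that unfolding submod_def by fastforce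
  qed
  define L where "L d = {a \<in> R. \<exists>y\<in>deg_less R f d. a * f ^ d + y \<in> I}" for d
  have L_mono1: "L d \<subseteq> L (d + m)" for d m
  proof
    fix a assume "a \<in> L d"
    then obtain y where y: "a \<in> R" "y \<in> deg_less R f d" "a * f ^ d + y \<in> I" by (auto simp: L_def)
    have "f ^ m * (a * f ^ d + y) \<in> I" using y I f_pow by (auto simp: submod_def)
    then have "a * f ^ (d + m) + f ^ m * y \<in> I" by (simp add: algebra_simps power_add)
    then show "a \<in> L (d + m)" using y deg_less_shift by (auto simp: L_def)
  qed
  have L_mono: "L d \<subseteq> L e" if "d \<le> e" for d e using L_mono1[of d "e - d"] that by simp
  have L_submod: "submod (*) R (L d)" for d
    unfolding submod_def
  proof (intro conjI ballI)
    show "0 \<in> L d" using I R_closed(1) deg_less_zero[of d] by (auto simp: L_def submod_def)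
  next
    fix a b assume "a \<in> L d" "b \<in> L d"
    then obtain y z where y: "a \<in> R" "y \<in> deg_less R f d" "a * f ^ d + y \<in> I"
      and z: "b \<in> R" "z \<in> deg_less R f d" "b * f ^ d + z \<in> I" by (auto simp: L_def)
    have "(a * f ^ d + y) + (b * f ^ d + z) \<in> I" using y z I by (auto simp: submod_def)
    then have "(a + b) * f ^ d + (y + z) \<in> I" by (simp add: algebra_simps)
    then show "a + b \<in> L d" using y z deg_less_add R_closed(3) by (auto simp: L_def)
  next
    fix c a assume "c \<in> R" "a \<in> L d"
    then obtain y where y: "a \<in> R" "y \<in> deg_less R f d" "a * f ^ d + y \<in> I" by (auto simp: L_def)
    have "c * (a * f ^ d + y) \<in> I" using y I \<open>c \<in> R\<close> R'(2) by (auto simp: submod_def)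
    then have "(c * a) * f ^ d + c * y \<in> I" by (simp add: algebra_simps)
    then show "c * a \<in> L d" using y deg_less_scale R_closed(4) \<open>c \<in> R\<close> by (auto simp: L_def)
  qed
  have "submod (*) R (\<Union>d. L d)"
    unfolding submod_def
  proof (intro conjI ballI)
    show "0 \<in> (\<Union>d. L d)" using L_submod by (auto simp: submod_def)
  next
    fix a b assume "a \<in> (\<Union>d. L d)" "b \<in> (\<Union>d. L d)"
    then obtain d e where "a \<in> L d" "b \<in> L e" by blast
    then have "a \<in> L (max d e)" "b \<in> L (max d e)"
      using L_mono[of d "max d e"] L_mono[of e "max d e"] by auto
    then have "a + b \<in> L (max d e)" using L_submod[of "max d e"] unfolding submod_def by blast
    then show "a + b \<in> (\<Union>d. L d)" by (rule UN_I[OF UNIV_I])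
  next
    fix c a assume "c \<in> R" "a \<in> (\<Union>d. L d)"
    then show "c * a \<in> (\<Union>d. L d)" using L_submod unfolding submod_def by blast
  qed
  moreover have "(\<Union>d. L d) \<subseteq> R" by (auto simp: L_def)
  ultimately obtain G0 where G0: "finite G0" "G0 \<subseteq> (\<Union>d. L d)" "(\<Union>d. L d) \<subseteq> rspan (*) R G0"
    by (rule noetherian_onD[OF noeth])
  obtain D where D: "G0 \<subseteq> L D"
  proof -
    have "\<exists>D. G0 \<subseteq> L D"
      using G0(1,2)
    proof (induction rule: finite_induct)
      case (insert a G)
      have "G \<subseteq> (\<Union>d. L d)" "a \<in> (\<Union>d. L d)" using insert.prems by simp_all
      then obtain D d where "G \<subseteq> L D" "a \<in> L d" using insert.IH by (elim UN_E) meson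
      have "insert a G \<subseteq> L (max D d)"
        using \<open>G \<subseteq> L D\<close> \<open>a \<in> L d\<close> L_mono[of D "max D d"] L_mono[of d "max D d"] by auto
      then show ?case by blast
    qed auto
    then show ?thesis using that by blast
  qed
  have "\<exists>G. finite G \<and> G \<subseteq> L d \<and> L d \<subseteq> rspan (*) R G" for d
    using noetherian_onD[OF noeth L_submod[of d]] by (metis (no_types, lifting) L_def mem_Collect_eq subsetI)
  then obtain G where G: "\<And>d. finite (G d)" "\<And>d. G d \<subseteq> L d" "\<And>d. L d \<subseteq> rspan (*) R (G d)"
    by metis
  have "\<exists>y. y \<in> deg_less R f d \<and> a * f ^ d + y \<in> I" if "a \<in> G d" for d a
    using G(2)[of d] that by (auto simp: L_def)
  then have "\<exists>y. \<forall>d a. a \<in> G d \<longrightarrow> y d a \<in> deg_less R f d \<and> a * f ^ d + y d a \<in> I"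
    by (intro choice allI) auto
  then obtain y where y: "\<And>d a. a \<in> G d \<Longrightarrow> y d a \<in> deg_less R f d \<and> a * f ^ d + y d a \<in> I"
    by blast
  define W where "W = (\<Union>d\<le>D. (\<lambda>a. a * f ^ d + y d a) ` G d)"
  have W: "finite W" "W \<subseteq> I" using G(1) y by (auto simp: W_def)
  have lead: "\<exists>u\<in>rspan (*) R' W. \<exists>z\<in>deg_less R f d. u = a * f ^ d + z"
    if "d \<le> D" "a \<in> rspan (*) R (G d)" for a d
    using that(2)
  proof induction
    case zero
    show ?case using rspan.zero deg_less_zero by fastforce
  next
    case (step c g v)
    then obtain u z where u: "u \<in> rspan (*) R' W" "z \<in> deg_less R f d" "u = v * f ^ d + z" by blast
    have "g * f ^ d + y d g \<in> W" using step \<open>d \<le> D\<close> by (auto simp: W_def)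
    then have "c * (g * f ^ d + y d g) + u \<in> rspan (*) R' W"
      using u step R' by (auto intro: rspan.step)
    moreover have "c * (g * f ^ d + y d g) + u = (c * g + v) * f ^ d + (c * y d g + z)"
      by (simp add: u algebra_simps)
    moreover have "c * y d g + z \<in> deg_less R f d"
      using step y u by (auto intro!: deg_less_add deg_less_scale)
    ultimately show ?case by metis
  qed
  have "v \<in> rspan (*) R' W" if "v \<in> I" "v \<in> deg_less R f d" for v d
    using that
  proof (induction d arbitrary: v)
    case (Suc d)
    then obtain a v' where v: "v = a * f ^ d + v'" "a \<in> R" "v' \<in> deg_less R f d" by auto
    \<comment> \<open>beyond degree \<open>D\<close>, a generator of degree \<open>D\<close> is multiplied with a power of \<open>f\<close>\<close>
    define e where "e = min d D"
    have "a \<in> L d" using v Suc.prems by (auto simp: L_def)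
    have "a \<in> rspan (*) R (G e)"
    proof (cases "d \<le> D")
      case True
      then show ?thesis using G(3)[of d] \<open>a \<in> L d\<close> by (auto simp: e_def)
    next
      case False
      have "a \<in> rspan (*) R G0" using G0(3) \<open>a \<in> L d\<close> by auto
      then have "a \<in> L D" using rspan_submod[OF L_submod D] by blast
      then show ?thesis using G(3)[of D] False by (auto simp: e_def)
    qed
    then obtain u z where u: "u \<in> rspan (*) R' W" "z \<in> deg_less R f e" "u = a * f ^ e + z"
      using lead[of e a] by (auto simp: e_def)
    define u' where "u' = f ^ (d - e) * u"
    have u': "u' \<in> rspan (*) R' W" using rspan_scale[OF u(1) f_pow R'(1)] by (simp add: u'_def)
    have de: "d = e + (d - e)" by (simp add: e_def)
    have "u' = a * f ^ d + f ^ (d - e) * z"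
      using de by (simp add: u'_def u algebra_simps flip: power_add)
    then have "v - u' = v' + - 1 * (f ^ (d - e) * z)" unfolding v(1) by simp
    moreover have "f ^ (d - e) * z \<in> deg_less R f d"
      using deg_less_shift[OF u(2), of "d - e"] de by simp
    then have "- 1 * (f ^ (d - e) * z) \<in> deg_less R f d"
      by (rule deg_less_scale) (intro R_closed)
    ultimately have "v - u' \<in> deg_less R f d" by (simp only: deg_less_add[OF v(3)])
    moreover have "v - u' \<in> I" using I_diff Suc.prems(1) rspan_submod[OF I W(2) u'] by blast
    ultimately have "v - u' \<in> rspan (*) R' W" using Suc.IH by blast
    then show ?case using rspan_add[OF _ u'] by fastforce
  qed (simp add: rspan.zero)
  then show "\<exists>G. finite G \<and> G \<subseteq> I \<and> I \<subseteq> rspan (*) R' G"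
    using W IR R'_deg by (intro exI[of _ W]) blast
qed

text \<open>
  Induction on \<open>n\<close>: the last entries of the tuples in a submodule of \<open>R\<^sup>n\<close> form a finitely generated
  ideal, and the tuples with vanishing last entry a submodule of \<open>R\<^bsup>n-1\<^esup>\<close>.
\<close>

lemma noetherian_submodule_fg:
  assumes "noetherian_on R" "submod tuple_scale R N"
    and "\<And>v. v \<in> N \<Longrightarrow> (\<forall>i<n. v i \<in> R) \<and> (\<forall>i\<ge>n. v i = 0)"
  shows "\<exists>G. finite G \<and> G \<subseteq> N \<and> N \<subseteq> rspan tuple_scale R G"
  using assms(2,3)
proof (induction n arbitrary: N)
  case 0
  then have "N \<subseteq> {0}" by (auto simp: fun_eq_iff)
  then have "N \<subseteq> rspan tuple_scale R {}" by (metis rspan.zero singletonD subset_iff)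
  then show ?case by (intro exI[of _ "{}"] conjI finite.emptyI empty_subsetI)
next
  case (Suc n)
  note N = Suc.prems(1)[unfolded submod_def]
  define I where "I = (\<lambda>v. v n) ` N"
  have "submod (*) R I"
    unfolding submod_def
  proof (intro conjI ballI)
    show "0 \<in> I" unfolding I_def by (rule image_eqI[of _ _ 0]) (use N in auto)
  next
    fix a b assume "a \<in> I" "b \<in> I"
    then obtain u v where uv: "u \<in> N" "v \<in> N" "a = u n" "b = v n" by (auto simp: I_def)
    show "a + b \<in> I" unfolding I_def by (rule image_eqI[of _ _ "u + v"]) (use N uv in auto)
  next
    fix a b assume "a \<in> R" "b \<in> I"
    then obtain v where v: "v \<in> N" "b = v n" by (auto simp: I_def)
    show "a * b \<in> I"
      unfolding I_def by (rule image_eqI[of _ _ "tuple_scale a v"]) (use N v \<open>a \<in> R\<close> in \<open>auto simp: tuple_scale_apply\<close>)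
  qed
  moreover have "I \<subseteq> R" using Suc.prems(2) by (auto simp: I_def)
  ultimately obtain G where G: "finite G" "G \<subseteq> I" "I \<subseteq> rspan (*) R G"
    by (rule noetherian_onD[OF assms(1)])
  have "\<forall>g\<in>G. \<exists>v\<in>N. v n = g" using G(2) by (auto simp: I_def)
  then obtain w where w: "\<And>g. g \<in> G \<Longrightarrow> w g \<in> N \<and> w g n = g" by metis
  define N' where "N' = {v \<in> N. v n = 0}"
  have N': "submod tuple_scale R N'"
    unfolding submod_def
  proof (intro conjI ballI)
    show "0 \<in> N'" using N by (simp add: N'_def)
    show "u + v \<in> N'" if "u \<in> N'" "v \<in> N'" for u v using that N by (simp add: N'_def)
    show "tuple_scale a v \<in> N'" if "a \<in> R" "v \<in> N'" for a v
      using that N by (simp add: N'_def tuple_scale_apply)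
  qed
  moreover have "(\<forall>i<n. v i \<in> R) \<and> (\<forall>i\<ge>n. v i = 0)" if "v \<in> N'" for v
    using that Suc.prems(2)[of v] by (auto simp: N'_def less_Suc_eq) (metis Suc_leI le_neq_implies_less)
  ultimately obtain G' where G': "finite G'" "G' \<subseteq> N'" "N' \<subseteq> rspan tuple_scale R G'"
    using Suc.IH[OF _ ] by (metis (no_types, lifting))
  have lift: "\<exists>u\<in>rspan tuple_scale R (w ` G). u n = a" if "a \<in> rspan (*) R G" for a
    using that
  proof induction
    case zero
    then show ?case by (intro bexI[of _ 0]) (auto intro: rspan.zero)
  next
    case (step a g v)
    then obtain u where u: "u \<in> rspan tuple_scale R (w ` G)" "u n = v" by blast
    have "(tuple_scale a (w g) + u) n = a * g + v"
      using w[OF step(2)] u(2) by (simp add: tuple_scale_apply)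
    moreover have "tuple_scale a (w g) + u \<in> rspan tuple_scale R (w ` G)"
      using u(1) step by (intro rspan.step) simp_all
    ultimately show ?case by blast
  qed
  have "v \<in> rspan tuple_scale R (w ` G \<union> G')" if "v \<in> N" for v
  proof -
    have "v n \<in> rspan (*) R G" using that G(3) by (auto simp: I_def)
    then obtain u where u: "u \<in> rspan tuple_scale R (w ` G)" "u n = v n" using lift by blast
    have uN: "u \<in> N" using rspan_submod[OF Suc.prems(1) _ u(1)] w by blast
    have "tuple_scale (- 1) u \<in> N" using N uN R_closed(2,5) by blast
    then have "v + tuple_scale (- 1) u \<in> N'" using N that u(2) by (simp add: N'_def tuple_scale_apply)
    then have "v + tuple_scale (- 1) u \<in> rspan tuple_scale R (w ` G \<union> G')"
      by (intro rspan_mono[OF subsetD[OF G'(3)]]) simp_all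
    moreover have "u \<in> rspan tuple_scale R (w ` G \<union> G')" using u(1) rspan_mono by fastforce
    ultimately have "(v + tuple_scale (- 1) u) + u \<in> rspan tuple_scale R (w ` G \<union> G')" by (rule rspan_add)
    moreover have "(v + tuple_scale (- 1) u) + u = v" by (simp add: fun_eq_iff tuple_scale_apply)
    ultimately show ?thesis by simp
  qed
  then show ?case using G(1) G' w by (intro exI[of _ "w ` G \<union> G'"]) (auto simp: N'_def)
qed

end

lemma subring_poly_funs: "subring_on (poly_funs C :: ('x \<Rightarrow> 'k::comm_ring_1) set)"
  using poly_funs.const[of 0 C] poly_funs.const[of 1 C]
  by (auto simp: subring_on_def zero_fun_def one_fun_def plus_fun_def times_fun_def fun_Compl_def
      intro: poly_funs.add poly_funs.mult poly_funs_minus)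

lemma noetherian_poly_funs:
  assumes "finite C"
  shows "noetherian_on (poly_funs C :: ('x \<Rightarrow> 'k::field) set)"
  using assms
proof induction
  case empty
  have const: "\<exists>c. f = (\<lambda>_. c)" if "f \<in> poly_funs {}" for f :: "'x \<Rightarrow> 'k"
    using that by induction auto
  show ?case
    unfolding noetherian_on_def
  proof (intro allI impI)
    fix I :: "('x \<Rightarrow> 'k) set"
    assume I: "I \<subseteq> poly_funs {} \<and> submod (*) (poly_funs {}) I"
    show "\<exists>G. finite G \<and> G \<subseteq> I \<and> I \<subseteq> rspan (*) (poly_funs {}) G"
    proof (cases "I \<subseteq> {0}")
      case True
      then have "I \<subseteq> rspan (*) (poly_funs {}) {}" by (metis rspan.zero singletonD subset_iff)
      then show ?thesis by (intro exI[of _ "{}"] conjI finite.emptyI empty_subsetI)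
    next
      case False
      then obtain g where g: "g \<in> I" "g \<noteq> 0" by blast
      then obtain c where c: "g = (\<lambda>_. c)" using I const by blast
      have "f \<in> rspan (*) (poly_funs {}) {g}" if "f \<in> I" for f
      proof -
        have "\<exists>d. f = (\<lambda>_. d)" using I that by (intro const) auto
        then obtain d where d: "f = (\<lambda>_. d)" ..
        have "(\<lambda>_. d / c) * g + 0 \<in> rspan (*) (poly_funs {}) {g}"
          by (intro rspan.step poly_funs.const rspan.zero) simp
        moreover have "(\<lambda>_. d / c) * g + 0 = f" using g(2) by (auto simp: c d fun_eq_iff)
        ultimately show ?thesis by simp
      qed
      then show ?thesis using g by (intro exI[of _ "{g}"]) auto
    qed
  qed
next
  case (insert f C)
  note sub = subring_poly_funs[of C]
  have mono: "poly_funs C \<subseteq> poly_funs (insert f C)"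
  proof
    show "g \<in> poly_funs (insert f C)" if "g \<in> poly_funs C" for g
      using that by induction (auto intro: poly_funs.intros)
  qed
  have base: "\<exists>d. g \<in> deg_less (poly_funs C) f d" if "g \<in> poly_funs C" for g
    using that by (intro exI[of _ 1]) auto
  have "\<exists>d. g \<in> deg_less (poly_funs C) f d" if "g \<in> poly_funs (insert f C)" for g
    using that
  proof induction
    case (const c)
    show ?case by (rule base) (rule poly_funs.const)
  next
    case (coord g)
    show ?case
    proof (cases "g = f")
      case True
      have "f = 1 * f ^ 1 + (0 * f ^ 0 + 0)" by simp
      moreover have "0 * f ^ 0 + 0 \<in> deg_less (poly_funs C) f 1"
        using R_closed[OF sub] by auto
      ultimately have "f \<in> deg_less (poly_funs C) f (Suc 1)"
        using R_closed(2)[OF sub] by (simp only: deg_less.simps) blast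
      then show ?thesis using True by blast
    qed (use coord base in \<open>auto intro: poly_funs.coord\<close>)
  next
    case (add g h)
    then obtain d e where "g \<in> deg_less (poly_funs C) f d" "h \<in> deg_less (poly_funs C) f e" by blast
    then have "g + h \<in> deg_less (poly_funs C) f (max d e)"
      using deg_less_mono[OF sub, of d "max d e"] deg_less_mono[OF sub, of e "max d e"]
      by (intro deg_less_add[OF sub]) auto
    then show ?case by (auto simp: plus_fun_def)
  next
    case (mult g h)
    then obtain d e where "h \<in> deg_less (poly_funs C) f d" "g \<in> deg_less (poly_funs C) f e" by blast
    then have "g * h \<in> deg_less (poly_funs C) f (d + e)" by (rule deg_less_mult[OF sub])
    then show ?case by (auto simp: times_fun_def)
  qed
  then show ?case
    using hilbert_basis[OF sub insert.IH subring_poly_funs mono] by (auto intro: poly_funs.coord)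
qed

text \<open>
  Tuples are extended by zero to functions on \<open>nat\<close>, which makes equality of tuples equality of functions.
\<close>

lemma poly_funs_submodule_fg:
  fixes N :: "(nat \<Rightarrow> 'x \<Rightarrow> 'k::field) set"
  assumes "finite C"
    and N0: "(\<lambda>i x. 0) \<in> N"
    and N_add: "\<And>u v. u \<in> N \<Longrightarrow> v \<in> N \<Longrightarrow> (\<lambda>i x. u i x + v i x) \<in> N"
    and N_scale: "\<And>a v. a \<in> poly_funs C \<Longrightarrow> v \<in> N \<Longrightarrow> (\<lambda>i x. a x * v i x) \<in> N"
    and N_poly: "\<And>v. v \<in> N \<Longrightarrow> (\<forall>i<n. v i \<in> poly_funs C) \<and> (\<forall>i\<ge>n. v i = (\<lambda>_. 0))"
  shows "\<exists>K G. (\<forall>l<K. G l \<in> N) \<and>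
    (\<forall>v\<in>N. \<exists>c. (\<forall>l<K. c l \<in> poly_funs C) \<and> (\<forall>i x. v i x = (\<Sum>l<(K::nat). c l x * G l i x)))"
proof -
  have "submod tuple_scale (poly_funs C) N"
    using N0 N_add N_scale by (auto simp: submod_def tuple_scale_def zero_fun_def plus_fun_def times_fun_def)
  moreover have "(\<forall>i<n. v i \<in> poly_funs C) \<and> (\<forall>i\<ge>n. v i = 0)" if "v \<in> N" for v
    using N_poly[OF that] by (auto simp: zero_fun_def)
  ultimately obtain G where G: "finite G" "G \<subseteq> N" "N \<subseteq> rspan tuple_scale (poly_funs C) G"
    using noetherian_submodule_fg[OF subring_poly_funs noetherian_poly_funs[OF assms(1)], of N n]
    by metis
  obtain K h where h: "bij_betw h {..<K::nat} G"
    using ex_bij_betw_nat_finite[OF G(1)] by (metis lessThan_atLeast0)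
  have "\<exists>c. (\<forall>l<K. c l \<in> poly_funs C) \<and> (\<forall>i x. v i x = (\<Sum>l<K. c l x * h l i x))" if "v \<in> N" for v
  proof -
    have "v \<in> rspan tuple_scale (poly_funs C) G" using that G by blast
    then have "\<exists>c. (\<forall>g. c g \<in> poly_funs C) \<and> v = (\<Sum>g\<in>G. tuple_scale (c g) g)"
      by (rule rspan_sum[OF _ G(1) subring_poly_funs])
        (simp_all add: fun_eq_iff tuple_scale_apply algebra_simps)
    then obtain c where c: "\<forall>g. c g \<in> poly_funs C" "v = (\<Sum>g\<in>G. tuple_scale (c g) g)"
      by blast
    have "v i x = (\<Sum>l<K. c (h l) x * h l i x)" for i x
    proof -
      have "v i x = (\<Sum>g\<in>G. c g x * g i x)"
        unfolding c(2) by (induction G rule: infinite_finite_induct) (auto simp: tuple_scale_apply)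
      then show ?thesis using sum.reindex_bij_betw[OF h, of "\<lambda>g. c g x * g i x"] by simp
    qed
    then show ?thesis using c by (intro exI[of _ "\<lambda>l. c (h l)"]) auto
  qed
  moreover have "\<forall>l<K. h l \<in> N" using h G(2) by (auto simp: bij_betw_def)
  ultimately show ?thesis by blast
qed


section \<open>Regular functions in charts\<close>

abbreviation points :: "('x, 'k) atlas \<Rightarrow> 'x set" where
  "points A \<equiv> \<Union>(fst ` A)"

text \<open>
  The equation is required wherever the denominator does not vanish. This absorbs the choice of a
  neighbourhood: to shrink it, multiply \<open>P\<close> and \<open>Q\<close> with a function that vanishes outside.
\<close>

definition frac_at :: "('x \<Rightarrow> 'k::field) set \<Rightarrow> 'x set \<Rightarrow> ('x \<Rightarrow> 'k) \<Rightarrow> 'x \<Rightarrow> bool" where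
  "frac_at C E f x \<longleftrightarrow> (\<exists>P\<in>poly_funs C. \<exists>Q\<in>poly_funs C. Q x \<noteq> 0 \<and> (\<forall>y\<in>E. Q y \<noteq> 0 \<longrightarrow> f y = P y / Q y))"

text \<open>
  In contrast to \<open>regular_funs\<close>, the values outside \<open>U\<close> are arbitrary, which makes it possible to
  restrict a regular function without changing it.
\<close>

definition reg :: "('x, 'k::field) atlas \<Rightarrow> 'x set \<Rightarrow> ('x \<Rightarrow> 'k) \<Rightarrow> bool" where
  "reg A U f \<longleftrightarrow> (\<forall>x\<in>U. \<exists>V C. (V, C) \<in> A \<and> x \<in> V \<and> frac_at C (U \<inter> V) f x)"

lemma frac_atI:
  "P \<in> poly_funs C \<Longrightarrow> Q \<in> poly_funs C \<Longrightarrow> Q x \<noteq> 0 \<Longrightarrow> (\<And>y. y \<in> E \<Longrightarrow> Q y \<noteq> 0 \<Longrightarrow> f y = P y / Q y)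
    \<Longrightarrow> frac_at C E f x"
  unfolding frac_at_def by blast

lemma frac_atE:
  assumes "frac_at C E f x"
  obtains P Q where "P \<in> poly_funs C" "Q \<in> poly_funs C" "Q x \<noteq> 0"
    "\<And>y. y \<in> E \<Longrightarrow> Q y \<noteq> 0 \<Longrightarrow> f y = P y / Q y"
  using assms unfolding frac_at_def by blast

lemma frac_at_poly: "f \<in> poly_funs C \<Longrightarrow> frac_at C E f x"
  by (rule frac_atI[of f _ "\<lambda>_. 1"]) (auto intro: poly_funs.const)

lemma frac_at_cong: "frac_at C E f x \<Longrightarrow> E' \<subseteq> E \<Longrightarrow> (\<And>y. y \<in> E' \<Longrightarrow> f y = g y) \<Longrightarrow> frac_at C E' g x"
  unfolding frac_at_def by (metis subset_iff)

lemma frac_at_add: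
  assumes "frac_at C E f x" "frac_at C E g x"
  shows "frac_at C E (\<lambda>y. f y + g y) x"
proof -
  from assms obtain P Q P' Q' where "P \<in> poly_funs C" "Q \<in> poly_funs C" "Q x \<noteq> 0"
    and 1: "\<And>y. y \<in> E \<Longrightarrow> Q y \<noteq> 0 \<Longrightarrow> f y = P y / Q y"
    and "P' \<in> poly_funs C" "Q' \<in> poly_funs C" "Q' x \<noteq> 0"
    and 2: "\<And>y. y \<in> E \<Longrightarrow> Q' y \<noteq> 0 \<Longrightarrow> g y = P' y / Q' y"
    by (elim frac_atE) blast
  then show ?thesis
    by (intro frac_atI[of "\<lambda>y. P y * Q' y + P' y * Q y" C "\<lambda>y. Q y * Q' y"])
      (auto intro!: poly_funs.add poly_funs.mult simp: 1 2 field_simps)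
qed

lemma frac_at_mult:
  assumes "frac_at C E f x" "frac_at C E g x"
  shows "frac_at C E (\<lambda>y. f y * g y) x"
proof -
  from assms obtain P Q P' Q' where "P \<in> poly_funs C" "Q \<in> poly_funs C" "Q x \<noteq> 0"
    and 1: "\<And>y. y \<in> E \<Longrightarrow> Q y \<noteq> 0 \<Longrightarrow> f y = P y / Q y"
    and "P' \<in> poly_funs C" "Q' \<in> poly_funs C" "Q' x \<noteq> 0"
    and 2: "\<And>y. y \<in> E \<Longrightarrow> Q' y \<noteq> 0 \<Longrightarrow> g y = P' y / Q' y"
    by (elim frac_atE) blast
  then show ?thesis
    by (intro frac_atI[of "\<lambda>y. P y * P' y" C "\<lambda>y. Q y * Q' y"])
      (auto intro!: poly_funs.add poly_funs.mult simp: 1 2 field_simps)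
qed

lemma frac_at_inverse:
  assumes "frac_at C E f x" "f x \<noteq> 0" "x \<in> E"
  shows "frac_at C E (\<lambda>y. inverse (f y)) x"
proof -
  from assms(1) obtain P Q where "P \<in> poly_funs C" "Q \<in> poly_funs C" "Q x \<noteq> 0"
    and 1: "\<And>y. y \<in> E \<Longrightarrow> Q y \<noteq> 0 \<Longrightarrow> f y = P y / Q y"
    by (elim frac_atE) blast
  moreover from this have "P x \<noteq> 0" using assms(2,3) by fastforce
  ultimately show ?thesis
    by (intro frac_atI[of "\<lambda>y. Q y * Q y" C "\<lambda>y. P y * Q y"])
      (auto intro!: poly_funs.add poly_funs.mult simp: 1 field_simps)
qed

lemma common_denominator:
  fixes C :: "('x \<Rightarrow> 'k::field) set"
  assumes "finite I" "\<And>i. i \<in> I \<Longrightarrow> frac_at C E (f i) x"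
  shows "\<exists>Q P. Q \<in> poly_funs C \<and> Q x \<noteq> 0 \<and>
    (\<forall>i\<in>I. P i \<in> poly_funs C \<and> (\<forall>y\<in>E. Q y \<noteq> 0 \<longrightarrow> f i y = P i y / Q y))"
proof -
  have "\<forall>i\<in>I. \<exists>PQ. fst PQ \<in> poly_funs C \<and> snd PQ \<in> poly_funs C \<and> snd PQ x \<noteq> 0 \<and>
    (\<forall>y\<in>E. snd PQ y \<noteq> 0 \<longrightarrow> f i y = fst PQ y / snd PQ y)"
  proof
    fix i assume "i \<in> I"
    then obtain P Q where "P \<in> poly_funs C" "Q \<in> poly_funs C" "Q x \<noteq> 0"
      "\<And>y. y \<in> E \<Longrightarrow> Q y \<noteq> 0 \<Longrightarrow> f i y = P y / Q y"
      using frac_atE[OF assms(2)] by blast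
    then show "\<exists>PQ. fst PQ \<in> poly_funs C \<and> snd PQ \<in> poly_funs C \<and> snd PQ x \<noteq> 0 \<and>
      (\<forall>y\<in>E. snd PQ y \<noteq> 0 \<longrightarrow> f i y = fst PQ y / snd PQ y)"
      by (intro exI[of _ "(P, Q)"]) simp
  qed
  then obtain PQ where PQ: "\<forall>i\<in>I. fst (PQ i) \<in> poly_funs C \<and> snd (PQ i) \<in> poly_funs C \<and> snd (PQ i) x \<noteq> 0 \<and>
    (\<forall>y\<in>E. snd (PQ i) y \<noteq> 0 \<longrightarrow> f i y = fst (PQ i) y / snd (PQ i) y)"
    by (rule bchoice[THEN exE])
  define Q where "Q = (\<lambda>y. \<Prod>i\<in>I. snd (PQ i) y)"
  define P where "P i = (\<lambda>y. fst (PQ i) y * (\<Prod>j\<in>I - {i}. snd (PQ j) y))" for i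
  have "f i y = P i y / Q y" if "i \<in> I" "y \<in> E" "Q y \<noteq> 0" for i y
  proof -
    have Q: "Q y = snd (PQ i) y * (\<Prod>j\<in>I - {i}. snd (PQ j) y)"
      unfolding Q_def using assms(1) that(1) by (rule prod.remove)
    then have "snd (PQ i) y \<noteq> 0" "(\<Prod>j\<in>I - {i}. snd (PQ j) y) \<noteq> 0" using that(3) by auto
    then show ?thesis using PQ that Q by (simp add: P_def)
  qed
  moreover have "Q \<in> poly_funs C" "Q x \<noteq> 0" "\<forall>i\<in>I. P i \<in> poly_funs C"
    using PQ assms(1) by (auto simp: Q_def P_def intro!: poly_funs_prod poly_funs.mult)
  ultimately show ?thesis by blast
qed

lemma regD: "reg A U f \<Longrightarrow> x \<in> U \<Longrightarrow> \<exists>V C. (V, C) \<in> A \<and> x \<in> V \<and> frac_at C (U \<inter> V) f x"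
  unfolding reg_def by blast

lemma regI:
  "(\<And>x. x \<in> U \<Longrightarrow> \<exists>V C. (V, C) \<in> A \<and> x \<in> V \<and> frac_at C (U \<inter> V) f x) \<Longrightarrow> reg A U f"
  unfolding reg_def by blast

lemma reg_cong:
  assumes "reg A U f" "U' \<subseteq> U" "\<And>y. y \<in> U' \<Longrightarrow> f y = g y"
  shows "reg A U' g"
proof (rule regI)
  fix x assume x: "x \<in> U'"
  then obtain V C where V: "(V, C) \<in> A" "x \<in> V" "frac_at C (U \<inter> V) f x"
    using regD[OF assms(1)] assms(2) by blast
  have "frac_at C (U' \<inter> V) g x"
    by (rule frac_at_cong[OF V(3)]) (use assms(2,3) in auto)
  then show "\<exists>V C. (V, C) \<in> A \<and> x \<in> V \<and> frac_at C (U' \<inter> V) g x" using V by blast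
qed

lemma reg_mono: "reg A U f \<Longrightarrow> U' \<subseteq> U \<Longrightarrow> reg A U' f"
  by (rule reg_cong[where f = f]) auto

lemma zar_on_open_sub:
  assumes "openin (zar_on A X) U"
  shows "openin (zar_on A U) V \<longleftrightarrow> openin (zar_on A X) V \<and> V \<subseteq> U"
proof -
  have "U \<subseteq> X" using assms openin_subset topspace_subtopology_subset by (metis Int_subset_iff topspace_subtopology)
  then have "zar_on A U = subtopology (zar_on A X) U"
    by (simp add: subtopology_subtopology inf.absorb2)
  then show ?thesis using openin_open_subtopology[OF assms] by simp
qed

lemma zar_on_subset: "openin (zar_on A X) U \<Longrightarrow> U \<subseteq> X"
  using openin_subset by (fastforce simp: topspace_subtopology)

lemma zar_on_restrict:
  assumes "openin (zar_on A X) U" "Y \<subseteq> X"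
  shows "openin (zar_on A Y) (U \<inter> Y)"
  using assms unfolding openin_subtopology by blast

text \<open>
  The atlases of quasi-projective varieties: the part of a chart that lies in another chart is a
  principal open subset of the first one, and there the coordinates of the second are fractions.
\<close>

locale nice_atlas =
  fixes A :: "('x, 'k::field) atlas"
  assumes finite_coords: "(V, C) \<in> A \<Longrightarrow> finite C"
    and overlap: "(V, C) \<in> A \<Longrightarrow> (V', C') \<in> A \<Longrightarrow>
      \<exists>D\<in>poly_funs C. V \<inter> V' = {x \<in> V. D x \<noteq> 0} \<and>
        (\<forall>c\<in>C'. \<exists>P\<in>poly_funs C. \<forall>x\<in>V \<inter> V'. c x = P x / D x)"
begin

lemma overlap_poly:
  assumes "(V, C) \<in> A" "(V', C') \<in> A"
  obtains D where "D \<in> poly_funs C" "V \<inter> V' = {x \<in> V. D x \<noteq> 0}"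
    "\<And>f. f \<in> poly_funs C' \<Longrightarrow> \<exists>P\<in>poly_funs C. \<exists>m. \<forall>x\<in>V \<inter> V'. f x = P x / D x ^ m"
proof -
  obtain D where D: "D \<in> poly_funs C" "V \<inter> V' = {x \<in> V. D x \<noteq> 0}"
    "\<forall>c\<in>C'. \<exists>P\<in>poly_funs C. \<forall>x\<in>V \<inter> V'. c x = P x / D x"
    using overlap[OF assms] by blast
  have "D x \<noteq> 0" if "x \<in> V \<inter> V'" for x using D(2) that by blast
  then have "\<exists>P\<in>poly_funs C. \<exists>m. \<forall>x\<in>V \<inter> V'. f x = P x / D x ^ m" if "f \<in> poly_funs C'" for f
    using poly_funs_frac[OF D(1) _ _ that, of "V \<inter> V'" "\<lambda>x. x"] D(3) by blast
  then show ?thesis using that D(1,2) by blast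
qed

text \<open>
  The factors \<open>D\<^bsup>l+1\<^esup>\<close> and \<open>D\<^bsup>m+1\<^esup>\<close> clear the denominators of \<open>P'\<close> and \<open>Q'\<close> and, being divisible by \<open>D\<close>,
  confine the new denominator to the overlap of the charts.
\<close>

lemma frac_at_change:
  assumes "(V, C) \<in> A" "(V', C') \<in> A" "x \<in> V" "x \<in> V'" "frac_at C' (U \<inter> V') f x"
  shows "frac_at C (U \<inter> V) f x"
proof -
  obtain D where D: "D \<in> poly_funs C" "V \<inter> V' = {x \<in> V. D x \<noteq> 0}"
    "\<And>f. f \<in> poly_funs C' \<Longrightarrow> \<exists>P\<in>poly_funs C. \<exists>m. \<forall>x\<in>V \<inter> V'. f x = P x / D x ^ m"
    using overlap_poly[OF assms(1,2)] by blast
  obtain P' Q' where PQ: "P' \<in> poly_funs C'" "Q' \<in> poly_funs C'" "Q' x \<noteq> 0"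
    "\<And>y. y \<in> U \<inter> V' \<Longrightarrow> Q' y \<noteq> 0 \<Longrightarrow> f y = P' y / Q' y"
    using assms(5) by (elim frac_atE) blast
  obtain p m q l where p: "p \<in> poly_funs C" "\<forall>x\<in>V \<inter> V'. P' x = p x / D x ^ m"
    and q: "q \<in> poly_funs C" "\<forall>x\<in>V \<inter> V'. Q' x = q x / D x ^ l"
    using D(3)[OF PQ(1)] D(3)[OF PQ(2)] by blast
  have Dx: "D x \<noteq> 0" using D(2) assms(3,4) by blast
  have "Q' x = q x / D x ^ l" using q(2) assms(3,4) by blast
  then have qx: "q x \<noteq> 0" using PQ(3) by auto
  have "f y = (p y * D y ^ Suc l) / (q y * D y ^ Suc m)"
    if "y \<in> U \<inter> V" "q y * D y ^ Suc m \<noteq> 0" for y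
  proof -
    have y: "q y \<noteq> 0" "D y \<noteq> 0" using that(2) by auto
    then have yV: "y \<in> V \<inter> V'" using D(2) that(1) by blast
    then have "P' y = p y / D y ^ m" "Q' y = q y / D y ^ l" using p(2) q(2) by blast+
    moreover have "f y = P' y / Q' y"
      using PQ(4)[of y] that(1) yV y \<open>Q' y = _\<close> by auto
    ultimately have "f y = (p y / D y ^ m) / (q y / D y ^ l)" by simp
    then show ?thesis using y by simp
  qed
  then show ?thesis
    using p(1) q(1) D(1) qx Dx
    by (intro frac_atI[of "\<lambda>y. p y * D y ^ Suc l" C "\<lambda>y. q y * D y ^ Suc m"])
      (auto intro!: poly_funs.mult poly_funs_power simp del: power_Suc)
qed

lemma reg_chart:
  assumes "reg A U f" "(V, C) \<in> A" "x \<in> U" "x \<in> V"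
  shows "frac_at C (U \<inter> V) f x"
  using regD[OF assms(1,3)] frac_at_change assms by blast

lemma reg_const: "U \<subseteq> points A \<Longrightarrow> reg A U (\<lambda>_. c)"
proof (rule regI)
  fix x assume "U \<subseteq> points A" "x \<in> U"
  then obtain V C where "(V, C) \<in> A" "x \<in> V" by auto
  then show "\<exists>V C. (V, C) \<in> A \<and> x \<in> V \<and> frac_at C (U \<inter> V) (\<lambda>_. c) x"
    using frac_at_poly[OF poly_funs.const[of c C], of "U \<inter> V" x] by blast
qed

lemma reg_add:
  assumes "reg A U f" "reg A U g"
  shows "reg A U (\<lambda>x. f x + g x)"
proof (rule regI)
  fix x assume x: "x \<in> U"
  then obtain V C where "(V, C) \<in> A" "x \<in> V" "frac_at C (U \<inter> V) f x" using regD[OF assms(1)] by blast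
  then show "\<exists>V C. (V, C) \<in> A \<and> x \<in> V \<and> frac_at C (U \<inter> V) (\<lambda>x. f x + g x) x"
    using frac_at_add[OF _ reg_chart[OF assms(2)]] x by blast
qed

lemma reg_mult:
  assumes "reg A U f" "reg A U g"
  shows "reg A U (\<lambda>x. f x * g x)"
proof (rule regI)
  fix x assume x: "x \<in> U"
  then obtain V C where "(V, C) \<in> A" "x \<in> V" "frac_at C (U \<inter> V) f x" using regD[OF assms(1)] by blast
  then show "\<exists>V C. (V, C) \<in> A \<and> x \<in> V \<and> frac_at C (U \<inter> V) (\<lambda>x. f x * g x) x"
    using frac_at_mult[OF _ reg_chart[OF assms(2)]] x by blast
qed

lemma reg_inverse:
  assumes "reg A U f" "\<And>x. x \<in> U \<Longrightarrow> f x \<noteq> 0"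
  shows "reg A U (\<lambda>x. inverse (f x))"
proof (rule regI)
  fix x assume x: "x \<in> U"
  then obtain V C where "(V, C) \<in> A" "x \<in> V" "frac_at C (U \<inter> V) f x" using regD[OF assms(1)] by blast
  then show "\<exists>V C. (V, C) \<in> A \<and> x \<in> V \<and> frac_at C (U \<inter> V) (\<lambda>x. inverse (f x)) x"
    using frac_at_inverse[of C "U \<inter> V" f x] assms(2) x by blast
qed

lemma reg_divide: "reg A U f \<Longrightarrow> reg A U g \<Longrightarrow> (\<And>x. x \<in> U \<Longrightarrow> g x \<noteq> 0) \<Longrightarrow> reg A U (\<lambda>x. f x / g x)"
  unfolding divide_inverse by (intro reg_mult reg_inverse)

lemma reg_sum:
  "U \<subseteq> points A \<Longrightarrow> (\<And>i. i \<in> I \<Longrightarrow> reg A U (f i)) \<Longrightarrow> reg A U (\<lambda>x. \<Sum>i\<in>I. f i x)"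
  by (induction I rule: infinite_finite_induct) (auto intro: reg_const reg_add)

lemma reg_poly: "f \<in> poly_funs C \<Longrightarrow> (V, C) \<in> A \<Longrightarrow> U \<subseteq> V \<Longrightarrow> reg A U f"
  by (rule regI) (use frac_at_poly[of f C "U \<inter> V"] in blast)

lemma reg_poly_comp:
  assumes "f \<in> poly_funs C" "\<And>c. c \<in> C \<Longrightarrow> reg A U (\<lambda>x. c (\<phi> x))" "U \<subseteq> points A"
  shows "reg A U (\<lambda>x. f (\<phi> x))"
  using assms(1)
proof induction
  case (const c)
  show ?case by (rule reg_const[OF assms(3)])
next
  case (coord f)
  then show ?case by (rule assms(2))
next
  case (add f g)
  then show ?case by (intro reg_add)
next
  case (mult f g)
  then show ?case by (intro reg_mult)
qed

text \<open>
  In another chart \<open>f\<close> becomes a fraction on the overlap \<open>{D \<noteq> 0}\<close>, and the set is the locus where \<open>D\<close>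
  times its numerator does not vanish.
\<close>

lemma zariski_basic_open:
  assumes "(V, C) \<in> A" "f \<in> poly_funs C"
  shows "openin (zariski A) {x \<in> V. f x \<noteq> 0}"
  unfolding openin_zariski
proof (rule zariski_openI)
  show "{x \<in> V. f x \<noteq> 0} \<subseteq> points A" using assms(1) by force
next
  fix V' C' assume V': "(V', C') \<in> A"
  obtain D where D: "D \<in> poly_funs C'" "V' \<inter> V = {x \<in> V'. D x \<noteq> 0}"
    "\<And>f. f \<in> poly_funs C \<Longrightarrow> \<exists>P\<in>poly_funs C'. \<exists>m. \<forall>x\<in>V' \<inter> V. f x = P x / D x ^ m"
    using overlap_poly[OF V' assms(1)] by blast
  obtain P m where P: "P \<in> poly_funs C'" "\<forall>x\<in>V' \<inter> V. f x = P x / D x ^ m"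
    using D(3)[OF assms(2)] by blast
  have "x \<in> V \<and> f x \<noteq> 0 \<longleftrightarrow> D x * P x \<noteq> 0" if "x \<in> V'" for x
  proof (cases "D x = 0")
    case True
    then have "x \<notin> V" using D(2) that by blast
    then show ?thesis using True by simp
  next
    case False
    then have "x \<in> V' \<inter> V" using D(2) that by blast
    then have "f x = P x / D x ^ m" "x \<in> V" using P(2) by auto
    then show ?thesis using False by simp
  qed
  then have "{x \<in> V. f x \<noteq> 0} \<inter> V' = {x \<in> V'. \<exists>g\<in>{\<lambda>x. D x * P x}. g x \<noteq> 0}"
    by (auto simp del: mult_eq_0_iff)
  then show "\<exists>S\<subseteq>poly_funs C'. {x \<in> V. f x \<noteq> 0} \<inter> V' = {x \<in> V'. \<exists>g\<in>S. g x \<noteq> 0}"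
    using D(1) P(1) by (intro exI[of _ "{\<lambda>x. D x * P x}"] conjI) (auto intro: poly_funs.mult)
qed

lemma basic_open:
  assumes "(V, C) \<in> A" "f \<in> poly_funs C"
  shows "openin (zar_on A X) {x \<in> X \<inter> V. f x \<noteq> 0}"
  unfolding openin_subtopology
  using zariski_basic_open[OF assms] by (intro exI[of _ "{x \<in> V. f x \<noteq> 0}"]) auto

lemma chart_open: "(V, C) \<in> A \<Longrightarrow> openin (zar_on A X) (X \<inter> V)"
  using basic_open[of V C "\<lambda>_. 1" X] by (simp add: poly_funs.const Int_def)

lemma open_basic:
  assumes "openin (zar_on A X) U" "(V, C) \<in> A" "x \<in> U" "x \<in> V"
  obtains f where "f \<in> poly_funs C" "f x \<noteq> 0" "{y \<in> X \<inter> V. f y \<noteq> 0} \<subseteq> U"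
proof -
  obtain T where T: "zariski_open A T" "U = T \<inter> X"
    using assms(1) unfolding openin_subtopology openin_zariski by blast
  obtain S where S: "S \<subseteq> poly_funs C" "T \<inter> V = {x \<in> V. \<exists>f\<in>S. f x \<noteq> 0}"
    using zariski_openD(2)[OF T(1) assms(2)] by blast
  then obtain f where "f \<in> S" "f x \<noteq> 0" using T(2) assms by blast
  then show ?thesis using S T(2) that[of f] by blast
qed

lemma open_zarI:
  assumes "U \<subseteq> X"
    and "\<And>x. x \<in> U \<Longrightarrow> \<exists>V C f. (V, C) \<in> A \<and> x \<in> V \<and> f \<in> poly_funs C \<and> f x \<noteq> 0 \<and> {y \<in> X \<inter> V. f y \<noteq> 0} \<subseteq> U"
  shows "openin (zar_on A X) U"
proof (subst openin_subopen, intro ballI)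
  fix x assume "x \<in> U"
  then obtain V C f where "(V, C) \<in> A" "x \<in> V" "f \<in> poly_funs C" "f x \<noteq> 0" "{y \<in> X \<inter> V. f y \<noteq> 0} \<subseteq> U"
    using assms(2) by blast
  then show "\<exists>T. openin (zar_on A X) T \<and> x \<in> T \<and> T \<subseteq> U"
    using basic_open[of V C f X] assms(1) \<open>x \<in> U\<close> by (intro exI[of _ "{y \<in> X \<inter> V. f y \<noteq> 0}"]) auto
qed

lemma reg_local:
  assumes "U \<subseteq> X"
    and "\<And>x. x \<in> U \<Longrightarrow> \<exists>T. openin (zar_on A X) T \<and> x \<in> T \<and> reg A (T \<inter> U) f"
  shows "reg A U f"
  unfolding reg_def
proof (intro ballI)
  fix x assume x: "x \<in> U"
  then obtain T where T: "openin (zar_on A X) T" "x \<in> T" "reg A (T \<inter> U) f" using assms(2) by blast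
  obtain V C where V: "(V, C) \<in> A" "x \<in> V" "frac_at C (T \<inter> U \<inter> V) f x" using regD[OF T(3)] x T(2) by blast
  obtain P Q where PQ: "P \<in> poly_funs C" "Q \<in> poly_funs C" "Q x \<noteq> 0"
    "\<And>y. y \<in> T \<inter> U \<inter> V \<Longrightarrow> Q y \<noteq> 0 \<Longrightarrow> f y = P y / Q y" using V(3) by (elim frac_atE) blast
  obtain h where h: "h \<in> poly_funs C" "h x \<noteq> 0" "{y \<in> X \<inter> V. h y \<noteq> 0} \<subseteq> T"
    using open_basic[OF T(1) V(1) T(2) V(2)] by blast
  have "frac_at C (U \<inter> V) f x"
    using h PQ assms(1)
    by (intro frac_atI[of "\<lambda>y. P y * h y" C "\<lambda>y. Q y * h y"]) (auto intro!: poly_funs.mult)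
  then show "\<exists>V C. (V, C) \<in> A \<and> x \<in> V \<and> frac_at C (U \<inter> V) f x" using V by blast
qed

lemma regular_funs_iff: "f \<in> regular_funs A U \<longleftrightarrow> (\<forall>x. x \<notin> U \<longrightarrow> f x = 0) \<and> reg A U f"
proof
  assume f: "f \<in> regular_funs A U"
  have "\<exists>V C. (V, C) \<in> A \<and> x \<in> V \<and> frac_at C (U \<inter> V) f x" if x: "x \<in> U" for x
  proof -
    obtain V C T P Q where V: "(V, C) \<in> A" "openin (zariski A) T" "x \<in> T \<inter> V" "P \<in> poly_funs C"
      "Q \<in> poly_funs C" "\<forall>y\<in>T \<inter> V \<inter> U. Q y \<noteq> 0 \<and> f y = P y / Q y"
      using f x unfolding regular_funs_def by blast
    obtain h where h: "h \<in> poly_funs C" "h x \<noteq> 0" "{y \<in> UNIV \<inter> V. h y \<noteq> 0} \<subseteq> T"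
      using open_basic[of UNIV T V C x] V by (auto simp: subtopology_UNIV)
    have "frac_at C (U \<inter> V) f x"
      using h V x
      by (intro frac_atI[of "\<lambda>y. P y * h y" C "\<lambda>y. Q y * h y"]) (auto intro!: poly_funs.mult)
    then show ?thesis using V by blast
  qed
  then have r: "reg A U f" by (rule regI)
  have v: "\<forall>x. x \<notin> U \<longrightarrow> f x = 0"
    using f[unfolded regular_funs_def mem_Collect_eq] by (rule conjunct1)
  show "(\<forall>x. x \<notin> U \<longrightarrow> f x = 0) \<and> reg A U f" by (rule conjI[OF v r])
next
  assume f: "(\<forall>x. x \<notin> U \<longrightarrow> f x = 0) \<and> reg A U f"
  have "\<exists>(V, C)\<in>A. \<exists>T. openin (zariski A) T \<and> x \<in> T \<inter> V \<and>
        (\<exists>P\<in>poly_funs C. \<exists>Q\<in>poly_funs C. \<forall>y\<in>T \<inter> V \<inter> U. Q y \<noteq> 0 \<and> f y = P y / Q y)" if x: "x \<in> U" for x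
  proof -
    obtain V C where V: "(V, C) \<in> A" "x \<in> V" "frac_at C (U \<inter> V) f x"
      using regD[OF conjunct2[OF f] x] by blast
    obtain P Q where PQ: "P \<in> poly_funs C" "Q \<in> poly_funs C" "Q x \<noteq> 0"
      "\<And>y. y \<in> U \<inter> V \<Longrightarrow> Q y \<noteq> 0 \<Longrightarrow> f y = P y / Q y" using V(3) by (elim frac_atE) blast
    let ?T = "{x \<in> V. Q x \<noteq> 0}"
    have "\<forall>y\<in>?T \<inter> V \<inter> U. Q y \<noteq> 0 \<and> f y = P y / Q y" using PQ(4) by auto
    then have "\<exists>P\<in>poly_funs C. \<exists>Q\<in>poly_funs C. \<forall>y\<in>?T \<inter> V \<inter> U. Q y \<noteq> 0 \<and> f y = P y / Q y"
      using PQ(1,2) by (intro bexI[of _ P] bexI[of _ Q])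
    moreover have "openin (zariski A) ?T \<and> x \<in> ?T \<inter> V"
      using zariski_basic_open[OF V(1) PQ(2)] V(2) PQ(3) by simp
    ultimately have "\<exists>T. openin (zariski A) T \<and> x \<in> T \<inter> V \<and>
        (\<exists>P\<in>poly_funs C. \<exists>Q\<in>poly_funs C. \<forall>y\<in>T \<inter> V \<inter> U. Q y \<noteq> 0 \<and> f y = P y / Q y)"
      by (intro exI[of _ ?T]) simp
    then show ?thesis by (intro bexI[OF _ V(1)] case_prodI)
  qed
  then show "f \<in> regular_funs A U"
    unfolding regular_funs_def mem_Collect_eq by (intro conjI ballI conjunct1[OF f])
qed

lemma restr_regular_funs: "restr U f \<in> regular_funs A U \<longleftrightarrow> reg A U f"
  unfolding regular_funs_iff restr_def
  using reg_cong[of A U f U "\<lambda>x. if x \<in> U then f x else 0"]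
    reg_cong[of A U "\<lambda>x. if x \<in> U then f x else 0" U f] by auto

end


section \<open>Morphisms\<close>

text \<open>
  Locally, a morphism maps into one chart and has regular coordinates there.
\<close>

definition morph ::
  "('x, 'k::field) atlas \<Rightarrow> 'x set \<Rightarrow> ('y, 'k) atlas \<Rightarrow> 'y set \<Rightarrow> ('y \<Rightarrow> 'x) \<Rightarrow> bool" where
  "morph A X B Y \<phi> \<longleftrightarrow> \<phi> ` Y \<subseteq> X \<and> (\<forall>y\<in>Y. \<exists>V C Y'. (V, C) \<in> A \<and> openin (zar_on B Y) Y' \<and> y \<in> Y' \<and>
     \<phi> ` Y' \<subseteq> V \<and> (\<forall>c\<in>C. reg B Y' (\<lambda>z. c (\<phi> z))))"

locale atlas_pair = A: nice_atlas A + B: nice_atlas B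
  for A :: "('x, 'k::field) atlas" and B :: "('y, 'k) atlas"
begin

text \<open>
  Near each point a morphism is given by fractions with one denominator \<open>D\<close>, so
  it pulls fractions back to fractions.
\<close>

lemma morph_frac:
  assumes "morph A X B Y \<phi>" "y \<in> Y"
  obtains V C V' C' D where "(V, C) \<in> A" "(V', C') \<in> B" "y \<in> V'" "\<phi> y \<in> V" "D \<in> poly_funs C'" "D y \<noteq> 0"
    "\<And>z. z \<in> Y \<inter> V' \<Longrightarrow> D z \<noteq> 0 \<Longrightarrow> \<phi> z \<in> V"
    "\<And>f. f \<in> poly_funs C \<Longrightarrow> \<exists>P\<in>poly_funs C'. \<exists>m. \<forall>z\<in>Y \<inter> V'. D z \<noteq> 0 \<longrightarrow> f (\<phi> z) = P z / D z ^ m"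
proof -
  obtain V C Y' where V: "(V, C) \<in> A" "openin (zar_on B Y) Y'" "y \<in> Y'" "\<phi> ` Y' \<subseteq> V"
    "\<forall>c\<in>C. reg B Y' (\<lambda>z. c (\<phi> z))" using assms unfolding morph_def by blast
  have Y': "Y' \<subseteq> Y" using V(2) zar_on_subset by blast
  have "reg B Y' (\<lambda>_. 0)"
  proof -
    have "openin (zariski B) Z \<Longrightarrow> Z \<subseteq> points B" for Z
      using zariski_openD(1) openin_zariski by blast
    then show ?thesis using V(2) unfolding openin_subtopology by (intro B.reg_const) blast
  qed
  then obtain V' C' where V': "(V', C') \<in> B" "y \<in> V'" using V(3) by (meson regD)
  obtain Q P where QP: "Q \<in> poly_funs C'" "Q y \<noteq> 0"
    "\<forall>c\<in>C. P c \<in> poly_funs C' \<and> (\<forall>z\<in>Y' \<inter> V'. Q z \<noteq> 0 \<longrightarrow> c (\<phi> z) = P c z / Q z)"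
    using common_denominator[OF A.finite_coords[OF V(1)], of C' "Y' \<inter> V'" "\<lambda>c z. c (\<phi> z)" y]
      B.reg_chart[OF _ V'(1) V(3) V'(2)] V(5) by blast
  obtain h where h: "h \<in> poly_funs C'" "h y \<noteq> 0" "{z \<in> Y \<inter> V'. h z \<noteq> 0} \<subseteq> Y'"
    using B.open_basic[OF V(2) V'(1) V(3) V'(2)] by blast
  define D where "D = (\<lambda>z. Q z * h z)"
  have D: "D \<in> poly_funs C'" using QP(1) h(1) by (auto simp: D_def intro: poly_funs.mult)
  let ?E = "{z \<in> Y \<inter> V'. D z \<noteq> 0}"
  have "\<exists>P'\<in>poly_funs C'. \<forall>z\<in>?E. c (\<phi> z) = P' z / D z" if "c \<in> C" for c
    using QP that h
    by (intro bexI[of _ "\<lambda>z. P c z * h z"] ballI) (auto simp: D_def intro!: poly_funs.mult)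
  then have frac: "\<exists>P\<in>poly_funs C'. \<exists>m. \<forall>z\<in>?E. f (\<phi> z) = P z / D z ^ m" if "f \<in> poly_funs C" for f
    using poly_funs_frac[OF D _ _ that, of ?E \<phi>] by blast
  show ?thesis
  proof (rule that[OF V(1) V' _ D])
    show "\<phi> y \<in> V" using V(3,4) by blast
    show "D y \<noteq> 0" using QP(2) h(2) by (simp add: D_def)
    show "\<phi> z \<in> V" if "z \<in> Y \<inter> V'" "D z \<noteq> 0" for z
      using that h(3) V(4) by (auto simp: D_def)
    show "\<exists>P\<in>poly_funs C'. \<exists>m. \<forall>z\<in>Y \<inter> V'. D z \<noteq> 0 \<longrightarrow> f (\<phi> z) = P z / D z ^ m"
      if "f \<in> poly_funs C" for f using frac[OF that] by blast
  qed
qed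

lemma morph_open:
  assumes "morph A X B Y \<phi>" "openin (zar_on A X) U"
  shows "openin (zar_on B Y) {y \<in> Y. \<phi> y \<in> U}"
proof (rule B.open_zarI)
  fix y assume "y \<in> {y \<in> Y. \<phi> y \<in> U}"
  then have y: "y \<in> Y" "\<phi> y \<in> U" by auto
  obtain V C V' C' D where V: "(V, C) \<in> A" "(V', C') \<in> B" "y \<in> V'" "\<phi> y \<in> V" "D \<in> poly_funs C'" "D y \<noteq> 0"
    "\<And>z. z \<in> Y \<inter> V' \<Longrightarrow> D z \<noteq> 0 \<Longrightarrow> \<phi> z \<in> V"
    "\<And>f. f \<in> poly_funs C \<Longrightarrow> \<exists>P\<in>poly_funs C'. \<exists>m. \<forall>z\<in>Y \<inter> V'. D z \<noteq> 0 \<longrightarrow> f (\<phi> z) = P z / D z ^ m"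
    by (rule morph_frac[OF assms(1) y(1)]) (rule that; assumption)
  obtain f where f: "f \<in> poly_funs C" "f (\<phi> y) \<noteq> 0" "{x \<in> X \<inter> V. f x \<noteq> 0} \<subseteq> U"
    using A.open_basic[OF assms(2) V(1) y(2) V(4)] by blast
  obtain P m where P: "P \<in> poly_funs C'" "\<forall>z\<in>Y \<inter> V'. D z \<noteq> 0 \<longrightarrow> f (\<phi> z) = P z / D z ^ m"
    using V(8)[OF f(1)] by blast
  have "f (\<phi> y) = P y / D y ^ m" using P(2) y(1) V(3,6) by blast
  then have "P y * D y \<noteq> 0" using f(2) V(6) by auto
  moreover have "z \<in> {y \<in> Y. \<phi> y \<in> U}" if z: "z \<in> Y \<inter> V'" "P z * D z \<noteq> 0" for z
  proof -
    have "f (\<phi> z) = P z / D z ^ m" using P(2) z by auto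
    then have "f (\<phi> z) \<noteq> 0" using z(2) by auto
    moreover have "\<phi> z \<in> X \<inter> V" using z V(7)[of z] assms(1) by (auto simp: morph_def)
    ultimately show ?thesis using f(3) z(1) by blast
  qed
  ultimately show "\<exists>V C f. (V, C) \<in> B \<and> y \<in> V \<and> f \<in> poly_funs C \<and> f y \<noteq> 0 \<and>
      {y \<in> Y \<inter> V. f y \<noteq> 0} \<subseteq> {y \<in> Y. \<phi> y \<in> U}"
    using V P(1)
    by (intro exI[of _ V'] exI[of _ C'] exI[of _ "\<lambda>z. P z * D z"] conjI) (auto intro: poly_funs.mult)
qed auto

lemma morph_reg:
  assumes "morph A X B Y \<phi>" "reg A U f" "V0 \<subseteq> Y" "\<phi> ` V0 \<subseteq> U"
  shows "reg B V0 (\<lambda>y. f (\<phi> y))"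
  unfolding reg_def
proof (intro ballI)
  fix y assume y: "y \<in> V0"
  then have "y \<in> Y" using assms(3) by blast
  obtain V C V' C' D where V: "(V, C) \<in> A" "(V', C') \<in> B" "y \<in> V'" "\<phi> y \<in> V" "D \<in> poly_funs C'" "D y \<noteq> 0"
    "\<And>z. z \<in> Y \<inter> V' \<Longrightarrow> D z \<noteq> 0 \<Longrightarrow> \<phi> z \<in> V"
    "\<And>f. f \<in> poly_funs C \<Longrightarrow> \<exists>P\<in>poly_funs C'. \<exists>m. \<forall>z\<in>Y \<inter> V'. D z \<noteq> 0 \<longrightarrow> f (\<phi> z) = P z / D z ^ m"
    by (rule morph_frac[OF assms(1) \<open>y \<in> Y\<close>]) (rule that; assumption)
  have "\<phi> y \<in> U" using y assms(4) by blast
  obtain P Q where PQ: "P \<in> poly_funs C" "Q \<in> poly_funs C" "Q (\<phi> y) \<noteq> 0"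
    "\<And>x. x \<in> U \<inter> V \<Longrightarrow> Q x \<noteq> 0 \<Longrightarrow> f x = P x / Q x"
    using A.reg_chart[OF assms(2) V(1) \<open>\<phi> y \<in> U\<close> V(4)] by (elim frac_atE) blast
  obtain p m q l where p: "p \<in> poly_funs C'" "\<forall>z\<in>Y \<inter> V'. D z \<noteq> 0 \<longrightarrow> P (\<phi> z) = p z / D z ^ m"
    and q: "q \<in> poly_funs C'" "\<forall>z\<in>Y \<inter> V'. D z \<noteq> 0 \<longrightarrow> Q (\<phi> z) = q z / D z ^ l"
    using V(8)[OF PQ(1)] V(8)[OF PQ(2)] by blast
  have "Q (\<phi> y) = q y / D y ^ l" using q(2) V(3,6) \<open>y \<in> Y\<close> by blast
  then have qy: "q y \<noteq> 0" using PQ(3) by auto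
  have "f (\<phi> z) = (p z * D z ^ Suc l) / (q z * D z ^ Suc m)"
    if z: "z \<in> V0 \<inter> V'" "q z * D z ^ Suc m \<noteq> 0" for z
  proof -
    have nz: "q z \<noteq> 0" "D z \<noteq> 0" using z(2) by auto
    have zY: "z \<in> Y \<inter> V'" using z assms(3) by blast
    then have e: "P (\<phi> z) = p z / D z ^ m" "Q (\<phi> z) = q z / D z ^ l" using p(2) q(2) nz by blast+
    moreover have "f (\<phi> z) = P (\<phi> z) / Q (\<phi> z)"
      using PQ(4)[of "\<phi> z"] V(7)[OF zY] z assms(4) nz e(2) by auto
    ultimately have "f (\<phi> z) = (p z / D z ^ m) / (q z / D z ^ l)" by simp
    then show ?thesis using nz by simp
  qed
  then have "frac_at C' (V0 \<inter> V') (\<lambda>y. f (\<phi> y)) y"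
    using p(1) q(1) V(5,6) qy
    by (intro frac_atI[of "\<lambda>y. p y * D y ^ Suc l" C' "\<lambda>y. q y * D y ^ Suc m"])
      (auto intro!: poly_funs.mult poly_funs_power simp del: power_Suc)
  then show "\<exists>V C. (V, C) \<in> B \<and> y \<in> V \<and> frac_at C (V0 \<inter> V) (\<lambda>y. f (\<phi> y)) y" using V by blast
qed

end


section \<open>Vector-valued functions\<close>

context finite_dimensional_vector_space
begin

definition bcoord :: "'b \<Rightarrow> 'b \<Rightarrow> 'a" where
  "bcoord b v = representation Basis v b"

lemma bcoord_add: "bcoord b (u + v) = bcoord b u + bcoord b v"
  by (simp add: bcoord_def representation_add independent_Basis span_Basis)

lemma bcoord_scale: "bcoord b (scale c v) = c * bcoord b v"
  by (simp add: bcoord_def representation_scale independent_Basis span_Basis)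

lemma bcoord_zero: "bcoord b 0 = 0"
  by (simp add: bcoord_def representation_zero)

lemma bcoord_sum: "bcoord b (\<Sum>i\<in>I. f i) = (\<Sum>i\<in>I. bcoord b (f i))"
  by (induction I rule: infinite_finite_induct) (auto simp: bcoord_add bcoord_zero)

lemma bcoord_expand: "(\<Sum>b\<in>Basis. scale (bcoord b v) b) = v"
  unfolding bcoord_def
  by (rule sum_representation_eq) (auto simp: independent_Basis span_Basis finite_Basis)

lemma bcoord_linear:
  assumes "Vector_Spaces.linear scale scale f"
  shows "bcoord b (f v) = (\<Sum>b'\<in>Basis. bcoord b' v * bcoord b (f b'))"
proof -
  interpret f: Vector_Spaces.linear scale scale f by fact
  have "f v = f (\<Sum>b\<in>Basis. scale (bcoord b v) b)" by (simp only: bcoord_expand)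
  also have "\<dots> = (\<Sum>b\<in>Basis. scale (bcoord b v) (f b))" by (simp add: f.sum f.scale)
  finally show ?thesis by (simp only: bcoord_sum bcoord_scale)
qed

lemma tens_coords:
  assumes "(\<lambda>_. 0) \<in> R" "\<And>f g. f \<in> R \<Longrightarrow> g \<in> R \<Longrightarrow> (\<lambda>x. f x + g x) \<in> R"
    and "\<And>f c. f \<in> R \<Longrightarrow> (\<lambda>x. f x * c) \<in> R"
  shows "t \<in> tens scale R \<longleftrightarrow> (\<forall>b\<in>Basis. (\<lambda>x. bcoord b (t x)) \<in> R)"
proof
  assume "t \<in> tens scale R"
  then obtain N :: nat and f m where t: "t = (\<lambda>x. \<Sum>i<N. scale (f i x) (m i))" and f: "\<forall>i<N. f i \<in> R"
    unfolding tens_def by blast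
  have "(\<lambda>x. \<Sum>i<K. f i x * bcoord b (m i)) \<in> R" if "K \<le> N" for K b
    using that by (induction K) (use f assms in \<open>auto simp: Suc_le_eq\<close>)
  then show "\<forall>b\<in>Basis. (\<lambda>x. bcoord b (t x)) \<in> R" by (simp add: t bcoord_sum bcoord_scale)
next
  assume t: "\<forall>b\<in>Basis. (\<lambda>x. bcoord b (t x)) \<in> R"
  obtain N h where h: "bij_betw h {..<N::nat} Basis"
    using ex_bij_betw_nat_finite[OF finite_Basis] by (metis lessThan_atLeast0)
  have "t x = (\<Sum>i<N. scale (bcoord (h i) (t x)) (h i))" for x
    using sum.reindex_bij_betw[OF h, of "\<lambda>b. scale (bcoord b (t x)) b"] by (simp add: bcoord_expand)
  moreover have "\<forall>i<N. (\<lambda>x. bcoord (h i) (t x)) \<in> R"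
    using t bij_betwE[OF h] by simp
  ultimately show "t \<in> tens scale R"
    unfolding tens_def mem_Collect_eq
    by (intro exI[of _ N] exI[of _ "\<lambda>i x. bcoord (h i) (t x)"] exI[of _ h] conjI ext)
qed

definition vpoly :: "('x \<Rightarrow> 'a) set \<Rightarrow> ('x \<Rightarrow> 'b) \<Rightarrow> bool" where
  "vpoly C p \<longleftrightarrow> (\<forall>b\<in>Basis. (\<lambda>x. bcoord b (p x)) \<in> poly_funs C)"

lemma vpoly_scale: "f \<in> poly_funs C \<Longrightarrow> vpoly C p \<Longrightarrow> vpoly C (\<lambda>x. scale (f x) (p x))"
  unfolding vpoly_def bcoord_scale by (auto intro: poly_funs.mult)

lemma tens_coord_ring:
  "t \<in> tens scale (coord_ring C Z) \<longleftrightarrow> (\<exists>p. vpoly C p \<and> t = restr Z p)"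
proof -
  have *: "t \<in> tens scale (coord_ring C Z) \<longleftrightarrow> (\<forall>b\<in>Basis. (\<lambda>x. bcoord b (t x)) \<in> coord_ring C Z)"
  proof (rule tens_coords)
    show "(\<lambda>_. 0) \<in> coord_ring C Z"
      unfolding coord_ring_def
      by (rule image_eqI[OF _ poly_funs.const[of 0]]) (auto simp: restr_def)
  next
    fix f g assume "f \<in> coord_ring C Z" "g \<in> coord_ring C Z"
    then obtain p q where "p \<in> poly_funs C" "q \<in> poly_funs C" "f = restr Z p" "g = restr Z q"
      by (auto simp: coord_ring_def)
    then show "(\<lambda>x. f x + g x) \<in> coord_ring C Z"
      unfolding coord_ring_def
      by (intro image_eqI[OF _ poly_funs.add[of p _ q]]) (auto simp: restr_def)
  next
    fix f c assume "f \<in> coord_ring C Z"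
    then obtain p where "p \<in> poly_funs C" "f = restr Z p" by (auto simp: coord_ring_def)
    then show "(\<lambda>x. f x * c) \<in> coord_ring C Z"
      unfolding coord_ring_def
      by (intro image_eqI[OF _ poly_funs.mult[OF _ poly_funs.const[of c], of p]]) (auto simp: restr_def)
  qed
  show ?thesis
    unfolding *
  proof
    assume "\<forall>b\<in>Basis. (\<lambda>x. bcoord b (t x)) \<in> coord_ring C Z"
    then have "\<forall>b\<in>Basis. \<exists>p. p \<in> poly_funs C \<and> (\<lambda>x. bcoord b (t x)) = restr Z p"
      by (auto simp: coord_ring_def)
    then obtain p where p: "\<forall>b\<in>Basis. p b \<in> poly_funs C \<and> (\<lambda>x. bcoord b (t x)) = restr Z (p b)"
      by (rule bchoice[THEN exE])
    define P where "P = (\<lambda>x. \<Sum>b\<in>Basis. scale (p b x) b)"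
    have "t x = restr Z P x" for x
    proof -
      have "bcoord b (t x) = restr Z (p b) x" if "b \<in> Basis" for b
        using bspec[OF p that] by (metis)
      then have "t x = (\<Sum>b\<in>Basis. scale (restr Z (p b) x) b)"
        using bcoord_expand[of "t x"] by simp
      then show ?thesis by (simp add: restr_def P_def)
    qed
    moreover have "vpoly C P"
      unfolding vpoly_def
    proof
      fix b
      have "(\<lambda>x. \<Sum>b'\<in>Basis. p b' x * bcoord b b') \<in> poly_funs C"
        using p by (intro poly_funs_sum poly_funs.mult poly_funs.const) auto
      then show "(\<lambda>x. bcoord b (P x)) \<in> poly_funs C" by (simp add: P_def bcoord_sum bcoord_scale)
    qed
    ultimately show "\<exists>p. vpoly C p \<and> t = restr Z p" by (intro exI[of _ P]) auto
  next
    assume "\<exists>p. vpoly C p \<and> t = restr Z p"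
    then obtain p where p: "vpoly C p" "t = restr Z p" by blast
    have "(\<lambda>x. bcoord b (t x)) = restr Z (\<lambda>x. bcoord b (p x))" for b
      by (auto simp: p restr_def bcoord_zero)
    then show "\<forall>b\<in>Basis. (\<lambda>x. bcoord b (t x)) \<in> coord_ring C Z"
      using p(1) by (auto simp: coord_ring_def vpoly_def)
  qed
qed

end

locale vector_atlas = nice_atlas A + M: finite_dimensional_vector_space sM BM
  for A :: "('x, 'k::field) atlas" and sM :: "'k \<Rightarrow> 'm::ab_group_add \<Rightarrow> 'm" and BM
begin

definition vreg :: "'x set \<Rightarrow> ('x \<Rightarrow> 'm) \<Rightarrow> bool" where
  "vreg U t \<longleftrightarrow> (\<forall>b\<in>BM. reg A U (\<lambda>x. M.bcoord b (t x)))"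

lemma vreg_add: "vreg U s \<Longrightarrow> vreg U t \<Longrightarrow> vreg U (\<lambda>x. s x + t x)"
  unfolding vreg_def M.bcoord_add by (auto intro: reg_add)

lemma vreg_scale: "reg A U a \<Longrightarrow> vreg U t \<Longrightarrow> vreg U (\<lambda>x. sM (a x) (t x))"
  unfolding vreg_def M.bcoord_scale by (auto intro: reg_mult)

lemma vreg_const: "U \<subseteq> points A \<Longrightarrow> vreg U (\<lambda>_. v)"
  unfolding vreg_def by (auto intro: reg_const)

lemma vreg_sum: "U \<subseteq> points A \<Longrightarrow> (\<And>i. i \<in> I \<Longrightarrow> vreg U (f i)) \<Longrightarrow> vreg U (\<lambda>x. \<Sum>i\<in>I. f i x)"
  unfolding vreg_def M.bcoord_sum by (auto intro: reg_sum)

lemma vreg_linear: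
  assumes "Vector_Spaces.linear sM sM f" "vreg U t" "U \<subseteq> points A"
  shows "vreg U (\<lambda>x. f (t x))"
  unfolding vreg_def
proof
  fix b
  have "reg A U (\<lambda>x. \<Sum>b'\<in>BM. M.bcoord b' (t x) * M.bcoord b (f b'))"
    using assms(2,3) by (intro reg_sum reg_mult reg_const) (auto simp: vreg_def)
  then show "reg A U (\<lambda>x. M.bcoord b (f (t x)))"
    by (rule reg_cong[OF _ order_refl M.bcoord_linear[OF assms(1), symmetric]])
qed

lemma vreg_cong: "vreg U s \<Longrightarrow> U' \<subseteq> U \<Longrightarrow> (\<And>y. y \<in> U' \<Longrightarrow> s y = t y) \<Longrightarrow> vreg U' t"
  unfolding vreg_def
  by (intro ballI, rule reg_cong[where f = "\<lambda>x. M.bcoord _ (s x)" and U = U]) auto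

lemma vreg_mono: "vreg U t \<Longrightarrow> U' \<subseteq> U \<Longrightarrow> vreg U' t"
  by (rule vreg_cong[where s = t]) auto

lemma vreg_restr: "vreg U (restr U t) \<longleftrightarrow> vreg U t"
  using vreg_cong[of U t U "restr U t"] vreg_cong[of U "restr U t" U t] by (auto simp: restr_def)

lemma vreg_local:
  assumes "U \<subseteq> X"
    and "\<And>x. x \<in> U \<Longrightarrow> \<exists>T. openin (zar_on A X) T \<and> x \<in> T \<and> vreg (T \<inter> U) t"
  shows "vreg U t"
  unfolding vreg_def
proof (intro ballI)
  fix b assume "b \<in> BM"
  then show "reg A U (\<lambda>x. M.bcoord b (t x))"
    using assms(2) by (intro reg_local[OF assms(1)]) (auto simp: vreg_def)
qed

lemma vreg_vpoly: "M.vpoly C p \<Longrightarrow> (V, C) \<in> A \<Longrightarrow> U \<subseteq> V \<Longrightarrow> vreg U p"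
  unfolding vreg_def M.vpoly_def by (auto intro: reg_poly)

lemma vreg_common_denominator:
  assumes "finite I" "\<And>i. i \<in> I \<Longrightarrow> vreg U (t i)" "(V, C) \<in> A" "x \<in> U" "x \<in> V"
  obtains Q P where "Q \<in> poly_funs C" "Q x \<noteq> 0" "\<And>i. i \<in> I \<Longrightarrow> M.vpoly C (P i)"
    "\<And>i y. i \<in> I \<Longrightarrow> y \<in> U \<inter> V \<Longrightarrow> Q y \<noteq> 0 \<Longrightarrow> sM (Q y) (t i y) = P i y"
proof -
  have "frac_at C (U \<inter> V) (\<lambda>y. M.bcoord (snd ib) (t (fst ib) y)) x" if "ib \<in> I \<times> BM" for ib
    using assms that by (intro reg_chart[OF _ assms(3-5)]) (auto simp: vreg_def)
  then obtain Q p where Q: "Q \<in> poly_funs C" "Q x \<noteq> 0"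
    and p: "\<forall>ib\<in>I \<times> BM. p ib \<in> poly_funs C \<and>
      (\<forall>y\<in>U \<inter> V. Q y \<noteq> 0 \<longrightarrow> M.bcoord (snd ib) (t (fst ib) y) = p ib y / Q y)"
    using common_denominator[of "I \<times> BM" C "U \<inter> V" "\<lambda>ib y. M.bcoord (snd ib) (t (fst ib) y)" x]
      assms(1) M.finite_Basis by auto
  define P where "P i = (\<lambda>y. \<Sum>b\<in>BM. sM (p (i, b) y) b)" for i
  show ?thesis
  proof (rule that[OF Q])
    fix i assume i: "i \<in> I"
    show "M.vpoly C (P i)"
      unfolding M.vpoly_def P_def M.bcoord_sum M.bcoord_scale
      using p i by (intro ballI poly_funs_sum poly_funs.mult poly_funs.const) auto
    fix y assume y: "y \<in> U \<inter> V" "Q y \<noteq> 0"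
    have "sM (Q y) (t i y) = sM (Q y) (\<Sum>b\<in>BM. sM (M.bcoord b (t i y)) b)"
      by (simp only: M.bcoord_expand)
    also have "\<dots> = (\<Sum>b\<in>BM. sM (Q y * M.bcoord b (t i y)) b)"
      by (simp add: M.scale_sum_right)
    also have "\<dots> = P i y"
    proof -
      have "Q y * M.bcoord b (t i y) = p (i, b) y" if "b \<in> BM" for b
      proof -
        have "M.bcoord b (t i y) = p (i, b) y / Q y"
          using bspec[OF p, of "(i, b)"] that i y by simp
        then show ?thesis using y(2) by simp
      qed
      then show ?thesis by (simp add: P_def)
    qed
    finally show "sM (Q y) (t i y) = P i y" .
  qed
qed

lemma tens_regular_funs:
  assumes "U \<subseteq> points A"
  shows "t \<in> tens sM (regular_funs A U) \<longleftrightarrow> (\<forall>x. x \<notin> U \<longrightarrow> t x = 0) \<and> vreg U t"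
proof -
  have "t \<in> tens sM (regular_funs A U) \<longleftrightarrow> (\<forall>b\<in>BM. (\<lambda>x. M.bcoord b (t x)) \<in> regular_funs A U)"
    by (rule M.tens_coords)
      (use assms in \<open>auto simp: regular_funs_iff intro: reg_add reg_mult reg_const\<close>)
  also have "\<dots> \<longleftrightarrow> (\<forall>x. x \<notin> U \<longrightarrow> (\<forall>b\<in>BM. M.bcoord b (t x) = 0)) \<and> vreg U t"
    unfolding regular_funs_iff vreg_def by auto
  moreover have "(\<forall>b\<in>BM. M.bcoord b v = 0) \<longleftrightarrow> v = 0" for v
    using M.bcoord_expand[of v] by (auto simp: M.bcoord_zero)
  ultimately show ?thesis by simp
qed

lemma restr_tens_regular_funs:
  "U \<subseteq> points A \<Longrightarrow> restr U t \<in> tens sM (regular_funs A U) \<longleftrightarrow> vreg U t"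
  by (simp add: tens_regular_funs vreg_restr) (simp add: restr_def)

end


section \<open>Coherence of sheaves defined by pointwise linear conditions\<close>

text \<open>
  The sheaf of those sections of a free sheaf that have values in prescribed subspaces \<open>K x\<close> is of
  finite type. On a chart, the polynomial sections form a finitely generated module, and every local
  section is a quotient of a polynomial section: clear denominators, and multiply with a function that
  vanishes outside the open set where the section lives, so that the condition holds on the whole chart.
\<close>

lemma (in nice_atlas) finite_type_pointwise:
  fixes sN :: "'k \<Rightarrow> 'n::ab_group_add \<Rightarrow> 'n" and e :: "nat \<Rightarrow> 'n"
  assumes "vector_space sN"
    and F: "\<And>V t. openin (zar_on A X) V \<Longrightarrow> t \<in> F V \<longleftrightarrow> (\<forall>x. x \<notin> V \<longrightarrow> t x = 0) \<and>
      (\<exists>a. (\<forall>i<n. reg A V (a i)) \<and> (\<forall>x\<in>V. t x = (\<Sum>i<n. sN (a i x) (e i)))) \<and> (\<forall>x\<in>V. t x \<in> K x)"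
    and K: "\<And>x. 0 \<in> K x" "\<And>x u v. u \<in> K x \<Longrightarrow> v \<in> K x \<Longrightarrow> u + v \<in> K x"
      "\<And>x c v. v \<in> K x \<Longrightarrow> sN c v \<in> K x"
    and X: "X \<subseteq> points A"
  shows "finite_type sN A X F"
  unfolding finite_type_def
proof (intro ballI)
  interpret N: vector_space sN by fact
  fix x assume "x \<in> X"
  then obtain V C where V: "(V, C) \<in> A" "x \<in> V" using X by auto
  define U where "U = X \<inter> V"
  have U: "openin (zar_on A X) U" unfolding U_def by (rule chart_open[OF V(1)])
  define comb where "comb v y = (\<Sum>i<n. sN (v i y) (e i))" for v :: "nat \<Rightarrow> 'x \<Rightarrow> 'k" and y
  define L where "L = {v. (\<forall>i<n. v i \<in> poly_funs C) \<and> (\<forall>i\<ge>n. v i = (\<lambda>_. 0)) \<and> (\<forall>y\<in>U. comb v y \<in> K y)}"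
  have comb_add: "comb (\<lambda>i x. u i x + v i x) y = comb u y + comb v y" for u v y
    by (simp add: comb_def N.scale_left_distrib sum.distrib)
  have comb_scale: "comb (\<lambda>i x. a x * v i x) y = sN (a y) (comb v y)" for a v y
    by (simp add: comb_def N.scale_sum_right)
  have comb_zero: "comb (\<lambda>i x. 0) y = 0" for y by (simp add: comb_def)
  have "\<exists>k G. (\<forall>l<k. G l \<in> L) \<and>
    (\<forall>v\<in>L. \<exists>c. (\<forall>l<k. c l \<in> poly_funs C) \<and> (\<forall>i x. v i x = (\<Sum>l<(k::nat). c l x * G l i x)))"
  proof (rule poly_funs_submodule_fg[of C L n])
    show "finite C" using finite_coords V(1) by blast
    show "(\<lambda>i x. 0) \<in> L" using K(1) by (auto simp: L_def comb_zero intro: poly_funs.const)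
    show "(\<lambda>i x. u i x + v i x) \<in> L" if "u \<in> L" "v \<in> L" for u v
      using that K(2) by (auto simp: L_def comb_add intro!: poly_funs.add)
    show "(\<lambda>i x. a x * v i x) \<in> L" if "a \<in> poly_funs C" "v \<in> L" for a v
      using that K(3) by (auto simp: L_def comb_scale intro!: poly_funs.mult)
    show "(\<forall>i<n. v i \<in> poly_funs C) \<and> (\<forall>i\<ge>n. v i = (\<lambda>_. 0))" if "v \<in> L" for v
      using that by (simp add: L_def)
  qed
  then obtain k :: nat and G where G0: "\<forall>l<k. G l \<in> L" and
    gen: "\<forall>v\<in>L. \<exists>c. (\<forall>l<k. c l \<in> poly_funs C) \<and> (\<forall>i x. v i x = (\<Sum>l<k. c l x * G l i x))"
    by blast
  note G = G0[rule_format]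
  define s where "s l = restr U (comb (G l))" for l
  have s: "s l \<in> F U" if "l < k" for l
    unfolding F[OF U]
  proof (intro conjI exI[of _ "G l"])
    show "\<forall>i<n. reg A U (G l i)"
      using G[OF that] reg_poly[OF _ V(1), of _ U] by (auto simp: L_def U_def)
  qed (use G[OF that] in \<open>auto simp: s_def restr_def comb_def L_def\<close>)
  have cover: "\<exists>V' a. openin (zar_on A X) V' \<and> y \<in> V' \<and> V' \<subseteq> V0 \<and> (\<forall>l<k. a l \<in> regular_funs A V') \<and>
      restr V' t = (\<lambda>z. \<Sum>l<k. sN (a l z) (s l z))"
    if V0: "openin (zar_on A X) V0" "V0 \<subseteq> U" "t \<in> F V0" "y \<in> V0" for V0 t y
  proof -
    obtain a where a: "\<forall>i<n. reg A V0 (a i)" "\<forall>x\<in>V0. t x = comb a x" and tK: "\<forall>x\<in>V0. t x \<in> K x"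
      using V0(3) unfolding F[OF V0(1)] comb_def by blast
    have yV: "y \<in> V" and V0V: "V0 \<subseteq> V" using V0 by (auto simp: U_def)
    have "frac_at C (V0 \<inter> V) (a i) y" if "i \<in> {..<n}" for i
      using a(1) that V0 yV V(1) by (intro reg_chart) auto
    then obtain Q P where Q: "Q \<in> poly_funs C" "Q y \<noteq> 0"
      and P: "\<forall>i\<in>{..<n}. P i \<in> poly_funs C \<and> (\<forall>z\<in>V0 \<inter> V. Q z \<noteq> 0 \<longrightarrow> a i z = P i z / Q z)"
      using common_denominator[of "{..<n}" C "V0 \<inter> V" a y] by auto
    obtain h where h: "h \<in> poly_funs C" "h y \<noteq> 0" "{z \<in> X \<inter> V. h z \<noteq> 0} \<subseteq> V0"
      using open_basic[OF V0(1) V(1) V0(4) yV] by blast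
    define v where "v i = (if i < n then (\<lambda>z. h z * Q z * P i z) else (\<lambda>_. 0))" for i
    \<comment> \<open>where \<open>H\<close> vanishes, so does \<open>v\<close>, and elsewhere \<open>v\<close> is a multiple of \<open>t\<close>\<close>
    define H where "H = (\<lambda>z. h z * Q z)"
    have H: "H \<in> poly_funs C" using h(1) Q(1) by (auto simp: H_def intro: poly_funs.mult)
    have comb_v: "comb v z = sN (H z * Q z) (t z)" if z: "z \<in> U" "H z \<noteq> 0" for z
    proof -
      have zV0: "z \<in> V0" "z \<in> V" "Q z \<noteq> 0" using z h(3) by (auto simp: U_def H_def)
      have "v i z = H z * Q z * a i z" if "i < n" for i
        using bspec[OF P, of i] that zV0 by (simp add: v_def H_def)
      then have "comb v z = (\<Sum>i<n. sN (H z * Q z * a i z) (e i))" by (simp add: comb_def)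
      also have "\<dots> = sN (H z * Q z) (comb a z)" by (simp add: comb_def N.scale_sum_right)
      finally show ?thesis using a(2) zV0 by simp
    qed
    have "v \<in> L"
      unfolding L_def mem_Collect_eq
    proof (intro conjI ballI)
      show "\<forall>i<n. v i \<in> poly_funs C" using P h(1) Q(1) by (auto simp: v_def intro!: poly_funs.mult)
      fix z assume z: "z \<in> U"
      show "comb v z \<in> K z"
      proof (cases "H z = 0")
        case True
        have "v i z = 0" for i
        proof -
          have "v i z = (if i < n then H z * P i z else 0)" by (simp add: v_def H_def)
          then show ?thesis using True by simp
        qed
        then show ?thesis using K(1) by (simp add: comb_def)
      next
        case False
        then have "z \<in> V0" using h(3) z by (auto simp: U_def H_def)
        then show ?thesis using comb_v[OF z False] tK K(3) by simp
      qed
    qed (simp add: v_def)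
    then obtain c where c: "\<forall>l<k. c l \<in> poly_funs C" "\<forall>i x. v i x = (\<Sum>l<k. c l x * G l i x)"
      using bspec[OF gen \<open>v \<in> L\<close>] by (elim exE conjE) (rule that, assumption+)
    have comb_vc: "comb v z = (\<Sum>l<k. sN (c l z) (comb (G l) z))" for z
    proof -
      have "comb v z = (\<Sum>i<n. \<Sum>l<k. sN (c l z * G l i z) (e i))"
        unfolding comb_def using c(2) by (simp add: N.scale_sum_left)
      also have "\<dots> = (\<Sum>l<k. \<Sum>i<n. sN (c l z * G l i z) (e i))" by (rule sum.swap)
      finally show ?thesis by (simp add: comb_def N.scale_sum_right)
    qed
    define V' where "V' = {z \<in> X \<inter> V. H z \<noteq> 0}"
    define d where "d l = restr V' (\<lambda>z. c l z / (H z * Q z))" for l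
    have V': "openin (zar_on A X) V'" unfolding V'_def by (rule basic_open[OF V(1) H])
    have V'0: "V' \<subseteq> V0" using h(3) by (auto simp: V'_def H_def)
    have nz: "H z * Q z \<noteq> 0" if "z \<in> V'" for z using that by (auto simp: V'_def H_def)
    have "d l \<in> regular_funs A V'" if "l < k" for l
      unfolding d_def restr_regular_funs
    proof (rule reg_divide)
      have "V' \<subseteq> V" by (auto simp: V'_def)
      then show "reg A V' (c l)" "reg A V' (\<lambda>z. H z * Q z)"
        using c(1) that H Q(1) by (auto intro!: reg_poly[OF _ V(1)] poly_funs.mult)
    qed (rule nz)
    moreover have "restr V' t z = (\<Sum>l<k. sN (d l z) (s l z))" for z
    proof (cases "z \<in> V'")
      case True
      then have z: "z \<in> U" "H z \<noteq> 0" by (auto simp: V'_def U_def)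
      have "(\<Sum>l<k. sN (d l z) (s l z)) = sN (inverse (H z * Q z)) (comb v z)"
        unfolding comb_vc N.scale_sum_right
        using True z by (intro sum.cong refl) (simp add: d_def s_def restr_def divide_inverse mult.commute)
      also have "\<dots> = sN (inverse (H z * Q z) * (H z * Q z)) (t z)"
        by (simp only: comb_v[OF z] N.scale_scale)
      also have "inverse (H z * Q z) * (H z * Q z) = 1" using nz[OF True] by (rule left_inverse)
      finally show ?thesis using True by (simp add: restr_def)
    qed (simp add: restr_def d_def)
    moreover have "y \<in> V'" using V0 yV h(2) Q(2) zar_on_subset[OF V0(1)] by (auto simp: V'_def H_def)
    ultimately show ?thesis using V' V'0
      by (intro exI[of _ V'] exI[of _ d] conjI) auto
  qed
  show "\<exists>U. openin (zar_on A X) U \<and> x \<in> U \<and>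
        (\<exists>(N::nat) s. (\<forall>i<N. s i \<in> F U) \<and>
           (\<forall>V t. openin (zar_on A X) V \<and> V \<subseteq> U \<and> t \<in> F V \<longrightarrow>
              (\<forall>y\<in>V. \<exists>V' a. openin (zar_on A X) V' \<and> y \<in> V' \<and> V' \<subseteq> V \<and>
                 (\<forall>i<N. a i \<in> regular_funs A V') \<and>
                 restr V' t = (\<lambda>z. \<Sum>i<N. sN (a i z) (s i z)))))"
  proof (intro exI conjI)
    show "x \<in> U" using \<open>x \<in> X\<close> V(2) by (simp add: U_def)
    show "\<forall>l<k. s l \<in> F U" using s by blast
    show "\<forall>V t. openin (zar_on A X) V \<and> V \<subseteq> U \<and> t \<in> F V \<longrightarrow>
              (\<forall>y\<in>V. \<exists>V' a. openin (zar_on A X) V' \<and> y \<in> V' \<and> V' \<subseteq> V \<and>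
                 (\<forall>i<k. a i \<in> regular_funs A V') \<and>
                 restr V' t = (\<lambda>z. \<Sum>i<k. sN (a i z) (s i z)))"
      by (intro allI impI ballI) (elim conjE, rule cover)
  qed (rule U)
qed

text \<open>
  Relations are the sections of the free sheaf of rank \<open>N\<close> with values in the kernels of the maps
  \<open>v \<mapsto> \<Sum>i. v\<^sub>i s\<^sub>i(z)\<close>.
\<close>

lemma (in nice_atlas) finite_type_relation_sheaf:
  fixes sM :: "'k \<Rightarrow> 'm::ab_group_add \<Rightarrow> 'm"
  assumes "vector_space sM" "U \<subseteq> points A"
  shows "finite_type (\<lambda>c v i. c * v i) A U (relation_sheaf sM A U N s)"
proof (rule finite_type_pointwise)
  interpret M: vector_space sM by fact
  show "vector_space (\<lambda>c (v :: nat \<Rightarrow> 'k) i. c * v i)"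
    by unfold_locales (auto simp: fun_eq_iff algebra_simps)
  let ?K = "\<lambda>z. {v. (\<Sum>i<N. sM (v i) (s i z)) = 0}"
  let ?e = "\<lambda>i j. if j = i then 1 else (0::'k)"
  show "(0 :: nat \<Rightarrow> 'k) \<in> ?K z" for z by simp
  show "u + v \<in> ?K z" if "u \<in> ?K z" "v \<in> ?K z" for u v z
    using that by (simp add: M.scale_left_distrib sum.distrib)
  show "(\<lambda>i. c * v i) \<in> ?K z" if "v \<in> ?K z" for c v z
  proof -
    have "(\<Sum>i<N. sM (c * v i) (s i z)) = sM c (\<Sum>i<N. sM (v i) (s i z))"
      by (simp add: M.scale_sum_right)
    then show ?thesis using that by simp
  qed
  fix V and t :: "'x \<Rightarrow> nat \<Rightarrow> 'k" assume V: "openin (zar_on A U) V"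
  have comb: "(\<Sum>i<N. (\<lambda>j. a i * ?e i j)) j = (if j < N then a j else 0)" for a :: "nat \<Rightarrow> 'k" and j
  proof -
    have "(\<Sum>i\<in>I. (\<lambda>j. a i * ?e i j)) j = (\<Sum>i\<in>I. a i * ?e i j)" for I
      by (induction I rule: infinite_finite_induct) auto
    then show ?thesis by (simp add: if_distrib[of "(*) _"] cong: if_cong)
  qed
  show "t \<in> relation_sheaf sM A U N s V \<longleftrightarrow> (\<forall>x. x \<notin> V \<longrightarrow> t x = 0) \<and>
      (\<exists>a. (\<forall>i<N. reg A V (a i)) \<and> (\<forall>x\<in>V. t x = (\<Sum>i<N. (\<lambda>j. a i x * ?e i j)))) \<and>
      (\<forall>x\<in>V. t x \<in> ?K x)" (is "?l \<longleftrightarrow> ?r")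
  proof
    assume ?l
    then have t: "\<And>i. i < N \<Longrightarrow> (\<lambda>z. t z i) \<in> regular_funs A V" "\<And>i z. i \<ge> N \<Longrightarrow> t z i = 0"
      "\<And>z. z \<in> V \<Longrightarrow> t z \<in> ?K z"
      using V by (auto simp: relation_sheaf_def)
    have out: "t x j = 0" if "x \<notin> V" for x j
      using t(1)[of j] t(2)[of j x] that by (cases "j < N") (auto simp: regular_funs_iff)
    have sum: "t x = (\<Sum>i<N. (\<lambda>j. t x i * ?e i j))" for x
      using t(2) by (intro ext) (simp only: comb, auto)
    show ?r
    proof (intro conjI exI[of _ "\<lambda>i x. t x i"] allI impI ballI)
      show "t x = 0" if "x \<notin> V" for x using out[OF that] by (simp add: fun_eq_iff)
      show "reg A V (\<lambda>x. t x i)" if "i < N" for i using t(1)[OF that] by (simp add: regular_funs_iff)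
    qed (rule sum, rule t(3))
  next
    assume ?r
    then obtain a where t: "\<And>x. x \<notin> V \<Longrightarrow> t x = 0" "\<And>i. i < N \<Longrightarrow> reg A V (a i)"
      "\<And>x. x \<in> V \<Longrightarrow> t x = (\<Sum>i<N. (\<lambda>j. a i x * ?e i j))" "\<And>x. x \<in> V \<Longrightarrow> t x \<in> ?K x" by blast
    have tj: "t x j = (if j < N then a j x else 0)" if "x \<in> V" for x j
      unfolding t(3)[OF that] by (rule comb)
    have "reg A V (\<lambda>z. t z i)" if "i < N" for i
      using reg_cong[OF t(2)[OF that], of V "\<lambda>z. t z i"] tj that by simp
    moreover have "t z i = 0" if "i \<ge> N" for i z
      using tj[of z i] t(1)[of z] that by (cases "z \<in> V") auto
    moreover have "t z i = 0" if "z \<notin> V" for z i using t(1)[OF that] by simp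
    moreover have "(\<Sum>i<N. sM (t z i) (s i z)) = 0" if "z \<in> V" for z using t(4)[OF that] by simp
    ultimately show ?l
      using V by (simp add: relation_sheaf_def regular_funs_iff)
  qed
qed (rule assms(2))


section \<open>Descent\<close>

lemma submodule_sheafD:
  assumes "submodule_sheaf sM A X F" "openin (zar_on A X) U"
  shows "s \<in> F U \<Longrightarrow> s \<in> tens sM (regular_funs A U)"
    and "0 \<in> F U"
    and "s \<in> F U \<Longrightarrow> t \<in> F U \<Longrightarrow> s + t \<in> F U"
    and "a \<in> regular_funs A U \<Longrightarrow> s \<in> F U \<Longrightarrow> (\<lambda>x. sM (a x) (s x)) \<in> F U"
    and "openin (zar_on A X) V \<Longrightarrow> V \<subseteq> U \<Longrightarrow> s \<in> F U \<Longrightarrow> restr V s \<in> F V"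
    and "s \<in> tens sM (regular_funs A U) \<Longrightarrow>
      (\<And>x. x \<in> U \<Longrightarrow> \<exists>V. openin (zar_on A X) V \<and> x \<in> V \<and> V \<subseteq> U \<and> restr V s \<in> F V) \<Longrightarrow> s \<in> F U"
proof -
  have *: "F U \<subseteq> tens sM (regular_funs A U) \<and> 0 \<in> F U \<and> (\<forall>s\<in>F U. \<forall>t\<in>F U. s + t \<in> F U) \<and>
        (\<forall>a\<in>regular_funs A U. \<forall>s\<in>F U. (\<lambda>x. sM (a x) (s x)) \<in> F U) \<and>
        (\<forall>V s. openin (zar_on A X) V \<and> V \<subseteq> U \<and> s \<in> F U \<longrightarrow> restr V s \<in> F V) \<and>
        (\<forall>s\<in>tens sM (regular_funs A U).
           (\<forall>x\<in>U. \<exists>V. openin (zar_on A X) V \<and> x \<in> V \<and> V \<subseteq> U \<and> restr V s \<in> F V) \<longrightarrow> s \<in> F U)"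
    by (rule mp[OF spec[OF conjunct2[OF assms(1)[unfolded submodule_sheaf_def]]] assms(2)])
  note * = conjunct1[OF *] conjunct1[OF conjunct2[OF *]] conjunct1[OF conjunct2[OF conjunct2[OF *]]]
    conjunct1[OF conjunct2[OF conjunct2[OF conjunct2[OF *]]]]
    conjunct1[OF conjunct2[OF conjunct2[OF conjunct2[OF conjunct2[OF *]]]]]
    conjunct2[OF conjunct2[OF conjunct2[OF conjunct2[OF conjunct2[OF *]]]]]
  show "s \<in> F U \<Longrightarrow> s \<in> tens sM (regular_funs A U)" by (rule subsetD[OF *(1)])
  show "0 \<in> F U" by (rule *(2))
  show "s \<in> F U \<Longrightarrow> t \<in> F U \<Longrightarrow> s + t \<in> F U" using *(3) by simp
  show "a \<in> regular_funs A U \<Longrightarrow> s \<in> F U \<Longrightarrow> (\<lambda>x. sM (a x) (s x)) \<in> F U"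
    by (rule bspec[OF bspec[OF *(4)]])
  show "openin (zar_on A X) V \<Longrightarrow> V \<subseteq> U \<Longrightarrow> s \<in> F U \<Longrightarrow> restr V s \<in> F V" using *(5) by simp
  show "s \<in> tens sM (regular_funs A U) \<Longrightarrow>
      (\<And>x. x \<in> U \<Longrightarrow> \<exists>V. openin (zar_on A X) V \<and> x \<in> V \<and> V \<subseteq> U \<and> restr V s \<in> F V) \<Longrightarrow> s \<in> F U"
    by (rule mp[OF bspec[OF *(6)]], assumption, rule ballI) simp
qed

lemma submodule_sheafI:
  assumes "\<And>U. \<not> openin (zar_on A X) U \<Longrightarrow> F U = {}"
    and "\<And>U s. openin (zar_on A X) U \<Longrightarrow> s \<in> F U \<Longrightarrow> s \<in> tens sM (regular_funs A U)"
    and "\<And>U. openin (zar_on A X) U \<Longrightarrow> 0 \<in> F U"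
    and "\<And>U s t. openin (zar_on A X) U \<Longrightarrow> s \<in> F U \<Longrightarrow> t \<in> F U \<Longrightarrow> s + t \<in> F U"
    and "\<And>U a s. openin (zar_on A X) U \<Longrightarrow> a \<in> regular_funs A U \<Longrightarrow> s \<in> F U \<Longrightarrow> (\<lambda>x. sM (a x) (s x)) \<in> F U"
    and "\<And>U V s. openin (zar_on A X) U \<Longrightarrow> openin (zar_on A X) V \<Longrightarrow> V \<subseteq> U \<Longrightarrow> s \<in> F U \<Longrightarrow> restr V s \<in> F V"
    and "\<And>U s. openin (zar_on A X) U \<Longrightarrow> s \<in> tens sM (regular_funs A U) \<Longrightarrow>
      (\<And>x. x \<in> U \<Longrightarrow> \<exists>V. openin (zar_on A X) V \<and> x \<in> V \<and> V \<subseteq> U \<and> restr V s \<in> F V) \<Longrightarrow> s \<in> F U"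
  shows "submodule_sheaf sM A X F"
  unfolding submodule_sheaf_def
proof (intro conjI allI impI ballI subsetI)
  show "restr V s \<in> F V" if "openin (zar_on A X) U" "openin (zar_on A X) V \<and> V \<subseteq> U \<and> s \<in> F U" for U V s
    using that assms(6)[of U V s] by simp
  show "s \<in> F U" if "openin (zar_on A X) U" "s \<in> tens sM (regular_funs A U)"
    "\<forall>x\<in>U. \<exists>V. openin (zar_on A X) V \<and> x \<in> V \<and> V \<subseteq> U \<and> restr V s \<in> F V" for U s
    by (rule assms(7)[OF that(1,2) bspec[OF that(3)]])
qed (simp_all add: assms(1-5))

lemma submodule_sheaf_sum:
  assumes "submodule_sheaf sM A X F" "openin (zar_on A X) U" "\<And>i. i < N \<Longrightarrow> f i \<in> F U"
  shows "(\<lambda>x. \<Sum>i<(N::nat). f i x) \<in> F U"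
  using assms(3)
proof (induction N)
  case 0
  then show ?case using submodule_sheafD(2)[OF assms(1,2)] by (simp add: zero_fun_def)
next
  case (Suc N)
  then have "(\<lambda>x. \<Sum>i<N. f i x) + f N \<in> F U" by (intro submodule_sheafD(3)[OF assms(1,2)]) auto
  then show ?case by (simp add: plus_fun_def)
qed

lemma restr_restr: "V \<subseteq> U \<Longrightarrow> restr V (restr U f) = restr V f"
  by (auto simp: restr_def fun_eq_iff)

text \<open>
  Local sections of \<open>q\<close> are all that is recorded of the torsor: pulling back along them undoes pulling back
  along \<open>q\<close>.
\<close>

locale descent = A: vector_atlas A sM BM + B: vector_atlas B sM BM
  for A :: "('x, 'k::field) atlas" and B :: "('y, 'k) atlas"
    and sM :: "'k \<Rightarrow> 'm::ab_group_add \<Rightarrow> 'm" and BM +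
  fixes X :: "'x set" and Y :: "'y set" and q :: "'y \<Rightarrow> 'x"
  assumes X: "X \<subseteq> points A" and Y: "Y \<subseteq> points B" and q: "morph A X B Y q"
    and local_section: "\<And>x. x \<in> X \<Longrightarrow>
      \<exists>U \<sigma>. openin (zar_on A X) U \<and> x \<in> U \<and> morph B Y A U \<sigma> \<and> (\<forall>u\<in>U. q (\<sigma> u) = u)"
begin

sublocale AB: atlas_pair A B ..
sublocale BA: atlas_pair B A ..

lemma vreg_pullback:
  assumes "morph A X' B Y' \<phi>" "A.vreg U t" "V \<subseteq> Y'" "\<phi> ` V \<subseteq> U"
  shows "B.vreg V (\<lambda>y. t (\<phi> y))"
  using assms(2) unfolding A.vreg_def B.vreg_def
  by (intro ballI AB.morph_reg[OF assms(1) _ assms(3,4), where f = "\<lambda>x. A.M.bcoord _ (t x)"]) simp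

lemma vreg_section:
  assumes "morph B Y' A X' \<phi>" "B.vreg U t" "V \<subseteq> X'" "\<phi> ` V \<subseteq> U"
  shows "A.vreg V (\<lambda>y. t (\<phi> y))"
  using assms(2) unfolding A.vreg_def B.vreg_def
  by (intro ballI BA.morph_reg[OF assms(1) _ assms(3,4), where f = "\<lambda>x. A.M.bcoord _ (t x)"]) simp

abbreviation pre :: "'x set \<Rightarrow> 'y set" where
  "pre U \<equiv> {y \<in> Y. q y \<in> U}"

lemma pre_open: "openin (zar_on A X) U \<Longrightarrow> openin (zar_on B Y) (pre U)"
  by (rule AB.morph_open[OF q])

lemma open_points: "openin (zar_on A X) U \<Longrightarrow> U \<subseteq> points A" "openin (zar_on B Y) V \<Longrightarrow> V \<subseteq> points B"
  by (rule order_trans[OF zar_on_subset X], assumption) (rule order_trans[OF zar_on_subset Y])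

text \<open>
  The only candidate for a sheaf with pull-back \<open>G\<close>: those sections of \<open>M \<otimes> \<O>\<close> whose pull-back along
  \<open>q\<close> lies in \<open>G\<close>.
\<close>

definition desc :: "('y, 'm) sheaf \<Rightarrow> ('x, 'm) sheaf" where
  "desc G U = (if openin (zar_on A X) U then
     {t \<in> tens sM (regular_funs A U). restr (pre U) (\<lambda>y. t (q y)) \<in> G (pre U)} else {})"

lemma desc_iff:
  "openin (zar_on A X) U \<Longrightarrow> t \<in> desc G U \<longleftrightarrow>
     (\<forall>x. x \<notin> U \<longrightarrow> t x = 0) \<and> A.vreg U t \<and> restr (pre U) (\<lambda>y. t (q y)) \<in> G (pre U)"
  by (simp add: desc_def A.tens_regular_funs[OF open_points(1)])

lemma submodule_sheaf_desc:
  assumes G: "submodule_sheaf sM B Y G"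
  shows "submodule_sheaf sM A X (desc G)"
proof (rule submodule_sheafI)
  fix U assume U: "openin (zar_on A X) U"
  note GU = submodule_sheafD[OF G pre_open[OF U]]
  show "s \<in> tens sM (regular_funs A U)" if "s \<in> desc G U" for s
    using that U by (simp add: desc_def)
  have "restr (pre U) (\<lambda>y. (0 :: 'x \<Rightarrow> 'm) (q y)) = 0" by (auto simp: restr_def fun_eq_iff)
  then show "0 \<in> desc G U"
    using GU(2) A.vreg_const[OF open_points(1)[OF U], of 0]
    unfolding desc_iff[OF U] by (simp add: zero_fun_def)
  show "s + t \<in> desc G U" if "s \<in> desc G U" "t \<in> desc G U" for s t
  proof -
    have "restr (pre U) (\<lambda>y. (s + t) (q y)) = restr (pre U) (\<lambda>y. s (q y)) + restr (pre U) (\<lambda>y. t (q y))"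
      by (auto simp: restr_def fun_eq_iff)
    then show ?thesis
      using that GU(3) A.vreg_add[of U s t] unfolding desc_iff[OF U] by (simp add: plus_fun_def)
  qed
  show "(\<lambda>x. sM (a x) (s x)) \<in> desc G U" if a: "a \<in> regular_funs A U" and s: "s \<in> desc G U" for a s
  proof -
    have "restr (pre U) (\<lambda>y. a (q y)) \<in> regular_funs B (pre U)"
      unfolding B.restr_regular_funs
      using a by (intro AB.morph_reg[OF q]) (auto simp: A.regular_funs_iff)
    then have "(\<lambda>y. sM (restr (pre U) (\<lambda>y. a (q y)) y) (restr (pre U) (\<lambda>y. s (q y)) y)) \<in> G (pre U)"
      using s unfolding desc_iff[OF U] by (intro GU(4)) auto
    also have "(\<lambda>y. sM (restr (pre U) (\<lambda>y. a (q y)) y) (restr (pre U) (\<lambda>y. s (q y)) y)) =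
      restr (pre U) (\<lambda>y. sM (a (q y)) (s (q y)))"
      by (auto simp: restr_def fun_eq_iff)
    finally show ?thesis
      using a s A.vreg_scale[of U a s] unfolding desc_iff[OF U] by (auto simp: A.regular_funs_iff)
  qed
  show "restr V s \<in> desc G V" if V: "openin (zar_on A X) V" "V \<subseteq> U" and s: "s \<in> desc G U" for V s
  proof -
    have "pre V \<subseteq> pre U" using V(2) by blast
    moreover have "restr (pre U) (\<lambda>y. s (q y)) \<in> G (pre U)" using s unfolding desc_iff[OF U] by blast
    ultimately have "restr (pre V) (restr (pre U) (\<lambda>y. s (q y))) \<in> G (pre V)"
      by (rule GU(5)[OF pre_open[OF V(1)]])
    also have "restr (pre V) (restr (pre U) (\<lambda>y. s (q y))) = restr (pre V) (\<lambda>y. restr V s (q y))"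
      using V(2) by (auto simp: restr_def fun_eq_iff)
    finally show ?thesis
      using s A.vreg_mono[OF _ V(2), of s] unfolding desc_iff[OF U] desc_iff[OF V(1)]
      by (simp add: A.vreg_restr) (simp add: restr_def)
  qed
  show "s \<in> desc G U" if s: "s \<in> tens sM (regular_funs A U)"
    and loc: "\<And>x. x \<in> U \<Longrightarrow> \<exists>V. openin (zar_on A X) V \<and> x \<in> V \<and> V \<subseteq> U \<and> restr V s \<in> desc G V" for s
  proof -
    have reg: "A.vreg U s" using s by (simp add: A.tens_regular_funs[OF open_points(1)[OF U]])
    have "restr (pre U) (\<lambda>y. s (q y)) \<in> G (pre U)"
    proof (rule GU(6))
      show "restr (pre U) (\<lambda>y. s (q y)) \<in> tens sM (regular_funs B (pre U))"
        unfolding B.restr_tens_regular_funs[OF open_points(2)[OF pre_open[OF U]]]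
        by (rule vreg_pullback[OF q reg]) auto
      fix y assume y: "y \<in> pre U"
      then obtain V where V: "openin (zar_on A X) V" "q y \<in> V" "V \<subseteq> U" "restr V s \<in> desc G V"
        using loc[of "q y"] by auto
      have "restr (pre V) (\<lambda>y. restr V s (q y)) \<in> G (pre V)" using V(4) unfolding desc_iff[OF V(1)] by blast
      also have "restr (pre V) (\<lambda>y. restr V s (q y)) = restr (pre V) (restr (pre U) (\<lambda>y. s (q y)))"
        using V(3) by (auto simp: restr_def fun_eq_iff)
      finally show "\<exists>V. openin (zar_on B Y) V \<and> y \<in> V \<and> V \<subseteq> pre U \<and> restr V (restr (pre U) (\<lambda>y. s (q y))) \<in> G V"
        using V(2,3) y by (intro exI[of _ "pre V"] conjI pre_open[OF V(1)]) auto
    qed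
    then show ?thesis using s unfolding desc_def using U by simp
  qed
qed (simp add: desc_def)

lemma pullback_iff:
  assumes "openin (zar_on B Y) V"
  shows "t \<in> pullback_subsheaf sM A X B Y q F V \<longleftrightarrow> (\<forall>y. y \<notin> V \<longrightarrow> t y = 0) \<and> B.vreg V t \<and>
    (\<forall>y\<in>V. \<exists>V' U (N::nat) a s. openin (zar_on B Y) V' \<and> y \<in> V' \<and> V' \<subseteq> V \<and> openin (zar_on A X) U \<and>
      q ` V' \<subseteq> U \<and> (\<forall>i<N. reg B V' (a i) \<and> s i \<in> F U) \<and>
      (\<forall>z\<in>V'. t z = (\<Sum>i<N. sM (a i z) (s i (q z)))))" (is "_ \<longleftrightarrow> _ \<and> _ \<and> (\<forall>y\<in>V. ?loc y)")
proof -
  let ?base = "\<lambda>y. \<exists>V' U. openin (zar_on B Y) V' \<and> y \<in> V' \<and> V' \<subseteq> V \<and> openin (zar_on A X) U \<and> q ` V' \<subseteq> U \<and>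
        (\<exists>(N::nat) a s. (\<forall>i<N. a i \<in> regular_funs B V' \<and> s i \<in> F U) \<and>
           restr V' t = (\<lambda>z. \<Sum>i<N. sM (a i z) (s i (q z))))"
  have "?base y \<longleftrightarrow> ?loc y" for y
  proof
    assume "?base y"
    then obtain V' U and N :: nat and a s where *: "openin (zar_on B Y) V'" "y \<in> V'" "V' \<subseteq> V" "openin (zar_on A X) U"
      "q ` V' \<subseteq> U" "\<forall>i<N. a i \<in> regular_funs B V' \<and> s i \<in> F U"
      "restr V' t = (\<lambda>z. \<Sum>i<N. sM (a i z) (s i (q z)))" by blast
    have e: "\<forall>z\<in>V'. t z = (\<Sum>i<N. sM (a i z) (s i (q z)))"
    proof
      fix z assume "z \<in> V'"
      then show "t z = (\<Sum>i<N. sM (a i z) (s i (q z)))"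
        using fun_cong[OF *(7), of z] by (simp add: restr_def)
    qed
    have r: "\<forall>i<N. reg B V' (a i) \<and> s i \<in> F U" using *(6) by (simp add: B.regular_funs_iff)
    show "?loc y"
      by (intro exI[of _ V'] exI[of _ U] exI[of _ N] exI[of _ a] exI[of _ s] conjI) (rule *(1-5) r e)+
  next
    assume "?loc y"
    then obtain V' U and N :: nat and a s where *: "openin (zar_on B Y) V'" "y \<in> V'" "V' \<subseteq> V" "openin (zar_on A X) U"
      "q ` V' \<subseteq> U" "\<forall>i<N. reg B V' (a i) \<and> s i \<in> F U"
      "\<forall>z\<in>V'. t z = (\<Sum>i<N. sM (a i z) (s i (q z)))" by blast
    have "restr V' t z = (\<Sum>i<N. sM (restr V' (a i) z) (s i (q z)))" for z
      using *(7) by (simp add: restr_def)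
    then have "restr V' t = (\<lambda>z. \<Sum>i<N. sM (restr V' (a i) z) (s i (q z)))" by (rule ext)
    moreover have "\<forall>i<N. restr V' (a i) \<in> regular_funs B V' \<and> s i \<in> F U"
      using *(6) by (simp add: B.restr_regular_funs)
    ultimately have "\<exists>(N::nat) a s. (\<forall>i<N. a i \<in> regular_funs B V' \<and> s i \<in> F U) \<and>
           restr V' t = (\<lambda>z. \<Sum>i<N. sM (a i z) (s i (q z)))"
      by (intro exI[of _ N] exI[of _ "\<lambda>i. restr V' (a i)"] exI[of _ s] conjI)
    with *(1-5) show "?base y" by (intro exI[of _ V'] exI[of _ U] conjI)
  qed
  then show ?thesis
    using assms unfolding pullback_subsheaf_def
    by (simp add: B.tens_regular_funs[OF open_points(2)[OF assms]])
qed

text \<open>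
  Pulling an expression of \<open>t \<circ> q\<close> through sections of \<open>F\<close> back along a local section of \<open>q\<close> gives an
  expression of \<open>t\<close>. So a sheaf is determined by its pull-back.
\<close>

lemma pullback_determines:
  assumes F: "submodule_sheaf sM A X F"
  shows "F = desc (pullback_subsheaf sM A X B Y q F)"
proof
  fix U
  show "F U = desc (pullback_subsheaf sM A X B Y q F) U"
  proof (cases "openin (zar_on A X) U")
    case False
    then show ?thesis using F unfolding submodule_sheaf_def desc_def by simp
  next
    case U: True
    note FU = submodule_sheafD[OF F U]
    show ?thesis
    proof (intro Set.set_eqI iffI)
      fix t assume t: "t \<in> F U"
      have t': "(\<forall>x. x \<notin> U \<longrightarrow> t x = 0) \<and> A.vreg U t"
        using FU(1)[OF t] by (simp add: A.tens_regular_funs[OF open_points(1)[OF U]])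
      have "B.vreg (pre U) (\<lambda>y. t (q y))"
        using t' by (intro vreg_pullback[OF q, of U t]) auto
      moreover have "reg B (pre U) (\<lambda>_. 1)" by (rule B.reg_const[OF open_points(2)[OF pre_open[OF U]]])
      ultimately have "restr (pre U) (\<lambda>y. t (q y)) \<in> pullback_subsheaf sM A X B Y q F (pre U)"
        unfolding pullback_iff[OF pre_open[OF U]] B.vreg_restr
        using U t pre_open[OF U]
        by (intro conjI ballI exI[of _ "pre U"] exI[of _ U] exI[of _ "Suc 0"] exI[of _ "\<lambda>_ _. 1"] exI[of _ "\<lambda>_. t"])
          (auto simp: restr_def fun_eq_iff)
      then show "t \<in> desc (pullback_subsheaf sM A X B Y q F) U" unfolding desc_iff[OF U] using t' by simp
    next
      fix t assume t: "t \<in> desc (pullback_subsheaf sM A X B Y q F) U"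
      note tp = conjunct2[OF conjunct2[OF conjunct2[OF conjunct2[OF t[unfolded desc_iff[OF U]]],
        unfolded pullback_iff[OF pre_open[OF U]]]]]
      show "t \<in> F U"
      proof (rule FU(6))
        show "t \<in> tens sM (regular_funs A U)" using t U unfolding desc_def by simp
        fix x assume x: "x \<in> U"
        then have "x \<in> X" using zar_on_subset[OF U] by blast
        then obtain U1 \<sigma> where U1: "openin (zar_on A X) U1" "x \<in> U1" "morph B Y A U1 \<sigma>" "\<forall>u\<in>U1. q (\<sigma> u) = u"
          using local_section by blast
        have \<sigma>Y: "\<sigma> u \<in> Y" if "u \<in> U1" for u using U1(3) that by (auto simp: morph_def)
        have "\<sigma> x \<in> pre U" using U1 \<sigma>Y x by simp
        then obtain V' U' and N :: nat and a s where *: "openin (zar_on B Y) V'" "\<sigma> x \<in> V'" "V' \<subseteq> pre U"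
          "openin (zar_on A X) U'" "q ` V' \<subseteq> U'" "\<forall>i<N. reg B V' (a i) \<and> s i \<in> F U'"
          "\<forall>z\<in>V'. restr (pre U) (\<lambda>y. t (q y)) z = (\<Sum>i<N. sM (a i z) (s i (q z)))"
          using bspec[OF tp \<open>\<sigma> x \<in> pre U\<close>] by blast
        define T where "T = {u \<in> U1. \<sigma> u \<in> V'}"
        have T: "openin (zar_on A X) T"
          using BA.morph_open[OF U1(3) *(1)] zar_on_open_sub[OF U1(1), of T] by (simp add: T_def)
        have q\<sigma>: "q (\<sigma> u) = u" if "u \<in> T" for u using U1(4) that by (simp add: T_def)
        have TU': "T \<subseteq> U'" "T \<subseteq> U" using *(3,5) q\<sigma> by (force simp: T_def)+
        have "(\<lambda>x. sM (restr T (\<lambda>u. a i (\<sigma> u)) x) (restr T (s i) x)) \<in> F T" if "i < N" for i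
        proof (rule submodule_sheafD(4)[OF F T])
          show "restr T (\<lambda>u. a i (\<sigma> u)) \<in> regular_funs A T"
            unfolding A.restr_regular_funs
            using *(6) that by (intro BA.morph_reg[OF U1(3), of V' "a i"]) (auto simp: T_def)
          show "restr T (s i) \<in> F T"
            using *(6) that TU' by (intro submodule_sheafD(5)[OF F *(4) T]) auto
        qed
        then have "(\<lambda>x. \<Sum>i<N. sM (restr T (\<lambda>u. a i (\<sigma> u)) x) (restr T (s i) x)) \<in> F T"
          by (rule submodule_sheaf_sum[OF F T])
        also have "(\<lambda>x. \<Sum>i<N. sM (restr T (\<lambda>u. a i (\<sigma> u)) x) (restr T (s i) x)) = restr T t"
        proof
          fix u
          show "(\<Sum>i<N. sM (restr T (\<lambda>u. a i (\<sigma> u)) u) (restr T (s i) u)) = restr T t u"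
          proof (cases "u \<in> T")
            case True
            then have "\<sigma> u \<in> V'" by (simp add: T_def)
            moreover from this have "\<sigma> u \<in> pre U" using *(3) by blast
            ultimately have "t (q (\<sigma> u)) = (\<Sum>i<N. sM (a i (\<sigma> u)) (s i (q (\<sigma> u))))"
              using bspec[OF *(7), of "\<sigma> u"] by (simp add: restr_def)
            then show ?thesis using True q\<sigma>[OF True] by (simp add: restr_def)
          qed (simp add: restr_def)
        qed
        finally show "\<exists>V. openin (zar_on A X) V \<and> x \<in> V \<and> V \<subseteq> U \<and> restr V t \<in> F V"
          using T TU'(2) U1(2) *(2) by (intro exI[of _ T]) (simp add: T_def)
      qed
    qed
  qed
qed

text \<open>
  The pull-back of \<open>desc G\<close> is contained in \<open>G\<close> because \<open>G\<close> is closed under combinations and gluing;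
  \<open>gen\<close> is what the other inclusion needs.
\<close>

lemma pullback_desc:
  assumes G: "submodule_sheaf sM B Y G"
    and gen: "\<And>V t y. openin (zar_on B Y) V \<Longrightarrow> t \<in> G V \<Longrightarrow> y \<in> V \<Longrightarrow>
      \<exists>V' U (N::nat) a s. openin (zar_on B Y) V' \<and> y \<in> V' \<and> V' \<subseteq> V \<and> openin (zar_on A X) U \<and>
      q ` V' \<subseteq> U \<and> (\<forall>i<N. reg B V' (a i) \<and> s i \<in> desc G U) \<and>
      (\<forall>z\<in>V'. t z = (\<Sum>i<N. sM (a i z) (s i (q z))))"
  shows "pullback_subsheaf sM A X B Y q (desc G) = G"
proof
  fix V
  show "pullback_subsheaf sM A X B Y q (desc G) V = G V"
  proof (cases "openin (zar_on B Y) V")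
    case False
    then show ?thesis using G unfolding submodule_sheaf_def pullback_subsheaf_def by simp
  next
    case V: True
    note GV = submodule_sheafD[OF G V]
    show ?thesis
    proof (intro Set.set_eqI iffI)
      fix t assume t: "t \<in> G V"
      then have "(\<forall>y. y \<notin> V \<longrightarrow> t y = 0) \<and> B.vreg V t"
        using GV(1) by (simp add: B.tens_regular_funs[OF open_points(2)[OF V]])
      then show "t \<in> pullback_subsheaf sM A X B Y q (desc G) V"
        unfolding pullback_iff[OF V] by (intro conjI ballI gen[OF V t]) simp_all
    next
      fix t assume t: "t \<in> pullback_subsheaf sM A X B Y q (desc G) V"
      note t' = t[unfolded pullback_iff[OF V]]
      show "t \<in> G V"
      proof (rule GV(6))
        show "t \<in> tens sM (regular_funs B V)"
          using t' by (simp add: B.tens_regular_funs[OF open_points(2)[OF V]])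
        fix y assume y: "y \<in> V"
        obtain V' U and N :: nat and a s where *: "openin (zar_on B Y) V'" "y \<in> V'" "V' \<subseteq> V"
          "openin (zar_on A X) U" "q ` V' \<subseteq> U" "\<forall>i<N. reg B V' (a i) \<and> s i \<in> desc G U"
          "\<forall>z\<in>V'. t z = (\<Sum>i<N. sM (a i z) (s i (q z)))"
          using t' y by blast
        have V'U: "V' \<subseteq> pre U" using *(1,5) zar_on_subset[OF *(1)] by blast
        have "(\<lambda>z. sM (restr V' (a i) z) (restr V' (restr (pre U) (\<lambda>y. s i (q y))) z)) \<in> G V'" if "i < N" for i
        proof (rule submodule_sheafD(4)[OF G *(1)])
          show "restr V' (a i) \<in> regular_funs B V'"
            unfolding B.restr_regular_funs using *(6) that by blast
          show "restr V' (restr (pre U) (\<lambda>y. s i (q y))) \<in> G V'"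
            using *(6) that unfolding desc_iff[OF *(4)]
            by (intro submodule_sheafD(5)[OF G pre_open[OF *(4)] *(1) V'U]) blast
        qed
        then have "(\<lambda>z. \<Sum>i<N. sM (restr V' (a i) z) (restr V' (restr (pre U) (\<lambda>y. s i (q y))) z)) \<in> G V'"
          by (rule submodule_sheaf_sum[OF G *(1)])
        also have "(\<lambda>z. \<Sum>i<N. sM (restr V' (a i) z) (restr V' (restr (pre U) (\<lambda>y. s i (q y))) z)) = restr V' t"
          unfolding restr_restr[OF V'U] using *(7) by (auto simp: restr_def fun_eq_iff)
        finally show "\<exists>V'. openin (zar_on B Y) V' \<and> y \<in> V' \<and> V' \<subseteq> V \<and> restr V' t \<in> G V'"
          using * by (intro exI[of _ V']) simp
      qed
    qed
  qed
qed

lemma descend_eq_desc: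
  assumes "submodule_sheaf sM B Y G" "finite_type sM A X (desc G)"
    and "\<And>V t y. openin (zar_on B Y) V \<Longrightarrow> t \<in> G V \<Longrightarrow> y \<in> V \<Longrightarrow>
      \<exists>V' U (N::nat) a s. openin (zar_on B Y) V' \<and> y \<in> V' \<and> V' \<subseteq> V \<and> openin (zar_on A X) U \<and>
      q ` V' \<subseteq> U \<and> (\<forall>i<N. reg B V' (a i) \<and> s i \<in> desc G U) \<and>
      (\<forall>z\<in>V'. t z = (\<Sum>i<N. sM (a i z) (s i (q z))))"
  shows "descend sM A X B Y q G = desc G"
  unfolding descend_def
proof (rule the_equality)
  have "coherent_subsheaf sM A X (desc G)"
    unfolding coherent_subsheaf_def
  proof (intro conjI allI impI submodule_sheaf_desc assms)
    fix U N and s :: "nat \<Rightarrow> 'x \<Rightarrow> 'm"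
    assume "openin (zar_on A X) U \<and> (\<forall>i<N. s i \<in> desc G U)"
    then show "finite_type (\<lambda>c v i. c * v i) A U (relation_sheaf sM A U N s)"
      using open_points(1) by (intro A.finite_type_relation_sheaf A.M.vector_space_axioms) simp
  qed
  then show "coherent_subsheaf sM A X (desc G) \<and> pullback_subsheaf sM A X B Y q (desc G) = G"
    using pullback_desc[OF assms(1,3)] by simp
next
  fix F assume "coherent_subsheaf sM A X F \<and> pullback_subsheaf sM A X B Y q F = G"
  then show "F = desc G" using pullback_determines[of F] unfolding coherent_subsheaf_def by simp
qed

end


section \<open>Determinants of matrices with entries indexed from 1\<close>

text \<open>
  Matrices with row and column indices \<open>1, \<dots>, r\<close>, like the tuples and the chart matrices, and their
  determinants and adjugates in terms of matrices whose indices start at 0.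
\<close>

definition mdet :: "nat \<Rightarrow> (nat \<Rightarrow> nat \<Rightarrow> 'k::field) \<Rightarrow> 'k" where
  "mdet r g = det (mat r r (\<lambda>(a, b). g (Suc a) (Suc b)))"

definition madj :: "nat \<Rightarrow> (nat \<Rightarrow> nat \<Rightarrow> 'k::field) \<Rightarrow> nat \<Rightarrow> nat \<Rightarrow> 'k" where
  "madj r g s t = adj_mat (mat r r (\<lambda>(a, b). g (Suc a) (Suc b))) $$ (s - 1, t - 1)"

lemma mdet_cong:
  assumes "\<And>s t. s \<in> {1..r} \<Longrightarrow> t \<in> {1..r} \<Longrightarrow> g s t = h s t"
  shows "mdet r g = mdet r h"
  unfolding mdet_def by (rule arg_cong[of _ _ det], rule eq_matI) (auto simp: assms)

lemma madj_right:
  assumes "s \<in> {1..r}" "t \<in> {1..r}"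
  shows "(\<Sum>u=1..r. g s u * madj r g u t) = (if s = t then mdet r g else 0)"
proof -
  let ?M = "mat r r (\<lambda>(a, b). g (Suc a) (Suc b))"
  note adj = adj_mat[of ?M r, OF mat_carrier]
  have "(\<Sum>u=1..r. g s u * madj r g u t) = (\<Sum>a<r. g s (Suc a) * madj r g (Suc a) t)"
    by (simp add: sum.atLeast1_atMost_eq)
  also have "\<dots> = (?M * adj_mat ?M) $$ (s - 1, t - 1)"
    using assms adj(1)
    by (auto simp: times_mat_def scalar_prod_def madj_def lessThan_atLeast0 intro!: sum.cong)
  also have "\<dots> = (if s = t then mdet r g else 0)"
    unfolding adj(2) using assms by (auto simp: mdet_def)
  finally show ?thesis .
qed

lemma madj_left:
  assumes "s \<in> {1..r}" "t \<in> {1..r}"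
  shows "(\<Sum>u=1..r. madj r g s u * g u t) = (if s = t then mdet r g else 0)"
proof -
  let ?M = "mat r r (\<lambda>(a, b). g (Suc a) (Suc b))"
  note adj = adj_mat[of ?M r, OF mat_carrier]
  have "(\<Sum>u=1..r. madj r g s u * g u t) = (\<Sum>a<r. madj r g s (Suc a) * g (Suc a) t)"
    by (simp add: sum.atLeast1_atMost_eq)
  also have "\<dots> = (adj_mat ?M * ?M) $$ (s - 1, t - 1)"
    using assms adj(1)
    by (auto simp: times_mat_def scalar_prod_def madj_def lessThan_atLeast0 intro!: sum.cong)
  also have "\<dots> = (if s = t then mdet r g else 0)"
    unfolding adj(3) using assms by (auto simp: mdet_def)
  finally show ?thesis .
qed

text \<open>
  A singular matrix over a field has a nonzero vector in its kernel.
\<close>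

lemma mdet_nonzero:
  assumes "\<And>c. (\<And>t. t \<in> {1..r} \<Longrightarrow> (\<Sum>s=1..r. g t s * c s) = 0) \<Longrightarrow> \<forall>s\<in>{1..r}. c s = 0"
  shows "mdet r g \<noteq> 0"
proof
  let ?M = "mat r r (\<lambda>(a, b). g (Suc a) (Suc b))"
  assume "mdet r g = 0"
  then obtain v where v: "v \<in> carrier_vec r" "v \<noteq> 0\<^sub>v r" "?M *\<^sub>v v = 0\<^sub>v r"
    using det_0_iff_vec_prod_zero_field[of ?M r] unfolding mdet_def by auto
  have "(\<Sum>s=1..r. g t s * v $ (s - 1)) = 0" if "t \<in> {1..r}" for t
  proof -
    have "(\<Sum>s=1..r. g t s * v $ (s - 1)) = (\<Sum>a<r. g t (Suc a) * v $ a)"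
      by (simp add: sum.atLeast1_atMost_eq)
    also have "\<dots> = (?M *\<^sub>v v) $ (t - 1)"
      using that v(1) by (auto simp: mult_mat_vec_def scalar_prod_def lessThan_atLeast0 intro!: sum.cong)
    finally show ?thesis using v(3) that by auto
  qed
  then have "\<forall>s\<in>{1..r}. v $ (s - 1) = 0" by (rule assms)
  then have "v $ a = 0" if "a < r" for a using that by (auto dest!: bspec[of _ _ "Suc a"])
  then have "v = 0\<^sub>v r" using v(1) by (intro eq_vecI) auto
  then show False using v(2) by blast
qed

lemma det_poly:
  assumes "\<And>a b. a < r \<Longrightarrow> b < r \<Longrightarrow> (\<lambda>x. G x a b) \<in> poly_funs C"
  shows "(\<lambda>x. det (mat r r (\<lambda>(a, b). G x a b))) \<in> poly_funs C"
proof -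
  have "(\<lambda>x. \<Sum>p\<in>{p. p permutes {0..<r}}. signof p * (\<Prod>i=0..<r. G x i (p i))) \<in> poly_funs C"
    using assms permutes_in_image
    by (intro poly_funs_sum poly_funs.mult poly_funs_prod poly_funs.const) fastforce
  also have "(\<lambda>x. \<Sum>p\<in>{p. p permutes {0..<r}}. signof p * (\<Prod>i=0..<r. G x i (p i))) =
      (\<lambda>x. det (mat r r (\<lambda>(a, b). G x a b)))"
  proof
    fix x
    have "(\<Prod>i=0..<r. mat r r (\<lambda>(a, b). G x a b) $$ (i, p i)) = (\<Prod>i=0..<r. G x i (p i))"
      if "p permutes {0..<r}" for p
      using permutes_in_image[OF that] by (intro prod.cong refl) auto
    then show "(\<Sum>p\<in>{p. p permutes {0..<r}}. signof p * (\<Prod>i=0..<r. G x i (p i))) = det (mat r r (\<lambda>(a, b). G x a b))"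
      by (subst det_def'[of _ r]) auto
  qed
  finally show ?thesis .
qed

lemma mdet_poly:
  assumes "\<And>s t. s \<in> {1..r} \<Longrightarrow> t \<in> {1..r} \<Longrightarrow> (\<lambda>x. G x s t) \<in> poly_funs C"
  shows "(\<lambda>x. mdet r (G x)) \<in> poly_funs C"
  unfolding mdet_def by (rule det_poly) (auto intro: assms)

lemma madj_poly:
  assumes G: "\<And>s t. s \<in> {1..r} \<Longrightarrow> t \<in> {1..r} \<Longrightarrow> (\<lambda>x. G x s t) \<in> poly_funs C"
    and "s \<in> {1..r}" "t \<in> {1..r}"
  shows "(\<lambda>x. madj r (G x) s t) \<in> poly_funs C"
proof -
  define H where "H x a b = G x (Suc (if a < t - 1 then a else Suc a)) (Suc (if b < s - 1 then b else Suc b))" for x a b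
  have "madj r (G x) s t = (- 1) ^ (t - 1 + (s - 1)) * det (mat (r - 1) (r - 1) (\<lambda>(a, b). H x a b))" for x
  proof -
    let ?M = "mat r r (\<lambda>(a, b). G x (Suc a) (Suc b))"
    have "mat_delete ?M (t - 1) (s - 1) = mat (r - 1) (r - 1) (\<lambda>(a, b). H x a b)"
      unfolding mat_delete_def H_def by (rule eq_matI) auto
    then show ?thesis using assms(2,3) by (auto simp: madj_def adj_mat_def cofactor_def)
  qed
  moreover have "(\<lambda>x. det (mat (r - 1) (r - 1) (\<lambda>(a, b). H x a b))) \<in> poly_funs C"
    by (rule det_poly) (auto simp: H_def intro: G)
  ultimately show ?thesis by (simp add: poly_funs.mult poly_funs.const)
qed


section \<open>Charts of the Grassmannian\<close>

\<comment> \<open>keeps the simplifier from turning the index set \<open>{1..r}\<close> into \<open>{Suc 0..r}\<close>\<close>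
declare One_nat_def [simp del]

context restricted_module
begin

sublocale G: finite_dimensional_vector_space sG "x ` {1..n}"
  by (rule basis)

lemma coord_bcoord: "coord i v = G.bcoord (x i) v"
  unfolding coord_def G.bcoord_def ..

lemma coord_add: "coord i (u + v) = coord i u + coord i v"
  and coord_scale: "coord i (sG c v) = c * coord i v"
  and coord_zero: "coord i 0 = 0"
  and coord_sum: "coord i (\<Sum>a\<in>I. f a) = (\<Sum>a\<in>I. coord i (f a))"
  by (simp_all only: coord_bcoord G.bcoord_add G.bcoord_scale G.bcoord_zero G.bcoord_sum)

lemma coord_diff: "coord i (u - v) = coord i u - coord i v"
  using coord_add[of i "u - v" v] by simp

lemma coord_basis: "i \<in> {1..n} \<Longrightarrow> j \<in> {1..n} \<Longrightarrow> coord i (x j) = (if i = j then 1 else 0)"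
  using basis_inj
  by (auto simp: coord_def representation_basis[OF G.independent_Basis] inj_on_eq_iff)

lemma coord_expand: "(\<Sum>i=1..n. sG (coord i v) (x i)) = v"
  using G.bcoord_expand[of v] sum.reindex[OF basis_inj, of "\<lambda>b. sG (G.bcoord b v) b"]
  by (simp add: coord_bcoord)

lemma coord_comb: "i \<in> {1..n} \<Longrightarrow> coord i (\<Sum>j=1..n. sG (a j) (x j)) = a i"
  by (simp add: coord_sum coord_scale coord_basis if_distrib[of "(*) _"] cong: if_cong)

lemma idx_bij:
  assumes "S \<subseteq> {1..n}" "card S = r"
  shows "bij_betw (idx S) {1..r} S"
proof -
  have S: "finite S" using assms(1) finite_subset by blast
  have "bij_betw ((!) (sorted_list_of_set S)) {..<r} S"
    using bij_betw_nth[of "sorted_list_of_set S" "{..<r}" S] S assms(2) by simp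
  moreover have "bij_betw (\<lambda>s. s - 1) {1..r} {..<r}"
    by (rule bij_betw_byWitness[of _ Suc]) auto
  ultimately have "bij_betw ((!) (sorted_list_of_set S) \<circ> (\<lambda>s. s - 1)) {1..r} S"
    by (rule bij_betw_trans[rotated])
  then show ?thesis by (simp add: idx_def[abs_def] comp_def)
qed

text \<open>
  Linear independence of an indexed family, which is more convenient for coordinate computations than
  injectivity together with independence of the image.
\<close>

definition frame :: "nat \<Rightarrow> (nat \<Rightarrow> 'g) \<Rightarrow> bool" where
  "frame r T \<longleftrightarrow> T \<in> tuple_space r \<and> (\<forall>c. (\<Sum>s=1..r. sG (c s) (T s)) = 0 \<longrightarrow> (\<forall>s\<in>{1..r}. c s = 0))"

lemma frameD: "frame r T \<Longrightarrow> (\<Sum>s=1..r. sG (c s) (T s)) = 0 \<Longrightarrow> s \<in> {1..r} \<Longrightarrow> c s = 0"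
  unfolding frame_def by blast

lemma frame_iff: "frame r T \<longleftrightarrow> T \<in> tuple_space r \<and> inj_on T {1..r} \<and> independent (T ` {1..r})"
proof (cases "T \<in> tuple_space r")
  case True
  show ?thesis
  proof (intro iffI conjI)
    assume f: "frame r T"
    show inj: "inj_on T {1..r}"
    proof (rule inj_onI, rule ccontr)
      fix s t assume st: "s \<in> {1..r}" "t \<in> {1..r}" "T s = T t" "s \<noteq> t"
      define c where "c u = (if u = s then 1 else if u = t then - 1 else (0::'k))" for u
      have "(\<Sum>u=1..r. sG (c u) (T u)) = (\<Sum>u\<in>{s, t}. sG (c u) (T u))"
        using st by (intro sum.mono_neutral_right) (auto simp: c_def)
      also have "\<dots> = 0" using st by (simp add: c_def)
      finally have "c s = 0" by (rule frameD[OF f _ st(1)])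
      then show False by (simp add: c_def)
    qed
    show "independent (T ` {1..r})"
    proof (rule independent_if_scalars_zero)
      fix u v assume "(\<Sum>a\<in>T ` {1..r}. sG (u a) a) = 0" "v \<in> T ` {1..r}"
      then have "(\<Sum>s=1..r. sG (u (T s)) (T s)) = 0" by (simp add: sum.reindex[OF inj])
      then show "u v = 0" using frameD[OF f, of "\<lambda>s. u (T s)"] \<open>v \<in> _\<close> by blast
    qed simp
  next
    assume "T \<in> tuple_space r \<and> inj_on T {1..r} \<and> independent (T ` {1..r})"
    then have inj: "inj_on T {1..r}" and ind: "independent (T ` {1..r})" by auto
    show "frame r T"
      unfolding frame_def
    proof (intro conjI allI impI ballI True)
      fix c s assume c: "(\<Sum>s=1..r. sG (c s) (T s)) = 0" and s: "s \<in> {1..r}"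
      define u where "u v = c (the_inv_into {1..r} T v)" for v
      have u: "u (T s) = c s" if "s \<in> {1..r}" for s
        using the_inv_into_f_f[OF inj that] by (simp add: u_def)
      have "(\<Sum>v\<in>T ` {1..r}. sG (u v) v) = 0"
        using c u by (simp add: sum.reindex[OF inj])
      then have "u (T s) = 0" using independentD[OF ind _ _ _, of "T ` {1..r}" u "T s"] s by simp
      then show "c s = 0" using u s by simp
    qed
  qed (use True in auto)
qed (simp add: frame_def)

lemma comb_in_span: "(\<Sum>s=1..r. sG (c s) (T s)) \<in> span (T ` {1..r})"
  by (intro span_sum span_scale span_base) auto

lemma span_combE:
  assumes "frame r T" "v \<in> span (T ` {1..r})"
  obtains c where "v = (\<Sum>s=1..r. sG (c s) (T s))"
proof -
  have inj: "inj_on T {1..r}" using assms(1) frame_iff by blast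
  obtain u where "v = (\<Sum>a\<in>T ` {1..r}. sG (u a) a)"
    using assms(2) by (auto simp: span_finite)
  then have "v = (\<Sum>s=1..r. sG (u (T s)) (T s))" by (simp add: sum.reindex[OF inj])
  then show ?thesis by (rule that)
qed

lemma frame_Grass: "frame r T \<Longrightarrow> span (T ` {1..r}) \<in> Grass r"
  unfolding frame_iff Grass_def
  by (simp add: dim_eq_card_independent card_image)

lemma Grass_frame:
  assumes "L \<in> Grass r"
  obtains T where "frame r T" "span (T ` {1..r}) = L"
proof -
  have L: "subspace L" "dim L = r" using assms by (auto simp: Grass_def)
  obtain B where B: "B \<subseteq> L" "independent B" "L \<subseteq> span B" "card B = r"
    using basis_exists[of L] L(2) by metis
  have "finite B" using G.finiteI_independent[OF B(2)] .
  then obtain h where h: "bij_betw h {1..r} B"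
    using finite_same_card_bij[of "{1..r}" B] B(4) by auto
  define T where "T s = (if s \<in> {1..r} then h s else 0)" for s
  have T: "T ` {1..r} = B" "inj_on T {1..r}"
  proof -
    have "bij_betw T {1..r} B \<longleftrightarrow> bij_betw h {1..r} B" by (rule bij_betw_cong) (simp add: T_def)
    then show "T ` {1..r} = B" "inj_on T {1..r}" using h by (simp_all add: bij_betw_def)
  qed
  have "T \<in> tuple_space r" by (simp add: tuple_space_def T_def)
  then have "frame r T" unfolding frame_iff T(1) using T(2) B(2) by simp
  moreover have "span (T ` {1..r}) = L"
    unfolding T(1) using B(3) span_minimal[OF B(1) L(1)] by simp
  ultimately show ?thesis by (rule that)
qed

definition minor :: "nat set \<Rightarrow> (nat \<Rightarrow> 'g) \<Rightarrow> nat \<Rightarrow> nat \<Rightarrow> 'k" where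
  "minor S T = (\<lambda>t s. coord (idx S t) (T s))"

lemma chart_eqI:
  assumes "L \<in> chart r S" "u \<in> L" "v \<in> L" "\<And>i. i \<in> S \<Longrightarrow> coord i u = coord i v"
  shows "u = v"
proof -
  have "inj_on (\<lambda>v. restrict (\<lambda>i. coord i v) S) L" using assms(1) by (auto simp: chart_def bij_betw_def)
  moreover have "restrict (\<lambda>i. coord i u) S = restrict (\<lambda>i. coord i v) S"
    using assms(4) by (rule restrict_ext)
  ultimately show ?thesis using assms(2,3) by (rule inj_onD)
qed

lemma chart_ex:
  assumes "L \<in> chart r S"
  obtains v where "v \<in> L" "\<And>i. i \<in> S \<Longrightarrow> coord i v = f i"
proof -
  have "restrict f S \<in> (\<lambda>v. restrict (\<lambda>i. coord i v) S) ` L"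
    using assms by (auto simp: chart_def bij_betw_def)
  then obtain v where v: "v \<in> L" "restrict f S = restrict (\<lambda>i. coord i v) S" by blast
  have "coord i v = f i" if "i \<in> S" for i using fun_cong[OF v(2), of i] that by simp
  then show ?thesis using that v(1) by blast
qed

lemma chartI:
  assumes "L \<in> Grass r" "\<And>v. v \<in> L \<Longrightarrow> (\<And>i. i \<in> S \<Longrightarrow> coord i v = 0) \<Longrightarrow> v = 0"
    and "\<And>f. \<exists>v\<in>L. \<forall>i\<in>S. coord i v = f i"
  shows "L \<in> chart r S"
proof -
  have L: "subspace L" using assms(1) by (simp add: Grass_def)
  have "bij_betw (\<lambda>v. restrict (\<lambda>i. coord i v) S) L (S \<rightarrow>\<^sub>E UNIV)"
    unfolding bij_betw_def
  proof (intro conjI inj_onI equalityI subsetI)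
    fix u v assume uv: "u \<in> L" "v \<in> L" "restrict (\<lambda>i. coord i u) S = restrict (\<lambda>i. coord i v) S"
    have "coord i (u - v) = 0" if "i \<in> S" for i
      using fun_cong[OF uv(3), of i] that by (simp add: coord_diff)
    then show "u = v" using assms(2)[of "u - v"] subspace_diff[OF L uv(1,2)] by simp
  next
    fix f assume f: "f \<in> S \<rightarrow>\<^sub>E (UNIV :: 'k set)"
    then obtain v where "v \<in> L" "\<forall>i\<in>S. coord i v = f i" using assms(3) by blast
    moreover from this have "f = restrict (\<lambda>i. coord i v) S"
      using f by (auto simp: PiE_def extensional_def fun_eq_iff)
    ultimately show "f \<in> (\<lambda>v. restrict (\<lambda>i. coord i v) S) ` L" by blast
  qed auto
  then show ?thesis using assms(1) by (simp add: chart_def)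
qed

lemma chart_Grass: "L \<in> chart r S \<Longrightarrow> L \<in> Grass r"
  by (simp add: chart_def)

lemma chart_subspace: "L \<in> chart r S \<Longrightarrow> subspace L"
  by (simp add: chart_def Grass_def)

context
  fixes S :: "nat set" and r :: nat
  assumes S: "S \<subseteq> {1..n}" "card S = r"
begin

lemma idx_in: "s \<in> {1..r} \<Longrightarrow> idx S s \<in> S" "s \<in> {1..r} \<Longrightarrow> idx S s \<in> {1..n}"
  using bij_betwE[OF idx_bij[OF S]] S(1) by blast+

lemma idx_eq: "s \<in> {1..r} \<Longrightarrow> t \<in> {1..r} \<Longrightarrow> idx S s = idx S t \<longleftrightarrow> s = t"
  using bij_betw_imp_inj_on[OF idx_bij[OF S]] by (auto simp: inj_on_eq_iff)

lemma idx_ex: "i \<in> S \<Longrightarrow> \<exists>s\<in>{1..r}. i = idx S s"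
  using bij_betw_imp_surj_on[OF idx_bij[OF S]] by blast

text \<open>
  A vector in the kernel of the block gives a combination of \<open>T\<close> without coordinates in the rows \<open>S\<close>.
\<close>

lemma minor_nonzero:
  assumes "frame r T" "\<And>v. v \<in> span (T ` {1..r}) \<Longrightarrow> (\<And>i. i \<in> S \<Longrightarrow> coord i v = 0) \<Longrightarrow> v = 0"
  shows "mdet r (minor S T) \<noteq> 0"
proof (rule mdet_nonzero)
  fix c assume c: "\<And>t. t \<in> {1..r} \<Longrightarrow> (\<Sum>s=1..r. minor S T t s * c s) = 0"
  have "(\<Sum>s=1..r. sG (c s) (T s)) = 0"
  proof (rule assms(2)[OF comb_in_span])
    fix i assume "i \<in> S"
    then obtain t where "t \<in> {1..r}" "i = idx S t" using idx_ex by blast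
    then show "coord i (\<Sum>s=1..r. sG (c s) (T s)) = 0"
      using c[of t] by (simp add: coord_sum coord_scale minor_def mult.commute)
  qed
  then show "\<forall>s\<in>{1..r}. c s = 0" using assms(1) by (simp add: frame_def)
qed

text \<open>
  Cramer's rule.
\<close>

lemma minor_solve:
  assumes "mdet r (minor S T) \<noteq> 0" "i \<in> S"
  shows "coord i (\<Sum>s=1..r. sG ((\<Sum>t=1..r. madj r (minor S T) s t * f (idx S t)) / mdet r (minor S T)) (T s)) = f i"
proof -
  obtain u where u: "u \<in> {1..r}" "i = idx S u" using idx_ex assms(2) by blast
  let ?d = "mdet r (minor S T)"
  have "coord i (\<Sum>s=1..r. sG ((\<Sum>t=1..r. madj r (minor S T) s t * f (idx S t)) / ?d) (T s))
      = (\<Sum>s=1..r. \<Sum>t=1..r. minor S T u s * madj r (minor S T) s t * f (idx S t) / ?d)"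
    by (simp add: coord_sum coord_scale minor_def u(2) sum_divide_distrib sum_distrib_right sum_distrib_left
        mult.commute mult.left_commute)
  also have "\<dots> = (\<Sum>t=1..r. (\<Sum>s=1..r. minor S T u s * madj r (minor S T) s t) * (f (idx S t) / ?d))"
    by (subst sum.swap) (simp add: sum_distrib_right sum_divide_distrib)
  also have "\<dots> = (\<Sum>t=1..r. (if u = t then ?d else 0) * (f (idx S t) / ?d))"
    by (rule sum.cong[OF refl]) (simp only: madj_right[OF u(1)])
  also have "\<dots> = (\<Sum>t=1..r. if u = t then f (idx S t) else 0)"
    using assms(1) by (intro sum.cong) auto
  also have "\<dots> = f i" using u by simp
  finally show ?thesis .
qed

lemma minor_kernel:
  assumes "mdet r (minor S T) \<noteq> 0" "\<And>i. i \<in> S \<Longrightarrow> coord i (\<Sum>s=1..r. sG (c s) (T s)) = 0" "s \<in> {1..r}"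
  shows "c s = 0"
proof -
  have *: "(\<Sum>u=1..r. minor S T t u * c u) = 0" if "t \<in> {1..r}" for t
    using assms(2)[OF idx_in(1)[OF that]] by (simp add: coord_sum coord_scale minor_def mult.commute)
  have "0 = (\<Sum>t=1..r. madj r (minor S T) s t * (\<Sum>u=1..r. minor S T t u * c u))" using * by simp
  also have "\<dots> = (\<Sum>u=1..r. (\<Sum>t=1..r. madj r (minor S T) s t * minor S T t u) * c u)"
    by (simp add: sum_distrib_left sum_distrib_right mult.assoc) (rule sum.swap)
  also have "\<dots> = (\<Sum>u=1..r. (if s = u then mdet r (minor S T) else 0) * c u)"
    by (rule sum.cong[OF refl]) (simp only: madj_left[OF assms(3)])
  also have "\<dots> = mdet r (minor S T) * c s"
    using assms(3) by (simp add: if_distrib[of "\<lambda>a. a * _"] cong: if_cong)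
  finally show ?thesis using assms(1) by simp
qed

text \<open>
  The chart asks for the rows \<open>S\<close> to give bijective coordinates on the span of \<open>T\<close>. With respect to the
  basis \<open>T\<close> this coordinate map is the block of rows \<open>S\<close>.
\<close>

lemma span_in_chart_iff:
  assumes "frame r T"
  shows "span (T ` {1..r}) \<in> chart r S \<longleftrightarrow> mdet r (minor S T) \<noteq> 0"
proof
  assume L: "span (T ` {1..r}) \<in> chart r S"
  show "mdet r (minor S T) \<noteq> 0"
    by (rule minor_nonzero[OF assms]) (rule chart_eqI[OF L], auto simp: span_zero coord_zero)
next
  assume nz: "mdet r (minor S T) \<noteq> 0"
  show "span (T ` {1..r}) \<in> chart r S"
  proof (rule chartI[OF frame_Grass[OF assms]])
    fix v assume v: "v \<in> span (T ` {1..r})" "\<And>i. i \<in> S \<Longrightarrow> coord i v = 0"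
    obtain c where c: "v = (\<Sum>s=1..r. sG (c s) (T s))" using span_combE[OF assms v(1)] .
    have "c s = 0" if "s \<in> {1..r}" for s using minor_kernel[OF nz _ that, of c] v(2) c by simp
    then show "v = 0" unfolding c by simp
  next
    fix f :: "nat \<Rightarrow> 'k"
    show "\<exists>v\<in>span (T ` {1..r}). \<forall>i\<in>S. coord i v = f i"
      by (intro bexI[OF _ comb_in_span] ballI) (rule minor_solve[OF nz])
  qed
qed

text \<open>
  By Cramer's rule the coefficients of a combination of \<open>T\<close> are determined by its coordinates in the rows
  \<open>S\<close>, and these can be prescribed. As a vector of \<open>L\<close> is known from its coordinates in the rows \<open>S\<close>, the
  combinations of \<open>T\<close> exhaust \<open>L\<close>.
\<close>

lemma frame_of_minor:
  assumes L: "L \<in> chart r S" and T: "T \<in> tuple_space r" "\<And>s. s \<in> {1..r} \<Longrightarrow> T s \<in> L"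
    and nz: "mdet r (minor S T) \<noteq> 0"
  shows "frame r T" "span (T ` {1..r}) = L"
proof -
  show "frame r T"
    unfolding frame_def
  proof (intro conjI allI impI ballI T(1))
    fix c s assume "(\<Sum>s=1..r. sG (c s) (T s)) = 0" "s \<in> {1..r}"
    then show "c s = 0" using minor_kernel[OF nz, of c s] by (simp add: coord_zero)
  qed
  have sub: "span (T ` {1..r}) \<subseteq> L"
    using T(2) chart_subspace[OF L] by (intro span_minimal) auto
  moreover have "v \<in> span (T ` {1..r})" if v: "v \<in> L" for v
  proof -
    let ?w = "\<Sum>s=1..r. sG ((\<Sum>t=1..r. madj r (minor S T) s t * coord (idx S t) v) / mdet r (minor S T)) (T s)"
    have w: "?w \<in> span (T ` {1..r})" by (rule comb_in_span)
    have "?w = v"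
      by (rule chart_eqI[OF L subsetD[OF sub w] v]) (rule minor_solve[OF nz])
    then show ?thesis using w by simp
  qed
  ultimately show "span (T ` {1..r}) = L" by blast
qed

text \<open>
  The columns are the vectors of \<open>L\<close> whose coordinates in the rows \<open>S\<close> form the unit vectors. They exist
  and are unique because \<open>L\<close> lies in the chart.
\<close>

lemma chart_matrix:
  assumes L: "L \<in> chart r S"
  shows "i \<notin> {1..n} \<or> s \<notin> {1..r} \<Longrightarrow> chart_matrix r S L i s = 0"
    and "s \<in> {1..r} \<Longrightarrow> t \<in> {1..r} \<Longrightarrow> chart_matrix r S L (idx S t) s = (if t = s then 1 else 0)"
    and "L = span ((\<lambda>s. \<Sum>i=1..n. sG (chart_matrix r S L i s) (x i)) ` {1..r})"
proof -
  let ?P = "\<lambda>A. (\<forall>i s. i \<notin> {1..n} \<or> s \<notin> {1..r} \<longrightarrow> A i s = 0) \<and>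
     (\<forall>s\<in>{1..r}. \<forall>s'\<in>{1..r}. A (idx S s') s = (if s' = s then 1 else 0)) \<and>
     L = span ((\<lambda>s. \<Sum>i=1..n. sG (A i s) (x i)) ` {1..r})"
  have "\<exists>v. v \<in> L \<and> (\<forall>i\<in>S. coord i v = (if i = idx S s then 1 else 0))" for s
    using chart_ex[OF L, of "\<lambda>i. if i = idx S s then 1 else 0"] by metis
  then obtain v where v: "\<And>s. v s \<in> L" "\<And>s i. i \<in> S \<Longrightarrow> coord i (v s) = (if i = idx S s then 1 else 0)"
    by metis
  define A where "A i s = (if i \<in> {1..n} \<and> s \<in> {1..r} then coord i (v s) else 0)" for i s
  have col: "(\<Sum>i=1..n. sG (A i s) (x i)) = v s" if "s \<in> {1..r}" for s
  proof -
    have "(\<Sum>i=1..n. sG (A i s) (x i)) = (\<Sum>i=1..n. sG (coord i (v s)) (x i))"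
      using that by (intro sum.cong) (auto simp: A_def)
    then show ?thesis by (simp only: coord_expand)
  qed
  have "span (v ` {1..r}) = L"
  proof
    show "span (v ` {1..r}) \<subseteq> L" using v(1) chart_subspace[OF L] by (intro span_minimal) auto
    show "L \<subseteq> span (v ` {1..r})"
    proof
      fix u assume u: "u \<in> L"
      let ?w = "\<Sum>s=1..r. sG (coord (idx S s) u) (v s)"
      have "?w = u"
      proof (rule chart_eqI[OF L _ u])
        show "?w \<in> L" using v(1) chart_subspace[OF L] by (intro subspace_sum subspace_scale) auto
        fix i assume "i \<in> S"
        then obtain t where t: "t \<in> {1..r}" "i = idx S t" using idx_ex by blast
        have "coord i ?w = (\<Sum>s=1..r. coord (idx S s) u * (if t = s then 1 else 0))"
          unfolding coord_sum coord_scale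
          using v(2)[OF \<open>i \<in> S\<close>] t idx_eq by (intro sum.cong) auto
        then show "coord i ?w = coord i u" using t by (simp add: if_distrib[of "(*) _"] cong: if_cong)
      qed
      then show "u \<in> span (v ` {1..r})" using comb_in_span[of "\<lambda>s. coord (idx S s) u" v r] by simp
    qed
  qed
  moreover have "(\<lambda>s. \<Sum>i=1..n. sG (A i s) (x i)) ` {1..r} = v ` {1..r}" using col by (intro image_cong) auto
  ultimately have "?P A"
    using v(2) idx_in idx_eq by (auto simp: A_def)
  moreover have "A' = A" if A': "?P A'" for A'
  proof (intro ext)
    fix i s
    show "A' i s = A i s"
    proof (cases "i \<in> {1..n} \<and> s \<in> {1..r}")
      case True
      let ?a = "\<Sum>i=1..n. sG (A' i s) (x i)"
      have "?a = v s"
      proof (rule chart_eqI[OF L _ v(1)])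
        have "?a \<in> span ((\<lambda>s. \<Sum>i=1..n. sG (A' i s) (x i)) ` {1..r})"
          using True by (intro span_base) auto
        then show "?a \<in> L" using A' by simp
        fix k assume "k \<in> S"
        then obtain t where t: "t \<in> {1..r}" "k = idx S t" using idx_ex by blast
        have "coord k ?a = A' k s" using t idx_in by (intro coord_comb) auto
        also have "\<dots> = (if t = s then 1 else 0)" using A' t True by auto
        finally show "coord k ?a = coord k (v s)" using v(2)[OF \<open>k \<in> S\<close>] t True idx_eq by auto
      qed
      then have "A' i s = coord i (v s)" using coord_comb[of i "\<lambda>i. A' i s"] True by simp
      then show ?thesis using True by (simp add: A_def)
    next
      case False
      then show ?thesis using A' by (auto simp: A_def)
    qed
  qed
  ultimately have "?P (chart_matrix r S L)"
    unfolding chart_matrix_def by (rule theI)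
  then show "i \<notin> {1..n} \<or> s \<notin> {1..r} \<Longrightarrow> chart_matrix r S L i s = 0"
    and "s \<in> {1..r} \<Longrightarrow> t \<in> {1..r} \<Longrightarrow> chart_matrix r S L (idx S t) s = (if t = s then 1 else 0)"
    and "L = span ((\<lambda>s. \<Sum>i=1..n. sG (chart_matrix r S L i s) (x i)) ` {1..r})"
    by blast+
qed

end

text \<open>
  The section of the torsor over the chart.
\<close>

definition chart_frame :: "nat \<Rightarrow> nat set \<Rightarrow> 'g set \<Rightarrow> nat \<Rightarrow> 'g" where
  "chart_frame r S L = (\<lambda>s. if s \<in> {1..r} then \<Sum>i=1..n. sG (chart_matrix r S L i s) (x i) else 0)"

text \<open>
  The action of matrices on tuples from the right, which for invertible matrices is the action on the torsor.
\<close>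

definition tmul :: "nat \<Rightarrow> (nat \<Rightarrow> 'g) \<Rightarrow> (nat \<Rightarrow> nat \<Rightarrow> 'k) \<Rightarrow> nat \<Rightarrow> 'g" where
  "tmul r T g = (\<lambda>s. if s \<in> {1..r} then \<Sum>t=1..r. sG (g t s) (T t) else 0)"

lemma coord_chart_frame:
  "i \<in> {1..n} \<Longrightarrow> s \<in> {1..r} \<Longrightarrow> coord i (chart_frame r S L s) = chart_matrix r S L i s"
  by (simp add: chart_frame_def coord_comb)

lemma chart_frame_tuple: "chart_frame r S L \<in> tuple_space r"
  by (auto simp: tuple_space_def chart_frame_def)

lemma tmul_tuple: "tmul r T g \<in> tuple_space r"
  by (auto simp: tuple_space_def tmul_def)

lemma coord_tmul: "s \<in> {1..r} \<Longrightarrow> coord i (tmul r T g s) = (\<Sum>t=1..r. coord i (T t) * g t s)"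
  by (simp add: tmul_def coord_sum coord_scale mult.commute)

context
  fixes S :: "nat set" and r :: nat
  assumes S: "S \<subseteq> {1..n}" "card S = r"
begin

lemma minor_chart_frame:
  assumes "L \<in> chart r S" "s \<in> {1..r}" "t \<in> {1..r}"
  shows "minor S (chart_frame r S L) t s = (if t = s then 1 else 0)"
  using chart_matrix(2)[OF S assms] assms(2) idx_in(2)[OF S assms(3)]
  by (simp add: minor_def coord_chart_frame)

lemma chart_frame_in:
  assumes "L \<in> chart r S" "s \<in> {1..r}"
  shows "chart_frame r S L s \<in> L"
proof -
  have "chart_frame r S L s \<in> span ((\<lambda>s. \<Sum>i=1..n. sG (chart_matrix r S L i s) (x i)) ` {1..r})"
    using assms(2) by (intro span_base) (auto simp: chart_frame_def)
  then show ?thesis using chart_matrix(3)[OF S assms(1)] by simp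
qed

lemma minor_tmul:
  assumes "L \<in> chart r S" "s \<in> {1..r}" "t \<in> {1..r}"
  shows "minor S (tmul r (chart_frame r S L) g) t s = g t s"
proof -
  have "minor S (tmul r (chart_frame r S L) g) t s
      = (\<Sum>u=1..r. minor S (chart_frame r S L) t u * g u s)"
    using assms(2) by (simp add: minor_def coord_tmul)
  also have "\<dots> = (\<Sum>u=1..r. if t = u then g u s else 0)"
    using minor_chart_frame[OF assms(1) _ assms(3)] by (intro sum.cong) auto
  finally show ?thesis using assms(3) by simp
qed

lemma frame_tmul:
  assumes L: "L \<in> chart r S" and g: "mdet r g \<noteq> 0"
  shows "frame r (tmul r (chart_frame r S L) g)" "span (tmul r (chart_frame r S L) g ` {1..r}) = L"
proof -
  have "mdet r (minor S (tmul r (chart_frame r S L) g)) = mdet r g"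
    by (rule mdet_cong) (rule minor_tmul[OF L])
  then have nz: "mdet r (minor S (tmul r (chart_frame r S L) g)) \<noteq> 0" using g by simp
  have "tmul r (chart_frame r S L) g s \<in> L" if "s \<in> {1..r}" for s
    using that chart_frame_in[OF L] chart_subspace[OF L]
    by (auto simp: tmul_def intro!: subspace_sum subspace_scale)
  then show "frame r (tmul r (chart_frame r S L) g)" "span (tmul r (chart_frame r S L) g ` {1..r}) = L"
    using frame_of_minor[OF S L tmul_tuple _ nz] by blast+
qed

lemma chart_frame:
  assumes L: "L \<in> chart r S"
  shows "frame r (chart_frame r S L)" "span (chart_frame r S L ` {1..r}) = L"
proof -
  have nz: "mdet r (minor S (chart_frame r S L)) \<noteq> 0"
  proof (rule mdet_nonzero, rule ballI)
    fix c t assume c: "\<And>t. t \<in> {1..r} \<Longrightarrow> (\<Sum>s=1..r. minor S (chart_frame r S L) t s * c s) = 0"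
      and t: "t \<in> {1..r}"
    have "0 = (\<Sum>s=1..r. minor S (chart_frame r S L) t s * c s)" using c[OF t] by simp
    also have "\<dots> = (\<Sum>s=1..r. if t = s then c s else 0)"
      using minor_chart_frame[OF L _ t] by (intro sum.cong) auto
    finally show "c t = 0" using t by simp
  qed
  show "frame r (chart_frame r S L)" "span (chart_frame r S L ` {1..r}) = L"
    using frame_of_minor[OF S L chart_frame_tuple chart_frame_in[OF L] nz] by blast+
qed

text \<open>
  Both sides are in \<open>L\<close> and have the same coordinates in the rows \<open>S\<close>.
\<close>

lemma tmul_minor:
  assumes T: "frame r T" and L: "L \<in> chart r S" "span (T ` {1..r}) = L"
  shows "tmul r (chart_frame r S L) (minor S T) = T"
proof
  fix s
  show "tmul r (chart_frame r S L) (minor S T) s = T s"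
  proof (cases "s \<in> {1..r}")
    case True
    show ?thesis
    proof (rule chart_eqI[OF L(1)])
      show "tmul r (chart_frame r S L) (minor S T) s \<in> L"
        using True chart_frame_in[OF L(1)] chart_subspace[OF L(1)]
        by (auto simp: tmul_def intro!: subspace_sum subspace_scale)
      show "T s \<in> L" unfolding L(2)[symmetric] using True by (intro span_base) auto
      fix i assume "i \<in> S"
      then obtain t where t: "t \<in> {1..r}" "i = idx S t" using idx_ex[OF S] by blast
      then show "coord i (tmul r (chart_frame r S L) (minor S T) s) = coord i (T s)"
        using minor_tmul[OF L(1) True t(1), of "minor S T"] by (simp add: minor_def)
    qed
  next
    case False
    then show ?thesis using T unfolding frame_def by (simp only: tmul_def tuple_space_def) simp
  qed
qed

lemma chart_frame_eq_tmul:
  assumes T: "frame r T" and L: "span (T ` {1..r}) = L" and nz: "mdet r (minor S T) \<noteq> 0"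
  shows "chart_frame r S L = tmul r T (\<lambda>t s. madj r (minor S T) t s / mdet r (minor S T))"
proof
  have LS: "L \<in> chart r S" using span_in_chart_iff[OF S T] L nz by simp
  fix s
  show "chart_frame r S L s = tmul r T (\<lambda>t s. madj r (minor S T) t s / mdet r (minor S T)) s"
  proof (cases "s \<in> {1..r}")
    case True
    let ?f = "\<lambda>i. coord i (chart_frame r S L s)"
    let ?w = "\<Sum>u=1..r. sG ((\<Sum>t=1..r. madj r (minor S T) u t * ?f (idx S t)) / mdet r (minor S T)) (T u)"
    have "(\<Sum>t=1..r. madj r (minor S T) u t * ?f (idx S t)) = madj r (minor S T) u s" for u
    proof -
      have "(\<Sum>t=1..r. madj r (minor S T) u t * ?f (idx S t)) =
          (\<Sum>t=1..r. if t = s then madj r (minor S T) u t else 0)"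
        using minor_chart_frame[OF LS True] by (intro sum.cong) (auto simp: minor_def)
      then show ?thesis using True by simp
    qed
    then have "tmul r T (\<lambda>t s. madj r (minor S T) t s / mdet r (minor S T)) s = ?w"
      using True by (simp add: tmul_def)
    moreover have "chart_frame r S L s = ?w"
    proof (rule chart_eqI[OF LS chart_frame_in[OF LS True]])
      show "?w \<in> L" unfolding L[symmetric] by (rule comb_in_span)
      show "coord i (chart_frame r S L s) = coord i ?w" if "i \<in> S" for i
        by (rule minor_solve[OF S nz that, symmetric])
    qed
    ultimately show ?thesis by simp
  qed (auto simp: chart_frame_def tmul_def)
qed

text \<open>
  This formula shows that the coordinates of a chart are regular on the space of bases, and on the other
  charts.
\<close>

lemma chart_matrix_eq:
  assumes "frame r T" "span (T ` {1..r}) = L" "mdet r (minor S T) \<noteq> 0" "i \<in> {1..n}" "s \<in> {1..r}"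
  shows "chart_matrix r S L i s = (\<Sum>t=1..r. coord i (T t) * madj r (minor S T) t s) / mdet r (minor S T)"
  using chart_frame_eq_tmul[OF assms(1-3)] coord_chart_frame[OF assms(4,5), of S L] coord_tmul[OF assms(5)]
  by (simp add: sum_divide_distrib)

end

text \<open>
  A basis of \<open>L\<close> extends by basis vectors \<open>x i\<close> to a basis of \<open>\<gg>\<close>. The other \<open>r\<close> indices form an
  \<open>S\<close> for which the projection of \<open>L\<close> to the rows \<open>S\<close> is injective.
\<close>

lemma Grass_chart:
  assumes "L \<in> Grass r"
  shows "\<exists>S. S \<subseteq> {1..n} \<and> card S = r \<and> L \<in> chart r S"
proof -
  obtain T where T: "frame r T" "span (T ` {1..r}) = L" using Grass_frame[OF assms] .
  let ?B = "T ` {1..r}"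
  have B: "independent ?B" "card ?B = r" using T(1) unfolding frame_iff by (auto simp: card_image)
  obtain E where E: "?B \<subseteq> E" "E \<subseteq> ?B \<union> x ` {1..n}" "independent E" "?B \<union> x ` {1..n} \<subseteq> span E"
    using maximal_independent_subset_extend[OF Un_upper1 B(1)] by metis
  have finE: "finite E" using E(2) finite_subset by blast
  have "span E = UNIV"
    using span_minimal[OF order_trans[OF Un_upper2 E(4)] subspace_span] G.span_Basis by auto
  then have "card E = n"
    using dim_span_eq_card_independent[OF E(3)] dim_span_eq_card_independent[OF G.independent_Basis]
      G.span_Basis card_image[OF basis_inj] by simp
  \<comment> \<open>the indices of the basis vectors that are not needed to complete \<open>T\<close> to a basis\<close>
  define S where "S = {i \<in> {1..n}. x i \<notin> E - ?B}"
  have S: "S \<subseteq> {1..n}" by (auto simp: S_def)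
  have finS: "finite S" using S finite_subset by blast
  have img: "x ` ({1..n} - S) = E - ?B" using E(2) by (auto simp: S_def)
  have "card ({1..n} - S) = card (E - ?B)"
    unfolding img[symmetric] by (rule card_image[symmetric], rule inj_on_subset[OF basis_inj]) auto
  also have "\<dots> = n - r" using card_Diff_subset[OF _ E(1)] \<open>card E = n\<close> B(2) by simp
  finally have "card {1..n} - card S = n - r" unfolding card_Diff_subset[OF finS S] .
  moreover have "card S \<le> n" using card_mono[OF _ S] by simp
  moreover have "r \<le> n" using card_mono[OF finE E(1)] B(2) \<open>card E = n\<close> by simp
  ultimately have cardS: "card S = r" by simp
  have "mdet r (minor S T) \<noteq> 0"
  proof (rule minor_nonzero[OF S cardS T(1)])
    fix v assume v: "v \<in> span ?B" "\<And>i. i \<in> S \<Longrightarrow> coord i v = 0"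
    have "v = (\<Sum>i\<in>{1..n} - S. sG (coord i v) (x i))"
      using coord_expand[of v] sum.subset_diff[OF S, of "\<lambda>i. sG (coord i v) (x i)"] v(2) by simp
    also have "\<dots> \<in> span (E - ?B)"
      unfolding img[symmetric] by (intro span_sum span_scale span_base) auto
    finally have v2: "v \<in> span (E - ?B)" .
    have ind: "independent (E - ?B)" by (rule independent_mono[OF E(3)]) auto
    have "representation E v = representation ?B v" "representation E v = representation (E - ?B) v"
      using representation_extend[OF E(3) v(1) E(1)] representation_extend[OF E(3) v2] by auto
    then have "representation E v b = 0" for b
      using representation_ne_zero[of ?B v b] representation_ne_zero[of "E - ?B" v b] by force
    then show "v = 0"
      using sum_nonzero_representation_eq[OF E(3), of v] \<open>span E = UNIV\<close> by simp
  qed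
  then have "L \<in> chart r S" using span_in_chart_iff[OF S cardS T(1)] T(2) by simp
  then show ?thesis using S cardS by blast
qed


section \<open>The atlases of the Grassmannian and of the space of tuples\<close>

lemma chart_coords_poly:
  "i \<in> {1..n} \<Longrightarrow> s \<in> {1..r} \<Longrightarrow> (\<lambda>L. chart_matrix r S L i s) \<in> poly_funs (chart_coords r S)"
  unfolding chart_coords_def by (intro poly_funs.coord) blast

lemma nice_Grass: "nice_atlas (Grass_atlas r)"
proof
  fix V C assume "(V, C) \<in> Grass_atlas r"
  then obtain S where "C = chart_coords r S" by (auto simp: Grass_atlas_def)
  then have "C \<subseteq> (\<lambda>(i, s) L. chart_matrix r S L i s) ` ({1..n} \<times> {1..r})"
    by (auto simp: chart_coords_def)
  then show "finite C" by (rule finite_subset) simp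
next
  fix V C V' C' assume "(V, C) \<in> Grass_atlas r" "(V', C') \<in> Grass_atlas r"
  then obtain S S' where S: "V = chart r S" "C = chart_coords r S" "S \<subseteq> {1..n}" "card S = r"
    and S': "V' = chart r S'" "C' = chart_coords r S'" "S' \<subseteq> {1..n}" "card S' = r"
    by (auto simp: Grass_atlas_def)
  let ?G = "\<lambda>L. minor S' (chart_frame r S L)"
  have G: "(\<lambda>L. ?G L t s) \<in> poly_funs C" if "t \<in> {1..r}" "s \<in> {1..r}" for t s
    using chart_coords_poly[OF idx_in(2)[OF S'(3,4) that(1)] that(2), of S]
    unfolding minor_def S(2) coord_chart_frame[OF idx_in(2)[OF S'(3,4) that(1)] that(2)] .
  have D: "L \<in> V' \<longleftrightarrow> mdet r (?G L) \<noteq> 0" if "L \<in> V" for L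
    using span_in_chart_iff[OF S'(3,4) chart_frame(1)[OF S(3,4)], of L]
      chart_frame(2)[OF S(3,4), of L] that by (simp add: S(1) S'(1))
  have fr: "\<exists>P\<in>poly_funs C. \<forall>L\<in>V \<inter> V'. c L = P L / mdet r (?G L)" if c: "c \<in> C'" for c
  proof -
    obtain i s where ia: "i \<in> {1..n}" "s \<in> {1..r}" "c = (\<lambda>L. chart_matrix r S' L i s)"
      using c by (auto simp: S'(2) chart_coords_def)
    have P: "(\<lambda>L. \<Sum>t=1..r. chart_matrix r S L i t * madj r (?G L) t s) \<in> poly_funs C"
      using ia(1,2) by (intro poly_funs_sum poly_funs.mult madj_poly[of r ?G] G)
        (auto simp: S(2) intro: chart_coords_poly)
    have "c L = (\<Sum>t=1..r. chart_matrix r S L i t * madj r (?G L) t s) / mdet r (?G L)"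
      if L: "L \<in> V \<inter> V'" for L
    proof -
      have LS: "L \<in> chart r S" "mdet r (?G L) \<noteq> 0" using L S(1) D by auto
      show ?thesis
        unfolding ia(3) chart_matrix_eq[OF S'(3,4) chart_frame[OF S(3,4) LS(1)] LS(2) ia(1,2)]
        using ia(1) by (simp add: coord_chart_frame)
    qed
    then show ?thesis by (intro bexI[OF _ P] ballI)
  qed
  have ov: "V \<inter> V' = {L \<in> V. mdet r (?G L) \<noteq> 0}" using D by blast
  have D_poly: "(\<lambda>L. mdet r (?G L)) \<in> poly_funs C" by (rule mdet_poly) (rule G)
  show "\<exists>D\<in>poly_funs C. V \<inter> V' = {L \<in> V. D L \<noteq> 0} \<and>
        (\<forall>c\<in>C'. \<exists>P\<in>poly_funs C. \<forall>L\<in>V \<inter> V'. c L = P L / D L)"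
  proof (rule bexI[of _ "\<lambda>L. mdet r (?G L)"])
    show "V \<inter> V' = {L \<in> V. mdet r (?G L) \<noteq> 0} \<and>
        (\<forall>c\<in>C'. \<exists>P\<in>poly_funs C. \<forall>L\<in>V \<inter> V'. c L = P L / mdet r (?G L))"
      by (intro conjI ov ballI) (rule fr)
  qed (rule D_poly)
qed

definition tuple_coords :: "nat \<Rightarrow> ((nat \<Rightarrow> 'g) \<Rightarrow> 'k) set" where
  "tuple_coords r = {tuple_coord i s | i s. i \<in> {1..n} \<and> s \<in> {1..r}}"

lemma tuple_atlas_eq: "tuple_atlas r = {(tuple_space r, tuple_coords r)}"
  unfolding tuple_atlas_def tuple_coords_def ..

lemma nice_tuple: "nice_atlas (tuple_atlas r)"
proof
  fix V C assume "(V, C) \<in> tuple_atlas r"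
  then have "C \<subseteq> (\<lambda>(i, s). tuple_coord i s) ` ({1..n} \<times> {1..r})"
    by (auto simp: tuple_atlas_eq tuple_coords_def)
  then show "finite C" by (rule finite_subset) simp
next
  fix V C V' C' assume "(V, C) \<in> tuple_atlas r" "(V', C') \<in> tuple_atlas r"
  then have eq: "V' = V" "C' = C" by (auto simp: tuple_atlas_eq)
  have fr: "\<exists>P\<in>poly_funs C. \<forall>L\<in>V \<inter> V'. c L = P L / 1" if "c \<in> C'" for c
    using that eq(2) by (intro bexI[of _ c]) (auto intro: poly_funs.coord)
  show "\<exists>D\<in>poly_funs C. V \<inter> V' = {L \<in> V. D L \<noteq> 0} \<and>
        (\<forall>c\<in>C'. \<exists>P\<in>poly_funs C. \<forall>L\<in>V \<inter> V'. c L = P L / D L)"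
  proof (rule bexI[of _ "\<lambda>_. 1"])
    show "V \<inter> V' = {L \<in> V. 1 \<noteq> (0::'k)} \<and> (\<forall>c\<in>C'. \<exists>P\<in>poly_funs C. \<forall>L\<in>V \<inter> V'. c L = P L / 1)"
    proof (intro conjI ballI)
      show "V \<inter> V' = {L \<in> V. 1 \<noteq> (0::'k)}" using eq(1) by simp
    qed (rule fr)
  qed (rule poly_funs.const)
qed

lemma points_Grass: "points (Grass_atlas r) = Grass r"
proof (intro equalityI subsetI)
  show "L \<in> Grass r" if "L \<in> points (Grass_atlas r)" for L
    using that chart_Grass by (auto simp: Grass_atlas_def)
  show "L \<in> points (Grass_atlas r)" if "L \<in> Grass r" for L
  proof -
    obtain S where "S \<subseteq> {1..n}" "card S = r" "L \<in> chart r S" using Grass_chart[OF \<open>L \<in> Grass r\<close>] by blast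
    then show ?thesis by (auto simp: Grass_atlas_def intro!: exI[of _ "chart r S"])
  qed
qed

lemma points_tuple: "points (tuple_atlas r) = tuple_space r"
  by (simp add: tuple_atlas_eq)

lemma tuple_coord_poly:
  "i \<in> {1..n} \<Longrightarrow> s \<in> {1..r} \<Longrightarrow> (\<lambda>T. coord i (T s)) \<in> poly_funs (tuple_coords r)"
proof -
  assume "i \<in> {1..n}" "s \<in> {1..r}"
  then have "tuple_coord i s \<in> poly_funs (tuple_coords r)"
    unfolding tuple_coords_def by (intro poly_funs.coord) blast
  then show ?thesis by (simp add: tuple_coord_def[abs_def])
qed

lemma morph_tuple:
  assumes "nice_atlas A" "U \<subseteq> points A" "\<phi> ` U \<subseteq> Y" "Y \<subseteq> tuple_space r"
    and "\<And>i s. i \<in> {1..n} \<Longrightarrow> s \<in> {1..r} \<Longrightarrow> reg A U (\<lambda>u. coord i (\<phi> u s))"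
  shows "morph (tuple_atlas r) Y A U \<phi>"
proof -
  interpret nice_atlas A by fact
  have U: "openin (zar_on A U) U"
  proof (rule open_zarI)
    fix u assume "u \<in> U"
    then obtain V C where "(V, C) \<in> A" "u \<in> V" using assms(2) by auto
    then show "\<exists>V C f. (V, C) \<in> A \<and> u \<in> V \<and> f \<in> poly_funs C \<and> f u \<noteq> 0 \<and> {y \<in> U \<inter> V. f y \<noteq> 0} \<subseteq> U"
      by (intro exI[of _ V] exI[of _ C] exI[of _ "\<lambda>_. 1"]) (auto intro: poly_funs.const)
  qed simp
  have reg: "\<forall>c\<in>tuple_coords r. reg A U (\<lambda>z. c (\<phi> z))"
    using assms(5) by (auto simp: tuple_coords_def tuple_coord_def)
  have "\<phi> ` U \<subseteq> tuple_space r" using assms(3,4) by blast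
  then show ?thesis
    unfolding morph_def using assms(3) U reg
    by (intro conjI ballI exI[of _ "tuple_space r"] exI[of _ "tuple_coords r"] exI[of _ U])
      (auto simp: tuple_atlas_eq)
qed

end


section \<open>The action of the Lie algebra\<close>

lemma word_mult: "word c v \<otimes>\<^bsub>free_algebra\<^esub> word d w = word (c * d) (v @ w)"
proof -
  have "(\<Sum>i\<le>length u. word c v (take i u) * word d w (drop i u)) = word (c * d) (v @ w) u" for u
  proof (cases "u = v @ w")
    case True
    have "(\<Sum>i\<le>length u. word c v (take i u) * word d w (drop i u)) =
        (\<Sum>i\<le>length u. if i = length v then c * d else 0)"
    proof (rule sum.cong[OF refl])
      fix i assume "i \<in> {..length u}"
      have "take i u = v \<Longrightarrow> i = length v" using True \<open>i \<in> _\<close> by (metis atMost_iff length_take min.absorb2)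
      then show "word c v (take i u) * word d w (drop i u) = (if i = length v then c * d else 0)"
        using True by (auto simp: word_def)
    qed
    then show ?thesis using True by (simp add: word_def)
  next
    case False
    have "word c v (take i u) * word d w (drop i u) = 0" for i
      using False append_take_drop_id[of i u] by (auto simp: word_def)
    then have "(\<Sum>i\<le>length u. word c v (take i u) * word d w (drop i u)) = 0"
      by (simp only: sum.neutral_const)
    then show ?thesis using False by (simp add: word_def)
  qed
  then show ?thesis by (simp add: free_algebra_def fun_eq_iff)
qed

lemma word_carrier: "word c v \<in> carrier free_algebra"
  by (simp add: free_algebra_def word_def)

lemma free_algebra_add: "f \<oplus>\<^bsub>free_algebra\<^esub> g = f + g"
  by (simp add: free_algebra_def plus_fun_def)

lemma free_algebra_diff_carrier:
  fixes f g :: "'g list \<Rightarrow> 'k::field"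
  assumes "f \<in> carrier free_algebra" "g \<in> carrier free_algebra"
  shows "f - g \<in> carrier free_algebra"
proof -
  have "{w. (f - g) w \<noteq> 0} \<subseteq> {w. f w \<noteq> 0} \<union> {w. g w \<noteq> 0}" by auto
  then show ?thesis using assms finite_subset by (fastforce simp: free_algebra_def)
qed

context restricted_module
begin

definition M_basis :: "'m set" where
  "M_basis = (SOME B. finite_dimensional_vector_space sM B)"

sublocale M: finite_dimensional_vector_space sM M_basis
  unfolding M_basis_def using M_fin_dim by (rule someI_ex)

text \<open>
  The representation of the free algebra; working with it avoids cosets.
\<close>

definition rep :: "('g list \<Rightarrow> 'k) \<Rightarrow> 'm \<Rightarrow> 'm" where
  "rep f = \<rho> (enveloping_ideal +>\<^bsub>free_algebra\<^esub> f)"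

lemma relations_carrier: "enveloping_relations \<subseteq> carrier free_algebra"
  unfolding enveloping_relations_def
  by (intro Un_least subsetI) (auto intro!: free_algebra_diff_carrier word_carrier)

lemma ideal_enveloping: "ideal enveloping_ideal free_algebra"
  unfolding enveloping_ideal_def by (rule ring.genideal_ideal[OF ring_free_algebra relations_carrier])

lemma rep_hom: "rep \<in> Ring.ring_hom free_algebra (endo_ring sM)"
proof -
  have "(+>\<^bsub>free_algebra\<^esub>) enveloping_ideal \<in> Ring.ring_hom free_algebra restricted_enveloping_algebra"
    unfolding restricted_enveloping_algebra_def by (rule ideal.rcos_ring_hom[OF ideal_enveloping])
  then have "\<rho> \<circ> (+>\<^bsub>free_algebra\<^esub>) enveloping_ideal \<in> Ring.ring_hom free_algebra (endo_ring sM)"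
    using \<rho>_hom by (rule ring_hom_trans)
  then show ?thesis by (simp add: rep_def[abs_def] comp_def)
qed

lemma rep_add: "f \<in> carrier free_algebra \<Longrightarrow> g \<in> carrier free_algebra \<Longrightarrow> rep (f + g) v = rep f v + rep g v"
  using Ring.ring_hom_add[OF rep_hom, of f g] by (simp add: free_algebra_add endo_ring_def)

lemma rep_mult: "rep (word (c * d) (v @ w)) m = rep (word c v) (rep (word d w) m)"
  using Ring.ring_hom_mult[OF rep_hom word_carrier word_carrier, of c v d w] by (simp add: word_mult endo_ring_def)

lemma rep_linear: "f \<in> carrier free_algebra \<Longrightarrow> Vector_Spaces.linear sM sM (rep f)"
  using Ring.ring_hom_closed[OF rep_hom, of f] by (simp add: endo_ring_def)

lemma rep_zero: "rep 0 v = 0"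
  using rep_add[of 0 0 v] by (simp add: free_algebra_def)

lemma rep_relation: "z \<in> enveloping_relations \<Longrightarrow> rep z v = 0"
proof -
  assume z: "z \<in> enveloping_relations"
  interpret I: ideal enveloping_ideal free_algebra by (rule ideal_enveloping)
  have "z \<in> enveloping_ideal"
    using ring.genideal_self[OF ring_free_algebra relations_carrier] z by (auto simp: enveloping_ideal_def)
  moreover have "0 \<in> enveloping_ideal" 
    using additive_subgroup.zero_closed[OF I.additive_subgroup_axioms] by (simp add: free_algebra_def zero_fun_def)
  ultimately have "rep z = rep 0" by (simp add: rep_def I.a_rcos_const)
  then show ?thesis by (simp add: rep_zero)
qed

lemma rep_word: "rep (word 1 [a]) = act a"
  by (simp add: rep_def act_def u_word_def)

lemma rep_scalar: "rep (word c []) = sM c"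
  using \<rho>_scalar[of c] by (simp add: rep_def u_word_def)

lemma act_linear: "Vector_Spaces.linear sM sM (act a)"
  using rep_linear[OF word_carrier, of 1 "[a]"] by (simp add: rep_word)

lemma act_add_left: "act (a + b) v = act a v + act b v"
proof -
  let ?z = "word 1 [a + b] - word 1 [a] - word 1 [b] :: 'g list \<Rightarrow> 'k"
  have "?z \<in> enveloping_relations" by (auto simp: enveloping_relations_def)
  then have z: "rep ?z v = 0" "?z \<in> carrier free_algebra" using rep_relation relations_carrier by auto
  have c: "word 1 [a] + word 1 [b] \<in> carrier (free_algebra :: ('g list \<Rightarrow> 'k) ring)"
    using ring.ring_simprules(1)[OF ring_free_algebra word_carrier word_carrier] by (simp add: free_algebra_add)
  have "act (a + b) v = rep (?z + (word 1 [a] + word 1 [b])) v" by (simp flip: rep_word)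
  also have "\<dots> = act a v + act b v"
    unfolding rep_add[OF z(2) c] rep_add[OF word_carrier word_carrier] rep_word z(1) by simp
  finally show ?thesis .
qed

lemma act_scale_left: "act (sG c a) v = sM c (act a v)"
proof -
  let ?z = "word 1 [sG c a] - word c [a] :: 'g list \<Rightarrow> 'k"
  have "?z \<in> enveloping_relations" by (auto simp: enveloping_relations_def)
  then have z: "rep ?z v = 0" "?z \<in> carrier free_algebra" using rep_relation relations_carrier by auto
  have "act (sG c a) v = rep (?z + word c [a]) v" by (simp flip: rep_word)
  also have "\<dots> = rep (word c [a]) v" unfolding rep_add[OF z(2) word_carrier] z(1) by simp
  also have "\<dots> = sM c (act a v)" using rep_mult[of c 1 "[]" "[a]" v] by (simp add: rep_scalar rep_word)
  finally show ?thesis .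
qed

lemma act_commute:
  assumes "br a b = 0"
  shows "act a (act b v) = act b (act a v)"
proof -
  let ?z = "word 1 [a, b] - word 1 [b, a] - word 1 [br a b] :: 'g list \<Rightarrow> 'k"
  have "?z \<in> enveloping_relations" unfolding enveloping_relations_def by blast
  then have z: "rep ?z v = 0" "?z \<in> carrier free_algebra" using rep_relation relations_carrier by auto
  have c: "word 1 [b, a] + word 1 [br a b] \<in> carrier (free_algebra :: ('g list \<Rightarrow> 'k) ring)"
    using ring.ring_simprules(1)[OF ring_free_algebra word_carrier word_carrier] by (simp add: free_algebra_add)
  have mult: "rep (word 1 [a, b]) v = act a (act b v)" for a b
    using rep_mult[of 1 1 "[a]" "[b]" v] by (simp add: rep_word)
  have "act 0 v = 0" using act_scale_left[of 0 0 v] by simp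
  have "act a (act b v) = rep (?z + (word 1 [b, a] + word 1 [br a b])) v" by (simp flip: mult)
  also have "\<dots> = rep (word 1 [b, a]) v + rep (word 1 [br a b]) v"
    unfolding rep_add[OF z(2) c] rep_add[OF word_carrier word_carrier] z(1) by simp
  also have "\<dots> = act b (act a v)" using \<open>act 0 v = 0\<close> by (simp only: mult rep_word assms add_0_right)
  finally show ?thesis .
qed

lemma act_sum_left: "act (\<Sum>i\<in>I. sG (c i) (a i)) v = (\<Sum>i\<in>I. sM (c i) (act (a i) v))"
proof -
  have "act 0 v = 0" using act_scale_left[of 0 0 v] by simp
  then show ?thesis
    by (induction I rule: infinite_finite_induct) (simp_all add: act_add_left act_scale_left)
qed


section \<open>Monomials in commuting operators\<close>

definition mon :: "nat \<Rightarrow> (nat \<Rightarrow> 'g) \<Rightarrow> (nat \<Rightarrow> nat) \<Rightarrow> 'm \<Rightarrow> 'm" where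
  "mon r T J = op_monomial (\<lambda>s. act (T s)) r J"

text \<open>
  At a point \<open>z\<close>, the operator \<open>Theta Y s\<close> is the action of the element with coordinates \<open>Y i s z\<close>. So
  identities between operators on sections can be checked in the endomorphisms of \<open>M\<close>.
\<close>

lemma op_monomial_Theta:
  assumes "\<And>s v. s \<in> {1..r} \<Longrightarrow> (\<Sum>i=1..n. sM (Y i s z) (act (x i) v)) = act (T s) v"
  shows "op_monomial (Theta Y) r J f z = mon r T J (f z)"
proof -
  have pow: "((Theta Y s ^^ k) f) z = (act (T s) ^^ k) (f z)" if "s \<in> {1..r}" for s k f
    using assms[OF that] by (induction k) (simp_all add: Theta_def)
  have "foldr (\<lambda>l g. (Theta Y l ^^ J l) \<circ> g) xs id f z = foldr (\<lambda>l g. (act (T l) ^^ J l) \<circ> g) xs id (f z)"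
    if "set xs \<subseteq> {1..r}" for xs
    using that by (induction xs) (simp_all add: pow)
  from this[of "[1..<Suc r]"] show ?thesis
    by (simp add: op_monomial_def mon_def atLeastLessThanSuc_atLeastAtMost del: upt_Suc)
qed

lemma linear_pow: "Vector_Spaces.linear sM sM f \<Longrightarrow> Vector_Spaces.linear sM sM (f ^^ k)"
  by (induction k) (auto intro: M.linear_id Vector_Spaces.linear_compose simp: id_def[symmetric] simp del: id_apply)

lemma mon_linear: "Vector_Spaces.linear sM sM (mon r T J)"
proof -
  have "Vector_Spaces.linear sM sM (foldr (\<lambda>l g. (act (T l) ^^ J l) \<circ> g) xs id)" for xs
  proof (induction xs)
    case Nil
    show ?case using M.linear_id by (simp add: id_def)
  next
    case (Cons l xs)
    have eq: "foldr (\<lambda>l g. (act (T l) ^^ J l) \<circ> g) (l # xs) id =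
        (act (T l) ^^ J l) \<circ> foldr (\<lambda>l g. (act (T l) ^^ J l) \<circ> g) xs id" by simp
    show ?case
      by (rule ssubst[OF eq, of "Vector_Spaces.linear sM sM"])
        (rule Vector_Spaces.linear_compose[OF Cons linear_pow[OF act_linear]])
  qed
  then show ?thesis unfolding mon_def op_monomial_def .
qed

lemma mon_add: "mon r T J (u + v) = mon r T J u + mon r T J v"
  and mon_scale: "mon r T J (sM c v) = sM c (mon r T J v)"
  and mon_zero: "mon r T J 0 = 0"
  and mon_sum: "mon r T J (\<Sum>i\<in>I. f i) = (\<Sum>i\<in>I. mon r T J (f i))"
proof -
  interpret l: Vector_Spaces.linear sM sM "mon r T J" by (rule mon_linear)
  show "mon r T J (u + v) = mon r T J u + mon r T J v" "mon r T J (sM c v) = sM c (mon r T J v)"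
    "mon r T J 0 = 0" "mon r T J (\<Sum>i\<in>I. f i) = (\<Sum>i\<in>I. mon r T J (f i))"
    by (simp_all add: l.add l.scale l.zero l.sum)
qed

definition commuting :: "nat \<Rightarrow> (nat \<Rightarrow> 'g) \<Rightarrow> bool" where
  "commuting r T \<longleftrightarrow> (\<forall>s\<in>{1..r}. \<forall>t\<in>{1..r}. br (T s) (T t) = 0)"

lemma foldr_comp_Cons:
  "foldr (\<lambda>l g. F l \<circ> g) (a # xs) id v = F a (foldr (\<lambda>l g. F l \<circ> g) xs id v)"
  by simp

text \<open>
  Move the new factor to the right, past the operators that it commutes with, to the power with the
  same index.
\<close>

lemma act_mon:
  assumes "commuting r T" "s \<in> {1..r}"
  shows "act (T s) (mon r T J v) = mon r T (J(s := Suc (J s))) v"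
proof -
  have pow: "act (T s) ((act (T l) ^^ k) w) = (act (T l) ^^ k) (act (T s) w)" if "l \<in> {1..r}" for l k w
  proof (induction k)
    case (Suc k)
    have "br (T s) (T l) = 0" using assms that by (simp add: commuting_def)
    then show ?case using Suc act_commute[of "T s" "T l"] by simp
  qed simp
  have "act (T s) (foldr (\<lambda>l g. (act (T l) ^^ J l) \<circ> g) xs id v) =
      foldr (\<lambda>l g. (act (T l) ^^ (J(s := Suc (J s))) l) \<circ> g) xs id v"
    if "set xs \<subseteq> {1..r}" "distinct xs" "s \<in> set xs" for xs
    using that
  proof (induction xs)
    case (Cons l xs)
    show ?case
    proof (cases "l = s")
      case True
      then have eq: "foldr (\<lambda>l g. (act (T l) ^^ (J(s := Suc (J s))) l) \<circ> g) xs id =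
          foldr (\<lambda>l g. (act (T l) ^^ J l) \<circ> g) xs id"
        using Cons.prems by (intro foldr_cong) auto
      show ?thesis unfolding foldr_comp_Cons eq using True by simp
    qed (use Cons pow in auto)
  qed simp
  from this[of "[1..<Suc r]"] show ?thesis 
    using assms(2) by (simp add: mon_def op_monomial_def atLeastLessThanSuc_atLeastAtMost del: upt_Suc)
qed

lemma mon_0: "mon r T (\<lambda>_. 0) v = v"
proof -
  have "foldr (\<lambda>l g. (act (T l) ^^ 0) \<circ> g) xs id v = v" for xs by (induction xs) auto
  then show ?thesis by (simp add: mon_def op_monomial_def)
qed

end

lemma finite_multi_exps: "finite (multi_exps r j)"
proof (rule finite_subset)
  show "multi_exps r j \<subseteq> {J. \<forall>l. (l \<in> {1..r} \<longrightarrow> J l \<in> {..j}) \<and> (l \<notin> {1..r} \<longrightarrow> J l = 0)}"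
    using member_le_sum[of _ "{1..r}"] by (fastforce simp: multi_exps_def)
qed (intro finite_set_of_finite_funs; simp)

lemma multi_exps_Suc:
  assumes "J \<in> multi_exps r j" "s \<in> {1..r}"
  shows "J(s := Suc (J s)) \<in> multi_exps r (Suc j)"
proof -
  have "(\<Sum>l=1..r. (J(s := Suc (J s))) l) = (\<Sum>l=1..r. J l + (if l = s then 1 else 0))"
    by (rule sum.cong) auto
  also have "\<dots> = Suc (\<Sum>l=1..r. J l)" using assms(2) by (simp add: sum.distrib)
  finally show ?thesis using assms by (auto simp: multi_exps_def)
qed

lemma multi_exps_0: "multi_exps r 0 = {\<lambda>_. 0}"
  by (auto simp: multi_exps_def fun_eq_iff) (metis atLeastAtMost_iff)

definition mat_coords :: "nat \<Rightarrow> ((nat \<Rightarrow> nat \<Rightarrow> 'k) \<Rightarrow> 'k) set" where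
  "mat_coords r = {\<lambda>g. g t s | t s. t \<in> {1..r} \<and> s \<in> {1..r}}"

lemma mat_coord_poly: "t \<in> {1..r} \<Longrightarrow> s \<in> {1..r} \<Longrightarrow> (\<lambda>g. g t s) \<in> poly_funs (mat_coords r)"
  unfolding mat_coords_def by (intro poly_funs.coord) blast

context restricted_module
begin

text \<open>
  Operators built from a tuple \<open>T\<close> and a matrix \<open>g\<close> that expand into the monomials of degree \<open>d\<close> in
  \<open>T\<close>, with polynomials in \<open>g\<close> as coefficients. For commuting \<open>T\<close>, a monomial of degree \<open>d\<close> in the
  tuple \<open>T g\<close> is of this kind: multiply out.
\<close>

definition expands :: "nat \<Rightarrow> nat \<Rightarrow> ((nat \<Rightarrow> 'g) \<Rightarrow> (nat \<Rightarrow> nat \<Rightarrow> 'k) \<Rightarrow> 'm \<Rightarrow> 'm) \<Rightarrow> bool" where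
  "expands r d E \<longleftrightarrow> (\<exists>c. (\<forall>J. c J \<in> poly_funs (mat_coords r)) \<and>
     (\<forall>T g v. commuting r T \<longrightarrow> E T g v = (\<Sum>J\<in>multi_exps r d. sM (c J g) (mon r T J v))))"

lemma expandsE:
  assumes "expands r d E"
  obtains c where "\<And>J. c J \<in> poly_funs (mat_coords r)"
    "\<And>T g v. commuting r T \<Longrightarrow> E T g v = (\<Sum>J\<in>multi_exps r d. sM (c J g) (mon r T J v))"
proof -
  obtain c where c: "(\<forall>J. c J \<in> poly_funs (mat_coords r)) \<and>
     (\<forall>T g v. commuting r T \<longrightarrow> E T g v = (\<Sum>J\<in>multi_exps r d. sM (c J g) (mon r T J v)))"
    using assms unfolding expands_def by (elim exE)
  show ?thesis by (rule that[of c]) (use c in simp_all)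
qed

lemma expandsI:
  assumes "\<And>J. c J \<in> poly_funs (mat_coords r)"
    "\<And>T g v. commuting r T \<Longrightarrow> E T g v = (\<Sum>J\<in>multi_exps r d. sM (c J g) (mon r T J v))"
  shows "expands r d E"
  unfolding expands_def using assms by (intro exI[of _ c]) simp

lemma expands_cong:
  assumes "expands r d E" "\<And>T g v. commuting r T \<Longrightarrow> E' T g v = E T g v"
  shows "expands r d E'"
proof -
  obtain c where c: "\<And>J. c J \<in> poly_funs (mat_coords r)"
    "\<And>T g v. commuting r T \<Longrightarrow> E T g v = (\<Sum>J\<in>multi_exps r d. sM (c J g) (mon r T J v))"
    by (rule expandsE[OF assms(1)]) (rule that; assumption)
  show ?thesis by (rule expandsI[OF c(1)]) (simp add: assms(2) c(2))
qed

lemma expands_sum: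
  assumes "finite I" "\<And>i. i \<in> I \<Longrightarrow> expands r d (E i)" "\<And>i. i \<in> I \<Longrightarrow> p i \<in> poly_funs (mat_coords r)"
  shows "expands r d (\<lambda>T g v. \<Sum>i\<in>I. sM (p i g) (E i T g v))"
proof -
  have "\<forall>i\<in>I. \<exists>c. (\<forall>J. c J \<in> poly_funs (mat_coords r)) \<and>
     (\<forall>T g v. commuting r T \<longrightarrow> E i T g v = (\<Sum>J\<in>multi_exps r d. sM (c J g) (mon r T J v)))"
    using assms(2) unfolding expands_def by simp
  then obtain c where "\<forall>i\<in>I. (\<forall>J. c i J \<in> poly_funs (mat_coords r)) \<and>
     (\<forall>T g v. commuting r T \<longrightarrow> E i T g v = (\<Sum>J\<in>multi_exps r d. sM (c i J g) (mon r T J v)))"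
    by (rule bchoice[THEN exE])
  then have c: "\<And>i J. i \<in> I \<Longrightarrow> c i J \<in> poly_funs (mat_coords r)"
    "\<And>i T g v. i \<in> I \<Longrightarrow> commuting r T \<Longrightarrow>
      E i T g v = (\<Sum>J\<in>multi_exps r d. sM (c i J g) (mon r T J v))" by simp_all
  show ?thesis
  proof (rule expandsI[of "\<lambda>J g. \<Sum>i\<in>I. p i g * c i J g"])
    show "(\<lambda>g. \<Sum>i\<in>I. p i g * c i J g) \<in> poly_funs (mat_coords r)" for J
      using c(1) assms(3) by (intro poly_funs_sum poly_funs.mult)
    fix T g v assume T: "commuting r T"
    have "(\<Sum>i\<in>I. sM (p i g) (E i T g v)) = (\<Sum>i\<in>I. \<Sum>J\<in>multi_exps r d. sM (p i g * c i J g) (mon r T J v))"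
      using c(2)[OF _ T] by (simp add: M.scale_sum_right)
    also have "\<dots> = (\<Sum>J\<in>multi_exps r d. \<Sum>i\<in>I. sM (p i g * c i J g) (mon r T J v))" by (rule sum.swap)
    finally show "(\<Sum>i\<in>I. sM (p i g) (E i T g v)) =
        (\<Sum>J\<in>multi_exps r d. sM (\<Sum>i\<in>I. p i g * c i J g) (mon r T J v))"
      by (simp add: M.scale_sum_left)
  qed
qed

lemma expands_mon:
  assumes "J \<in> multi_exps r d"
  shows "expands r d (\<lambda>T g v. mon r T J v)"
proof (rule expandsI[of "\<lambda>J' g. if J' = J then 1 else 0"])
  show "(\<lambda>g. if J' = J then 1 else (0::'k)) \<in> poly_funs (mat_coords r)" for J'
    by (rule poly_funs.const)
  show "mon r T J v = (\<Sum>J'\<in>multi_exps r d. sM (if J' = J then 1 else 0) (mon r T J' v))" for T v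
  proof -
    have "(\<Sum>J'\<in>multi_exps r d. sM (if J' = J then 1 else 0) (mon r T J' v)) =
        (\<Sum>J'\<in>multi_exps r d. if J' = J then mon r T J v else 0)" by (rule sum.cong) auto
    then show ?thesis using assms finite_multi_exps by simp
  qed
qed

lemma expands_act:
  assumes "expands r d E" "s \<in> {1..r}"
  shows "expands r (Suc d) (\<lambda>T g v. act (tmul r T g s) (E T g v))"
proof -
  obtain c where c: "\<And>J. c J \<in> poly_funs (mat_coords r)"
    "\<And>T g v. commuting r T \<Longrightarrow> E T g v = (\<Sum>J\<in>multi_exps r d. sM (c J g) (mon r T J v))"
    by (rule expandsE[OF assms(1)]) (rule that; assumption)
  let ?I = "{1..r} \<times> multi_exps r d"
  have "expands r (Suc d) (\<lambda>T g v. \<Sum>i\<in>?I. sM (g (fst i) s * c (snd i) g)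
      (mon r T ((snd i)(fst i := Suc (snd i (fst i)))) v))"
    using c(1) assms(2)
    by (intro expands_sum expands_mon poly_funs.mult mat_coord_poly multi_exps_Suc)
      (auto intro: finite_multi_exps)
  then show ?thesis
  proof (rule expands_cong)
    fix T g v assume T: "commuting r T"
    have lin: "act a (\<Sum>i\<in>I. f i) = (\<Sum>i\<in>I. act a (f i))" "act a (sM c v) = sM c (act a v)"
      for a c v and f :: "(nat \<Rightarrow> nat) \<Rightarrow> 'm" and I
    proof -
      interpret l: Vector_Spaces.linear sM sM "act a" by (rule act_linear)
      show "act a (\<Sum>i\<in>I. f i) = (\<Sum>i\<in>I. act a (f i))" "act a (sM c v) = sM c (act a v)"
        by (simp_all add: l.sum l.scale)
    qed
    have "act (tmul r T g s) (E T g v) =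
        (\<Sum>t=1..r. \<Sum>J\<in>multi_exps r d. sM (g t s) (sM (c J g) (act (T t) (mon r T J v))))"
      using assms(2) by (simp add: tmul_def act_sum_left c(2)[OF T] lin M.scale_sum_right)
        (subst sum.swap, simp add: mult.commute)
    also have "\<dots> = (\<Sum>t=1..r. \<Sum>J\<in>multi_exps r d. sM (g t s * c J g) (mon r T (J(t := Suc (J t))) v))"
      using act_mon[OF T] by (intro sum.cong) auto
    finally show "act (tmul r T g s) (E T g v) = (\<Sum>i\<in>?I. sM (g (fst i) s * c (snd i) g)
      (mon r T ((snd i)(fst i := Suc (snd i (fst i)))) v))"
      by (simp add: sum.cartesian_product case_prod_unfold)
  qed
qed

lemma mon_tmul:
  assumes "J \<in> multi_exps r j"
  obtains c where "\<And>J'. c J' \<in> poly_funs (mat_coords r)"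
    "\<And>T g v. commuting r T \<Longrightarrow>
      mon r (tmul r T g) J v = (\<Sum>J'\<in>multi_exps r j. sM (c J' g) (mon r T J' v))"
proof -
  have pow: "expands r (k + d) (\<lambda>T g v. (act (tmul r T g s) ^^ k) (E T g v))"
    if "expands r d E" "s \<in> {1..r}" for k d E s
    using that by (induction k) (auto intro: expands_act)
  have "expands r (sum_list (map J xs)) (\<lambda>T g. foldr (\<lambda>l h. (act (tmul r T g l) ^^ J l) \<circ> h) xs id)"
    if "set xs \<subseteq> {1..r}" for xs
    using that
  proof (induction xs)
    case Nil
    show ?case using expands_mon[of "\<lambda>_. 0" r 0] by (simp add: multi_exps_0 mon_0 id_def)
  next
    case (Cons l xs)
    then show ?case using pow[of "sum_list (map J xs)" _ l "J l"] by (simp add: comp_def)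
  qed
  from this[of "[1..<Suc r]"] have "expands r (sum_list (map J [1..<Suc r])) (\<lambda>T g. mon r (tmul r T g) J)"
    by (simp add: mon_def op_monomial_def atLeastLessThanSuc_atLeastAtMost del: upt_Suc)
  moreover have "sum_list (map J [1..<Suc r]) = j"
    using assms by (simp add: multi_exps_def sum_list_distinct_conv_sum_set atLeastLessThanSuc_atLeastAtMost del: upt_Suc)
  ultimately have "expands r j (\<lambda>T g. mon r (tmul r T g) J)" by simp
  then show ?thesis by (rule expandsE) (rule that; assumption)
qed

end


section \<open>The torsor over a set of elementary subalgebras\<close>

lemma sum_fun_apply: "(\<Sum>i\<in>I. f i) x = (\<Sum>i\<in>I. f i x)"
  for f :: "'i \<Rightarrow> 'x \<Rightarrow> 'a::comm_monoid_add"
  by (induction I rule: infinite_finite_induct) auto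

locale elementary_family = restricted_module sG br pm x n sM \<rho>
  for sG :: "'k::field \<Rightarrow> 'g::ab_group_add \<Rightarrow> 'g" and br pm x n
    and sM :: "'k \<Rightarrow> 'm::ab_group_add \<Rightarrow> 'm" and \<rho> +
  fixes r :: nat and X :: "'g set set"
  assumes X_Elem: "X \<subseteq> Elem r"
begin

lemma X_Grass: "X \<subseteq> Grass r"
  using X_Elem by (auto simp: Elem_def)

text \<open>
  That the entries of \<open>T\<close> commute and have vanishing \<open>p\<close>-th power is inherited from the elementary
  subalgebra that they span.
\<close>

lemma tilde_iff: "T \<in> tilde r X \<longleftrightarrow> frame r T \<and> span (T ` {1..r}) \<in> X"
proof
  assume "T \<in> tilde r X"
  then show "frame r T \<and> span (T ` {1..r}) \<in> X"
    unfolding tilde_def comm_tuples_def frame_iff quot_def by blast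
next
  assume T: "frame r T \<and> span (T ` {1..r}) \<in> X"
  then have e: "elementary (span (T ` {1..r}))" using X_Elem by (auto simp: Elem_def)
  have "T s \<in> span (T ` {1..r})" if "s \<in> {1..r}" for s using that by (intro span_base) auto
  then show "T \<in> tilde r X"
    using T e unfolding tilde_def comm_tuples_def frame_iff quot_def elementary_def by blast
qed

lemma tilde_tuple: "tilde r X \<subseteq> tuple_space r"
  by (auto simp: tilde_iff frame_def)

lemma tilde_commuting: "T \<in> tilde r X \<Longrightarrow> commuting r T"
  by (auto simp: tilde_def comm_tuples_def commuting_def)

lemma quot_in: "T \<in> tilde r X \<Longrightarrow> quot r T \<in> X"
  by (simp add: tilde_def)

abbreviation index_set :: "nat set \<Rightarrow> bool" where
  "index_set S \<equiv> S \<subseteq> {1..n} \<and> card S = r"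

lemma chart_atlas: "index_set S \<Longrightarrow> (chart r S, chart_coords r S) \<in> Grass_atlas r"
  unfolding Grass_atlas_def by blast

lemma X_chart:
  assumes "L \<in> X"
  obtains S where "index_set S" "L \<in> chart r S"
  using Grass_chart X_Grass assms by blast

lemma chart_frame_tilde:
  assumes "index_set S" "L \<in> X" "L \<in> chart r S"
  shows "chart_frame r S L \<in> tilde r X" "quot r (chart_frame r S L) = L"
  using chart_frame[of S r L] assms by (auto simp: tilde_iff quot_def)

lemma quot_chart_iff:
  assumes "index_set S" "T \<in> tilde r X"
  shows "quot r T \<in> chart r S \<longleftrightarrow> mdet r (minor S T) \<noteq> 0"
  using span_in_chart_iff[of S r T] assms by (simp add: tilde_iff quot_def)

lemma tilde_tmul:
  assumes "index_set S" "T \<in> tilde r X" "quot r T \<in> chart r S"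
  shows "tmul r (chart_frame r S (quot r T)) (minor S T) = T"
proof (rule tmul_minor)
  show "S \<subseteq> {1..n}" "card S = r" using assms(1) by blast+
  show "frame r T" using assms(2) tilde_iff by blast
  show "quot r T \<in> chart r S" by (rule assms(3))
  show "span (T ` {1..r}) = quot r T" by (simp only: quot_def)
qed

lemma minor_poly:
  assumes "index_set S" "s \<in> {1..r}" "t \<in> {1..r}"
  shows "(\<lambda>T. minor S T t s) \<in> poly_funs (tuple_coords r)"
  unfolding minor_def using assms idx_in(2)[of S r t] by (intro tuple_coord_poly) auto

lemma tuple_chart: "(tuple_space r, tuple_coords r) \<in> tuple_atlas r"
  by (simp add: tuple_atlas_eq)

interpretation B: nice_atlas "tuple_atlas r" by (rule nice_tuple)
interpretation A: nice_atlas "Grass_atlas r" by (rule nice_Grass)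

lemma reg_tuple: "f \<in> poly_funs (tuple_coords r) \<Longrightarrow> U \<subseteq> tilde r X \<Longrightarrow> reg (tuple_atlas r) U f"
  by (rule B.reg_poly[OF _ tuple_chart]) (use tilde_tuple in auto)

text \<open>
  Near \<open>T\<close>, the coordinates of its span are given by the formula for the chart matrix in terms of the
  adjugate of a block of \<open>T\<close>.
\<close>

lemma morph_quot: "morph (Grass_atlas r) X (tuple_atlas r) (tilde r X) (quot r)"
  unfolding morph_def
proof (intro conjI ballI)
  show "quot r ` tilde r X \<subseteq> X" using quot_in by blast
  fix T assume T: "T \<in> tilde r X"
  obtain S where S: "index_set S" "quot r T \<in> chart r S" using X_chart[OF quot_in[OF T]] .
  define Y' where "Y' = {T \<in> tilde r X \<inter> tuple_space r. mdet r (minor S T) \<noteq> 0}"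
  have det: "(\<lambda>T. mdet r (minor S T)) \<in> poly_funs (tuple_coords r)"
    by (rule mdet_poly) (rule minor_poly[OF S(1)])
  have "openin (zar_on (tuple_atlas r) (tilde r X)) Y'"
    unfolding Y'_def by (rule B.basic_open[OF tuple_chart det])
  moreover have "T \<in> Y'" using T S quot_chart_iff[OF S(1) T] tilde_tuple by (auto simp: Y'_def)
  moreover have "quot r ` Y' \<subseteq> chart r S" using quot_chart_iff[OF S(1)] by (auto simp: Y'_def)
  moreover have "reg (tuple_atlas r) Y' (\<lambda>z. c (quot r z))" if cS: "c \<in> chart_coords r S" for c
  proof -
    obtain i s where c: "c = (\<lambda>L. chart_matrix r S L i s)" "i \<in> {1..n}" "s \<in> {1..r}"
      using cS unfolding chart_coords_def by blast
    have "reg (tuple_atlas r) Y' (\<lambda>T. (\<Sum>t=1..r. coord i (T t) * madj r (minor S T) t s) / mdet r (minor S T))"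
    proof (rule B.reg_divide)
      have "(\<lambda>T. \<Sum>t=1..r. coord i (T t) * madj r (minor S T) t s) \<in> poly_funs (tuple_coords r)"
        using c(2,3)
        by (intro poly_funs_sum poly_funs.mult tuple_coord_poly madj_poly[of r "\<lambda>T. minor S T"] minor_poly[OF S(1)])
      then show "reg (tuple_atlas r) Y' (\<lambda>T. \<Sum>t=1..r. coord i (T t) * madj r (minor S T) t s)"
        by (rule reg_tuple) (auto simp: Y'_def)
      show "reg (tuple_atlas r) Y' (\<lambda>T. mdet r (minor S T))"
        by (rule reg_tuple[OF det]) (auto simp: Y'_def)
      show "mdet r (minor S T) \<noteq> 0" if "T \<in> Y'" for T using that by (simp add: Y'_def)
    qed
    then show ?thesis
    proof (rule reg_cong[OF _ order_refl])
      fix T assume "T \<in> Y'"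
      then have T: "frame r T" "mdet r (minor S T) \<noteq> 0" by (auto simp: Y'_def tilde_iff)
      show "(\<Sum>t=1..r. coord i (T t) * madj r (minor S T) t s) / mdet r (minor S T) = c (quot r T)"
        unfolding c(1) quot_def using S(1) by (intro chart_matrix_eq[symmetric] T c refl) auto
    qed
  qed
  ultimately show "\<exists>V C Y'. (V, C) \<in> Grass_atlas r \<and> openin (zar_on (tuple_atlas r) (tilde r X)) Y' \<and>
     T \<in> Y' \<and> quot r ` Y' \<subseteq> V \<and> (\<forall>c\<in>C. reg (tuple_atlas r) Y' (\<lambda>z. c (quot r z)))"
    using chart_atlas[OF S(1)]
    by (intro exI[of _ "chart r S"] exI[of _ "chart_coords r S"] exI[of _ Y'] conjI ballI)
qed

lemma reg_chart_frame:
  assumes "index_set S" "U \<subseteq> chart r S" "i \<in> {1..n}" "s \<in> {1..r}"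
  shows "reg (Grass_atlas r) U (\<lambda>L. coord i (chart_frame r S L s))"
  unfolding coord_chart_frame[OF assms(3,4)]
  using assms by (intro A.reg_poly[OF chart_coords_poly chart_atlas[OF assms(1)]])

lemma morph_chart_frame:
  assumes "index_set S" "U \<subseteq> X" "U \<subseteq> chart r S"
  shows "morph (tuple_atlas r) (tilde r X) (Grass_atlas r) U (chart_frame r S)"
proof (rule morph_tuple[OF nice_Grass])
  show "U \<subseteq> points (Grass_atlas r)" using assms(2) X_Grass points_Grass by blast
  show "chart_frame r S ` U \<subseteq> tilde r X" using chart_frame_tilde(1)[OF assms(1)] assms(2,3) by blast
qed (rule tilde_tuple, rule reg_chart_frame[OF assms(1,3)])

sublocale D: descent "Grass_atlas r" "tuple_atlas r" sM M_basis X "tilde r X" "quot r"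
proof (intro descent.intro vector_atlas.intro nice_Grass nice_tuple descent_axioms.intro)
  show "finite_dimensional_vector_space sM M_basis" by unfold_locales
  show "finite_dimensional_vector_space sM M_basis" by unfold_locales
  show "X \<subseteq> points (Grass_atlas r)" using X_Grass points_Grass by simp
  show "tilde r X \<subseteq> points (tuple_atlas r)" using tilde_tuple points_tuple by simp
  show "morph (Grass_atlas r) X (tuple_atlas r) (tilde r X) (quot r)" by (rule morph_quot)
  fix L assume L: "L \<in> X"
  then obtain S where S: "index_set S" "L \<in> chart r S" by (rule X_chart)
  have "openin (zar_on (Grass_atlas r) X) (X \<inter> chart r S)" by (rule A.chart_open[OF chart_atlas[OF S(1)]])
  moreover have "morph (tuple_atlas r) (tilde r X) (Grass_atlas r) (X \<inter> chart r S) (chart_frame r S)"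
    by (rule morph_chart_frame[OF S(1)]) auto
  moreover have "\<forall>u\<in>X \<inter> chart r S. quot r (chart_frame r S u) = u"
    using chart_frame_tilde(2)[OF S(1)] by blast
  ultimately show "\<exists>U \<sigma>. openin (zar_on (Grass_atlas r) X) U \<and> L \<in> U \<and>
      morph (tuple_atlas r) (tilde r X) (Grass_atlas r) U \<sigma> \<and> (\<forall>u\<in>U. quot r (\<sigma> u) = u)"
    using L S(2) by (intro exI[of _ "X \<inter> chart r S"] exI[of _ "chart_frame r S"]) blast
qed

lemma chart_open: "index_set S \<Longrightarrow> openin (zar_on (Grass_atlas r) X) (X \<inter> chart r S)"
  by (rule A.chart_open[OF chart_atlas])


section \<open>Image and kernel sheaves\<close>

lemma act_coords: "(\<Sum>i=1..n. sM (coord i a) (act (x i) v)) = act a v"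
  using act_sum_left[of "\<lambda>i. coord i a" x "{1..n}" v] by (simp only: coord_expand)

lemma op_tuple: "op_monomial (Theta tuple_coord) r J f z = mon r z J (f z)"
  by (rule op_monomial_Theta) (simp only: tuple_coord_def act_coords)

lemma op_tuple_fun: "op_monomial (Theta tuple_coord) r J f = (\<lambda>z. mon r z J (f z))"
  by (rule ext) (rule op_tuple)

text \<open>
  The action of \<open>\<phi> u s\<close> is a combination of the constant operators \<open>act (x i)\<close> with regular coefficients.
\<close>

lemma mon_vreg:
  assumes "vector_atlas A sM M_basis" "U \<subseteq> points A"
    and \<phi>: "\<And>i s. i \<in> {1..n} \<Longrightarrow> s \<in> {1..r} \<Longrightarrow> reg A U (\<lambda>u. coord i (\<phi> u s))"
    and t: "vector_atlas.vreg A sM M_basis U t"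
  shows "vector_atlas.vreg A sM M_basis U (\<lambda>u. mon r (\<phi> u) J (t u))"
proof -
  interpret V: vector_atlas A sM M_basis by fact
  have act: "V.vreg U (\<lambda>u. act (\<phi> u s) (t u))" if "s \<in> {1..r}" "V.vreg U t" for s t
  proof -
    have "V.vreg U (\<lambda>u. \<Sum>i=1..n. sM (coord i (\<phi> u s)) (act (x i) (t u)))"
    proof (rule V.vreg_sum[OF assms(2)])
      show "V.vreg U (\<lambda>u. sM (coord i (\<phi> u s)) (act (x i) (t u)))" if "i \<in> {1..n}" for i
        by (rule V.vreg_scale[OF \<phi>[OF that \<open>s \<in> {1..r}\<close>]
            V.vreg_linear[OF act_linear \<open>V.vreg U t\<close> assms(2)]])
    qed
    then show ?thesis by (simp only: act_coords)
  qed
  have pow: "V.vreg U (\<lambda>u. (act (\<phi> u s) ^^ k) (t u))" if "s \<in> {1..r}" "V.vreg U t" for s k t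
    using that by (induction k) (auto intro: act)
  have "V.vreg U (\<lambda>u. foldr (\<lambda>l g. (act (\<phi> u l) ^^ J l) \<circ> g) xs id (t u))" if "set xs \<subseteq> {1..r}" for xs
    using that
  proof (induction xs)
    case (Cons l xs)
    then have "l \<in> {1..r}" "set xs \<subseteq> {1..r}" by simp_all
    then show ?case unfolding foldr_comp_Cons using pow Cons.IH by blast
  qed (simp add: t)
  from this[of "[1..<Suc r]"] show ?thesis
    by (simp add: mon_def op_monomial_def atLeastLessThanSuc_atLeastAtMost del: upt_Suc)
qed

abbreviation Im_tilde :: "nat \<Rightarrow> (nat \<Rightarrow> 'g, 'm) sheaf" where
  "Im_tilde j \<equiv> im_sheaf sM (tuple_atlas r) (tilde r X) (Theta tuple_coord) r j"

abbreviation Ker_tilde :: "nat \<Rightarrow> (nat \<Rightarrow> 'g, 'm) sheaf" where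
  "Ker_tilde j \<equiv> ker_sheaf sM (tuple_atlas r) (tilde r X) (Theta tuple_coord) r j"

abbreviation openY :: "(nat \<Rightarrow> 'g) set \<Rightarrow> bool" where
  "openY \<equiv> openin (zar_on (tuple_atlas r) (tilde r X))"

abbreviation openX :: "'g set set \<Rightarrow> bool" where
  "openX \<equiv> openin (zar_on (Grass_atlas r) X)"

lemma Im_tilde_iff:
  assumes V: "openY V"
  shows "t \<in> Im_tilde j V \<longleftrightarrow> (\<forall>z. z \<notin> V \<longrightarrow> t z = 0) \<and> D.B.vreg V t \<and>
    (\<forall>y\<in>V. \<exists>V'. openY V' \<and> y \<in> V' \<and> V' \<subseteq> V \<and> (\<exists>f. (\<forall>J\<in>multi_exps r j. D.B.vreg V' (f J)) \<and>
      (\<forall>z\<in>V'. t z = (\<Sum>J\<in>multi_exps r j. mon r z J (f J z)))))"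
proof -
  have "restr V' t \<in> im_module (Theta tuple_coord) r j (tens sM (regular_funs (tuple_atlas r) V')) \<longleftrightarrow>
    (\<exists>f. (\<forall>J\<in>multi_exps r j. D.B.vreg V' (f J)) \<and> (\<forall>z\<in>V'. t z = (\<Sum>J\<in>multi_exps r j. mon r z J (f J z))))"
    (is "?l \<longleftrightarrow> ?r") if "openY V'" for V'
  proof
    note tens = D.B.tens_regular_funs[OF D.open_points(2)[OF that]] D.B.restr_tens_regular_funs[OF D.open_points(2)[OF that]]
    show ?r if ?l
    proof -
      obtain f where f: "restr V' t = (\<Sum>J\<in>multi_exps r j. op_monomial (Theta tuple_coord) r J (f J))"
        "\<forall>J\<in>multi_exps r j. f J \<in> tens sM (regular_funs (tuple_atlas r) V')"
        using \<open>?l\<close> unfolding im_module_def by blast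
      have "t z = (\<Sum>J\<in>multi_exps r j. mon r z J (f J z))" if "z \<in> V'" for z
        using fun_cong[OF f(1), of z] that by (simp add: restr_def sum_fun_apply op_tuple)
      moreover have "\<forall>J\<in>multi_exps r j. D.B.vreg V' (f J)" using f(2) by (simp add: tens)
      ultimately show ?r by (intro exI[of _ f]) simp
    qed
    show ?l if ?r
    proof -
      obtain f where f: "\<forall>J\<in>multi_exps r j. D.B.vreg V' (f J)"
        "\<forall>z\<in>V'. t z = (\<Sum>J\<in>multi_exps r j. mon r z J (f J z))" using \<open>?r\<close> by blast
      have "restr V' t = (\<Sum>J\<in>multi_exps r j. op_monomial (Theta tuple_coord) r J (restr V' (f J)))"
        unfolding op_tuple_fun using f(2) by (auto simp: fun_eq_iff sum_fun_apply restr_def mon_zero)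
      moreover have "\<forall>J\<in>multi_exps r j. restr V' (f J) \<in> tens sM (regular_funs (tuple_atlas r) V')"
        using f(1) by (simp add: tens(2))
      ultimately show ?l unfolding im_module_def mem_Collect_eq
        by (intro exI[of _ "\<lambda>J. restr V' (f J)"] conjI)
    qed
  qed
  then show ?thesis
    using V unfolding im_sheaf_def
    by (simp add: D.B.tens_regular_funs[OF D.open_points(2)[OF V]] cong: conj_cong)
qed

lemma Ker_tilde_iff:
  assumes V: "openY V"
  shows "t \<in> Ker_tilde j V \<longleftrightarrow> (\<forall>z. z \<notin> V \<longrightarrow> t z = 0) \<and> D.B.vreg V t \<and>
    (\<forall>z\<in>V. \<forall>J\<in>multi_exps r j. mon r z J (t z) = 0)"
  using V
  by (auto simp: ker_sheaf_def ker_module_def op_tuple_fun D.B.tens_regular_funs[OF D.open_points(2)[OF V]]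
      fun_eq_iff mon_zero)

lemma Ker_tilde_submodule: "submodule_sheaf sM (tuple_atlas r) (tilde r X) (Ker_tilde j)"
proof (rule submodule_sheafI)
  fix V assume V: "openY V"
  note VP = D.open_points(2)[OF V]
  show "s \<in> tens sM (regular_funs (tuple_atlas r) V)" if "s \<in> Ker_tilde j V" for s
    using that unfolding Ker_tilde_iff[OF V] D.B.tens_regular_funs[OF VP] by blast
  show "0 \<in> Ker_tilde j V"
    unfolding Ker_tilde_iff[OF V] using D.B.vreg_const[OF VP, of 0] by (simp add: mon_zero zero_fun_def)
  show "s + t \<in> Ker_tilde j V" if "s \<in> Ker_tilde j V" "t \<in> Ker_tilde j V" for s t
    using that D.B.vreg_add[of V s t] unfolding Ker_tilde_iff[OF V] by (simp add: mon_add plus_fun_def)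
  show "(\<lambda>x. sM (a x) (s x)) \<in> Ker_tilde j V"
    if "a \<in> regular_funs (tuple_atlas r) V" "s \<in> Ker_tilde j V" for a s
    using that D.B.vreg_scale[of V a s] unfolding Ker_tilde_iff[OF V] by (simp add: mon_scale B.regular_funs_iff)
  show "restr V' s \<in> Ker_tilde j V'" if "openY V'" "V' \<subseteq> V" "s \<in> Ker_tilde j V" for V' s
    using that D.B.vreg_mono[of V s V'] unfolding Ker_tilde_iff[OF V] Ker_tilde_iff[OF that(1)] D.B.vreg_restr
    by (auto simp: restr_def)
  show "s \<in> Ker_tilde j V" if s: "s \<in> tens sM (regular_funs (tuple_atlas r) V)"
    and loc: "\<And>x. x \<in> V \<Longrightarrow> \<exists>V'. openY V' \<and> x \<in> V' \<and> V' \<subseteq> V \<and> restr V' s \<in> Ker_tilde j V'" for s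
  proof -
    have "mon r z J (s z) = 0" if z: "z \<in> V" and J: "J \<in> multi_exps r j" for z J
    proof -
      obtain V' where V': "openY V'" "z \<in> V'" "restr V' s \<in> Ker_tilde j V'" using loc[OF z] by blast
      then have "mon r z J (restr V' s z) = 0" using J unfolding Ker_tilde_iff[OF V'(1)] by blast
      then show ?thesis using V'(2) by (simp add: restr_def)
    qed
    then show ?thesis using s unfolding Ker_tilde_iff[OF V] D.B.tens_regular_funs[OF VP] by blast
  qed
qed (simp add: ker_sheaf_def)

lemma Im_tilde_submodule: "submodule_sheaf sM (tuple_atlas r) (tilde r X) (Im_tilde j)"
proof (rule submodule_sheafI)
  fix V assume V: "openY V"
  note VP = D.open_points(2)[OF V]
  let ?loc = "\<lambda>t y. \<exists>V'. openY V' \<and> y \<in> V' \<and> V' \<subseteq> V \<and> (\<exists>f. (\<forall>J\<in>multi_exps r j. D.B.vreg V' (f J)) \<and>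
      (\<forall>z\<in>V'. t z = (\<Sum>J\<in>multi_exps r j. mon r z J (f J z))))"
  have locI: "?loc t y" if "openY V'" "y \<in> V'" "V' \<subseteq> V" "\<forall>J\<in>multi_exps r j. D.B.vreg V' (f J)"
    "\<forall>z\<in>V'. t z = (\<Sum>J\<in>multi_exps r j. mon r z J (f J z))" for V' f t y
    using that by (intro exI[of _ V'] exI[of _ f] conjI)
  show "s \<in> tens sM (regular_funs (tuple_atlas r) V)" if "s \<in> Im_tilde j V" for s
    using that unfolding Im_tilde_iff[OF V] D.B.tens_regular_funs[OF VP] by blast
  show "0 \<in> Im_tilde j V"
    unfolding Im_tilde_iff[OF V]
    using V D.B.vreg_const[OF VP, of 0]
    by (intro conjI ballI locI[of V _ "\<lambda>J z. 0"]) (simp_all add: mon_zero zero_fun_def)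
  show "s + t \<in> Im_tilde j V" if s: "s \<in> Im_tilde j V" and t: "t \<in> Im_tilde j V" for s t
  proof -
    note s' = s[unfolded Im_tilde_iff[OF V]] and t' = t[unfolded Im_tilde_iff[OF V]]
    have "?loc (s + t) y" if y: "y \<in> V" for y
    proof -
      obtain V1 f where 1: "openY V1" "y \<in> V1" "V1 \<subseteq> V" "\<forall>J\<in>multi_exps r j. D.B.vreg V1 (f J)"
        "\<forall>z\<in>V1. s z = (\<Sum>J\<in>multi_exps r j. mon r z J (f J z))" using s' y by blast
      obtain V2 g where 2: "openY V2" "y \<in> V2" "V2 \<subseteq> V" "\<forall>J\<in>multi_exps r j. D.B.vreg V2 (g J)"
        "\<forall>z\<in>V2. t z = (\<Sum>J\<in>multi_exps r j. mon r z J (g J z))" using t' y by blast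
      show ?thesis
      proof (rule locI[of "V1 \<inter> V2" _ "\<lambda>J z. f J z + g J z"])
        show "\<forall>J\<in>multi_exps r j. D.B.vreg (V1 \<inter> V2) (\<lambda>z. f J z + g J z)"
          using 1(4) 2(4) by (auto intro!: D.B.vreg_add elim: D.B.vreg_mono)
        show "\<forall>z\<in>V1 \<inter> V2. (s + t) z = (\<Sum>J\<in>multi_exps r j. mon r z J (f J z + g J z))"
          using 1(5) 2(5) by (simp add: mon_add sum.distrib)
      qed (use 1 2 in auto)
    qed
    then show ?thesis
      using s' t' D.B.vreg_add[of V s t] unfolding Im_tilde_iff[OF V]
      by (intro conjI ballI) (simp_all add: plus_fun_def)
  qed
  show "(\<lambda>x. sM (a x) (s x)) \<in> Im_tilde j V"
    if a: "a \<in> regular_funs (tuple_atlas r) V" and s: "s \<in> Im_tilde j V" for a s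
  proof -
    note s' = s[unfolded Im_tilde_iff[OF V]]
    have a': "reg (tuple_atlas r) V a" using a by (simp add: B.regular_funs_iff)
    have "?loc (\<lambda>x. sM (a x) (s x)) y" if y: "y \<in> V" for y
    proof -
      obtain V1 f where 1: "openY V1" "y \<in> V1" "V1 \<subseteq> V" "\<forall>J\<in>multi_exps r j. D.B.vreg V1 (f J)"
        "\<forall>z\<in>V1. s z = (\<Sum>J\<in>multi_exps r j. mon r z J (f J z))" using s' y by blast
      show ?thesis
      proof (rule locI[OF 1(1-3), of "\<lambda>J z. sM (a z) (f J z)"])
        show "\<forall>J\<in>multi_exps r j. D.B.vreg V1 (\<lambda>z. sM (a z) (f J z))"
          using 1(4) reg_mono[OF a' 1(3)] by (auto intro!: D.B.vreg_scale)
        show "\<forall>z\<in>V1. sM (a z) (s z) = (\<Sum>J\<in>multi_exps r j. mon r z J (sM (a z) (f J z)))"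
          using 1(5) by (simp add: mon_scale M.scale_sum_right)
      qed
    qed
    then show ?thesis
      using s' D.B.vreg_scale[OF a', of s] unfolding Im_tilde_iff[OF V]
      by (intro conjI ballI) simp_all
  qed
  show "restr V' s \<in> Im_tilde j V'" if V': "openY V'" "V' \<subseteq> V" and s: "s \<in> Im_tilde j V" for V' s
  proof -
    note s' = s[unfolded Im_tilde_iff[OF V]]
    show ?thesis
      unfolding Im_tilde_iff[OF V'(1)] D.B.vreg_restr
    proof (intro conjI ballI)
      fix y assume y: "y \<in> V'"
      then obtain V1 f where 1: "openY V1" "y \<in> V1" "V1 \<subseteq> V" "\<forall>J\<in>multi_exps r j. D.B.vreg V1 (f J)"
        "\<forall>z\<in>V1. s z = (\<Sum>J\<in>multi_exps r j. mon r z J (f J z))" using s' V'(2) by blast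
      show "\<exists>V''. openY V'' \<and> y \<in> V'' \<and> V'' \<subseteq> V' \<and> (\<exists>f. (\<forall>J\<in>multi_exps r j. D.B.vreg V'' (f J)) \<and>
          (\<forall>z\<in>V''. restr V' s z = (\<Sum>J\<in>multi_exps r j. mon r z J (f J z))))"
        using 1 y V'(1)
        by (intro exI[of _ "V1 \<inter> V'"] exI[of _ f] conjI ballI openin_Int)
          (auto intro: D.B.vreg_mono simp: restr_def)
    qed (use s' D.B.vreg_mono[OF _ V'(2), of s] in \<open>auto simp: restr_def\<close>)
  qed
  show "s \<in> Im_tilde j V" if s: "s \<in> tens sM (regular_funs (tuple_atlas r) V)"
    and loc: "\<And>x. x \<in> V \<Longrightarrow> \<exists>V'. openY V' \<and> x \<in> V' \<and> V' \<subseteq> V \<and> restr V' s \<in> Im_tilde j V'" for s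
  proof -
    have "?loc s y" if y: "y \<in> V" for y
    proof -
      obtain V' where V': "openY V'" "y \<in> V'" "V' \<subseteq> V" "restr V' s \<in> Im_tilde j V'" using loc[OF y] by blast
      then obtain V1 f where 1: "openY V1" "y \<in> V1" "V1 \<subseteq> V'" "\<forall>J\<in>multi_exps r j. D.B.vreg V1 (f J)"
        "\<forall>z\<in>V1. restr V' s z = (\<Sum>J\<in>multi_exps r j. mon r z J (f J z))"
        unfolding Im_tilde_iff[OF V'(1)] by blast
      have "\<forall>z\<in>V1. s z = (\<Sum>J\<in>multi_exps r j. mon r z J (f J z))"
      proof
        fix z assume z: "z \<in> V1"
        then show "s z = (\<Sum>J\<in>multi_exps r j. mon r z J (f J z))"
          using bspec[OF 1(5) z] 1(3) by (auto simp: restr_def)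
      qed
      then show ?thesis using 1 V'(3) by (intro locI[of V1 _ f]) auto
    qed
    then show ?thesis using s unfolding Im_tilde_iff[OF V] D.B.tens_regular_funs[OF VP] by simp
  qed
qed (simp add: im_sheaf_def)

end

context elementary_family
begin

text \<open>
  By Cramer's rule, this is the inverse of the block of rows \<open>S\<close>. It turns \<open>T\<close> into the normalised basis of
  the chart \<open>S\<close>.
\<close>

definition norm_mat :: "nat set \<Rightarrow> (nat \<Rightarrow> 'g) \<Rightarrow> nat \<Rightarrow> nat \<Rightarrow> 'k" where
  "norm_mat S T = (\<lambda>t s. madj r (minor S T) t s / mdet r (minor S T))"

lemma tmul_norm_mat:
  assumes "index_set S" "T \<in> tilde r X" "quot r T \<in> chart r S"
  shows "tmul r T (norm_mat S T) = chart_frame r S (quot r T)"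
  unfolding norm_mat_def
proof (rule chart_frame_eq_tmul[symmetric])
  show "S \<subseteq> {1..n}" "card S = r" using assms(1) by blast+
  show "frame r T" using assms(2) tilde_iff by blast
  show "span (T ` {1..r}) = quot r T" by (simp only: quot_def)
  show "mdet r (minor S T) \<noteq> 0" using quot_chart_iff[OF assms(1,2)] assms(3) by blast
qed

lemma reg_mat_poly:
  assumes "c \<in> poly_funs (mat_coords r)" "V \<subseteq> tilde r X"
    and "\<And>t s. t \<in> {1..r} \<Longrightarrow> s \<in> {1..r} \<Longrightarrow> reg (tuple_atlas r) V (\<lambda>z. g z t s)"
  shows "reg (tuple_atlas r) V (\<lambda>z. c (g z))"
proof (rule D.B.reg_poly_comp[OF assms(1)])
  show "reg (tuple_atlas r) V (\<lambda>x. c (g x))" if "c \<in> mat_coords r" for c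
    using assms(3) that by (auto simp: mat_coords_def)
  show "V \<subseteq> points (tuple_atlas r)" using assms(2) tilde_tuple points_tuple by blast
qed

lemma reg_norm_mat:
  assumes "index_set S" "V \<subseteq> tilde r X" "\<And>z. z \<in> V \<Longrightarrow> quot r z \<in> chart r S"
    and "t \<in> {1..r}" "s \<in> {1..r}"
  shows "reg (tuple_atlas r) V (\<lambda>z. norm_mat S z t s)"
  unfolding norm_mat_def
proof (rule D.B.reg_divide)
  show "reg (tuple_atlas r) V (\<lambda>z. madj r (minor S z) t s)"
    using assms by (intro reg_tuple madj_poly[of r "\<lambda>T. minor S T"] minor_poly)
  show "reg (tuple_atlas r) V (\<lambda>z. mdet r (minor S z))"
    using assms by (intro reg_tuple mdet_poly minor_poly)
  show "mdet r (minor S z) \<noteq> 0" if "z \<in> V" for z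
    using quot_chart_iff[OF assms(1), of z] assms(2,3) that by blast
qed

lemma reg_minor:
  assumes "index_set S" "V \<subseteq> tilde r X" "t \<in> {1..r}" "s \<in> {1..r}"
  shows "reg (tuple_atlas r) V (\<lambda>z. minor S z t s)"
  using assms by (intro reg_tuple minor_poly)

lemma mon_tmul_family:
  obtains c where "\<And>J J'. J \<in> multi_exps r j \<Longrightarrow> c J J' \<in> poly_funs (mat_coords r)"
    "\<And>J T g v. J \<in> multi_exps r j \<Longrightarrow> commuting r T \<Longrightarrow>
      mon r (tmul r T g) J v = (\<Sum>J'\<in>multi_exps r j. sM (c J J' g) (mon r T J' v))"
proof -
  have "\<forall>J\<in>multi_exps r j. \<exists>c. (\<forall>J'. c J' \<in> poly_funs (mat_coords r)) \<and> (\<forall>T g v. commuting r T \<longrightarrow>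
      mon r (tmul r T g) J v = (\<Sum>J'\<in>multi_exps r j. sM (c J' g) (mon r T J' v)))"
  proof
    fix J assume "J \<in> multi_exps r j"
    then obtain c where "\<And>J'. c J' \<in> poly_funs (mat_coords r)"
      "\<And>T g v. commuting r T \<Longrightarrow>
        mon r (tmul r T g) J v = (\<Sum>J'\<in>multi_exps r j. sM (c J' g) (mon r T J' v))"
      by (rule mon_tmul) (rule that; assumption)
    then show "\<exists>c. (\<forall>J'. c J' \<in> poly_funs (mat_coords r)) \<and> (\<forall>T g v. commuting r T \<longrightarrow>
      mon r (tmul r T g) J v = (\<Sum>J'\<in>multi_exps r j. sM (c J' g) (mon r T J' v)))"
      by (intro exI[of _ c]) simp
  qed
  then obtain c where c: "\<forall>J\<in>multi_exps r j. (\<forall>J'. c J J' \<in> poly_funs (mat_coords r)) \<and> (\<forall>T g v. commuting r T \<longrightarrow>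
      mon r (tmul r T g) J v = (\<Sum>J'\<in>multi_exps r j. sM (c J J' g) (mon r T J' v)))"
    by (rule bchoice[THEN exE])
  show ?thesis by (rule that[of c]) (use c in simp_all)
qed

lemma chart_frame_commuting:
  "index_set S \<Longrightarrow> L \<in> X \<Longrightarrow> L \<in> chart r S \<Longrightarrow> commuting r (chart_frame r S L)"
  by (intro tilde_commuting chart_frame_tilde(1))

text \<open>The monomials of degree \<open>j\<close> in one basis of \<open>L\<close> span the same operators as those in any other.\<close>

lemma mon_kernel_eq:
  assumes "index_set S" "z \<in> tilde r X" "quot r z \<in> chart r S"
  shows "(\<forall>J\<in>multi_exps r j. mon r z J v = 0) \<longleftrightarrow> (\<forall>J\<in>multi_exps r j. mon r (chart_frame r S (quot r z)) J v = 0)"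
proof -
  obtain c where c: "\<And>J T g v. J \<in> multi_exps r j \<Longrightarrow> commuting r T \<Longrightarrow>
      mon r (tmul r T g) J v = (\<Sum>J'\<in>multi_exps r j. sM (c J J' g) (mon r T J' v))"
    by (rule mon_tmul_family[of j]) (rule that; assumption)
  show ?thesis
  proof (intro iffI ballI)
    fix J assume "\<forall>J\<in>multi_exps r j. mon r z J v = 0" "J \<in> multi_exps r j"
    then show "mon r (chart_frame r S (quot r z)) J v = 0"
      using c[of J z "norm_mat S z" v] tilde_commuting[OF assms(2)] by (simp add: tmul_norm_mat[OF assms])
  next
    fix J assume "\<forall>J\<in>multi_exps r j. mon r (chart_frame r S (quot r z)) J v = 0" "J \<in> multi_exps r j"
    then show "mon r z J v = 0"
      using c[of J "chart_frame r S (quot r z)" "minor S z" v]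
        chart_frame_commuting[OF assms(1) quot_in[OF assms(2)] assms(3)] by (simp add: tilde_tmul[OF assms])
  qed
qed

abbreviation section_form :: "nat set \<Rightarrow> nat \<Rightarrow> 'g set set \<Rightarrow> ('g set \<Rightarrow> 'm) \<Rightarrow> bool" where
  "section_form S j U t \<equiv> \<exists>f. (\<forall>J\<in>multi_exps r j. D.A.vreg U (f J)) \<and>
     (\<forall>L\<in>U. t L = (\<Sum>J\<in>multi_exps r j. mon r (chart_frame r S L) J (f J L)))"

text \<open>
  In one direction, an expression of \<open>t \<circ> q\<close> is pulled back along \<open>\<sigma>\<close>. In the other direction, \<open>\<sigma> (q z)\<close>
  is \<open>z\<close> times a matrix that is regular in \<open>z\<close>, so monomials in \<open>\<sigma> (q z)\<close> expand into monomials in \<open>z\<close>.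
\<close>

lemma desc_Im_chart:
  assumes S: "index_set S" and U: "openX U" "U \<subseteq> chart r S"
  shows "t \<in> D.desc (Im_tilde j) U \<longleftrightarrow> (\<forall>L. L \<notin> U \<longrightarrow> t L = 0) \<and> D.A.vreg U t \<and>
    (\<forall>L\<in>U. \<exists>U'. openX U' \<and> L \<in> U' \<and> U' \<subseteq> U \<and> section_form S j U' t)"
proof -
  note preU = D.pre_open[OF U(1)]
  have UX: "U \<subseteq> X" using zar_on_subset[OF U(1)] .
  have \<sigma>: "morph (tuple_atlas r) (tilde r X) (Grass_atlas r) U (chart_frame r S)"
    by (rule morph_chart_frame[OF S UX U(2)])
  have \<sigma>in: "chart_frame r S L \<in> tilde r X" "quot r (chart_frame r S L) = L" if "L \<in> U" for L
    using chart_frame_tilde[OF S] that UX U(2) by blast+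
  have "restr (D.pre U) (\<lambda>y. t (quot r y)) \<in> Im_tilde j (D.pre U) \<longleftrightarrow>
    (\<forall>L\<in>U. \<exists>U'. openX U' \<and> L \<in> U' \<and> U' \<subseteq> U \<and> section_form S j U' t)" (is "?l \<longleftrightarrow> ?r")
    if reg: "D.A.vreg U t"
  proof
    assume l: ?l
    show ?r
    proof
      fix L assume L: "L \<in> U"
      then have "chart_frame r S L \<in> D.pre U" using \<sigma>in by simp
      then obtain V' f where V': "openY V'" "chart_frame r S L \<in> V'" "V' \<subseteq> D.pre U"
        "\<forall>J\<in>multi_exps r j. D.B.vreg V' (f J)"
        "\<forall>z\<in>V'. restr (D.pre U) (\<lambda>y. t (quot r y)) z = (\<Sum>J\<in>multi_exps r j. mon r z J (f J z))"
        using l unfolding Im_tilde_iff[OF preU] by blast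
      define U' where "U' = {L \<in> U. chart_frame r S L \<in> V'}"
      have U': "openX U'"
        using D.BA.morph_open[OF \<sigma> V'(1)] zar_on_open_sub[OF U(1), of U'] by (simp add: U'_def)
      have "t L = (\<Sum>J\<in>multi_exps r j. mon r (chart_frame r S L) J (f J (chart_frame r S L)))"
        if "L \<in> U'" for L
      proof -
        have "chart_frame r S L \<in> V'" "L \<in> U" using that by (auto simp: U'_def)
        then show ?thesis using bspec[OF V'(5), of "chart_frame r S L"] \<sigma>in[of L] by (simp add: restr_def)
      qed
      moreover have "D.A.vreg U' (\<lambda>L. f J (chart_frame r S L))" if "J \<in> multi_exps r j" for J
        using V'(4) that by (intro D.vreg_section[OF \<sigma>, of V' "f J"]) (auto simp: U'_def)
      ultimately have "section_form S j U' t"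
        by (intro exI[of _ "\<lambda>J L. f J (chart_frame r S L)"] conjI ballI)
      then show "\<exists>U'. openX U' \<and> L \<in> U' \<and> U' \<subseteq> U \<and> section_form S j U' t"
        using U' L V'(2) by (intro exI[of _ U'] conjI) (auto simp: U'_def)
    qed
  next
    assume r: ?r
    obtain c where c: "\<And>J J'. J \<in> multi_exps r j \<Longrightarrow> c J J' \<in> poly_funs (mat_coords r)"
      "\<And>J T g v. J \<in> multi_exps r j \<Longrightarrow> commuting r T \<Longrightarrow>
        mon r (tmul r T g) J v = (\<Sum>J'\<in>multi_exps r j. sM (c J J' g) (mon r T J' v))"
      by (rule mon_tmul_family[of j]) (rule that; assumption)
    show ?l
      unfolding Im_tilde_iff[OF preU] D.B.vreg_restr
    proof (intro conjI ballI)
      show "\<forall>z. z \<notin> D.pre U \<longrightarrow> restr (D.pre U) (\<lambda>y. t (quot r y)) z = 0" by (simp add: restr_def)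
      show "D.B.vreg (D.pre U) (\<lambda>y. t (quot r y))"
        by (rule D.vreg_pullback[OF D.q reg]) auto
      fix y assume y: "y \<in> D.pre U"
      then have "quot r y \<in> U" by simp
      from bspec[OF r this] obtain U' where U'0: "openX U' \<and> quot r y \<in> U' \<and> U' \<subseteq> U \<and> section_form S j U' t"
        by (elim exE) (rule that; assumption)
      from conjunct2[OF conjunct2[OF conjunct2[OF U'0]]]
      obtain f where "(\<forall>J\<in>multi_exps r j. D.A.vreg U' (f J)) \<and>
          (\<forall>L\<in>U'. t L = (\<Sum>J\<in>multi_exps r j. mon r (chart_frame r S L) J (f J L)))"
        by (elim exE) (rule that; assumption)
      with U'0 have U': "openX U'" "quot r y \<in> U'" "U' \<subseteq> U" "\<forall>J\<in>multi_exps r j. D.A.vreg U' (f J)"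
        "\<forall>L\<in>U'. t L = (\<Sum>J\<in>multi_exps r j. mon r (chart_frame r S L) J (f J L))"
        by simp_all
      define V' where "V' = D.pre U'"
      have V': "openY V'" unfolding V'_def by (rule D.pre_open[OF U'(1)])
      have VY: "V' \<subseteq> tilde r X" and VS: "\<And>z. z \<in> V' \<Longrightarrow> quot r z \<in> chart r S"
        using U'(3) U(2) by (auto simp: V'_def)
      define f' where "f' J' z = (\<Sum>J\<in>multi_exps r j. sM (c J J' (norm_mat S z)) (f J (quot r z)))" for J' z
      have "D.B.vreg V' (f' J')" for J'
        unfolding f'_def
      proof (rule D.B.vreg_sum[OF D.open_points(2)[OF V']], rule D.B.vreg_scale)
        fix J assume J: "J \<in> multi_exps r j"
        show "reg (tuple_atlas r) V' (\<lambda>z. c J J' (norm_mat S z))"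
          by (rule reg_mat_poly[OF c(1)[OF J, of J'] VY, of "norm_mat S"])
            (rule reg_norm_mat[OF S VY VS]; assumption)
        show "D.B.vreg V' (\<lambda>z. f J (quot r z))"
          using U'(4) J by (intro D.vreg_pullback[OF D.q, of U' "f J"]) (auto simp: V'_def)
      qed
      moreover have "restr (D.pre U) (\<lambda>y. t (quot r y)) z = (\<Sum>J\<in>multi_exps r j. mon r z J (f' J z))"
        if z: "z \<in> V'" for z
      proof -
        have zY: "z \<in> tilde r X" "quot r z \<in> U'" using z by (auto simp: V'_def)
        have "restr (D.pre U) (\<lambda>y. t (quot r y)) z = t (quot r z)"
          using zY U'(3) by (auto simp: restr_def)
        also have "\<dots> = (\<Sum>J\<in>multi_exps r j. mon r (chart_frame r S (quot r z)) J (f J (quot r z)))"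
          by (rule bspec[OF U'(5) zY(2)])
        also have "\<dots> = (\<Sum>J\<in>multi_exps r j. \<Sum>J'\<in>multi_exps r j.
            sM (c J J' (norm_mat S z)) (mon r z J' (f J (quot r z))))"
          using c(2)[OF _ tilde_commuting[OF zY(1)], of _ "norm_mat S z"]
          by (intro sum.cong refl) (simp only: tmul_norm_mat[OF S zY(1) VS[OF z]])
        also have "\<dots> = (\<Sum>J'\<in>multi_exps r j. \<Sum>J\<in>multi_exps r j.
            sM (c J J' (norm_mat S z)) (mon r z J' (f J (quot r z))))" by (rule sum.swap)
        also have "\<dots> = (\<Sum>J'\<in>multi_exps r j. mon r z J' (f' J' z))"
          by (simp add: f'_def mon_sum mon_scale)
        finally show ?thesis .
      qed
      ultimately show "\<exists>V'. openY V' \<and> y \<in> V' \<and> V' \<subseteq> D.pre U \<and> (\<exists>f. (\<forall>J\<in>multi_exps r j. D.B.vreg V' (f J)) \<and>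
        (\<forall>z\<in>V'. restr (D.pre U) (\<lambda>y. t (quot r y)) z = (\<Sum>J\<in>multi_exps r j. mon r z J (f J z))))"
        using V' y U'(2,3) by (intro exI[of _ V'] conjI exI[of _ f'] ballI) (auto simp: V'_def)
    qed
  qed
  then show ?thesis unfolding D.desc_iff[OF U(1)] by blast
qed

lemma chart_mon_vreg:
  assumes "index_set S" "U \<subseteq> X" "U \<subseteq> chart r S" "D.A.vreg U t"
  shows "D.A.vreg U (\<lambda>L. mon r (chart_frame r S L) J (t L))"
proof (rule mon_vreg)
  show "vector_atlas (Grass_atlas r) sM M_basis" by unfold_locales
  show "U \<subseteq> points (Grass_atlas r)" using assms(2) X_Grass points_Grass by blast
  show "reg (Grass_atlas r) U (\<lambda>L. coord i (chart_frame r S L s))" if "i \<in> {1..n}" "s \<in> {1..r}" for i s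
    by (rule reg_chart_frame[OF assms(1,3) that])
qed (rule assms(4))

text \<open>On a chart, the image sheaf is generated by the images of the constant sections.\<close>

definition gen_section :: "nat set \<Rightarrow> (nat \<Rightarrow> nat) \<times> 'm \<Rightarrow> 'g set \<Rightarrow> 'm" where
  "gen_section S Jb = restr (X \<inter> chart r S) (\<lambda>L. mon r (chart_frame r S L) (fst Jb) (snd Jb))"

lemma gen_section_in:
  assumes S: "index_set S" and J: "fst Jb \<in> multi_exps r j"
  shows "gen_section S Jb \<in> D.desc (Im_tilde j) (X \<inter> chart r S)"
proof -
  let ?U = "X \<inter> chart r S"
  note U = chart_open[OF S]
  have UP: "?U \<subseteq> points (Grass_atlas r)" by (rule D.open_points(1)[OF U])
  have "section_form S j ?U (gen_section S Jb)"
  proof (intro exI[of _ "\<lambda>J L. if J = fst Jb then snd Jb else 0"] conjI ballI)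
    show "D.A.vreg ?U (\<lambda>L. if J = fst Jb then snd Jb else 0)" for J by (rule D.A.vreg_const[OF UP])
    fix L assume L: "L \<in> ?U"
    have "(\<Sum>J\<in>multi_exps r j. mon r (chart_frame r S L) J (if J = fst Jb then snd Jb else 0)) =
        (\<Sum>J\<in>multi_exps r j. if J = fst Jb then mon r (chart_frame r S L) J (snd Jb) else 0)"
      by (rule sum.cong) (auto simp: mon_zero)
    then show "gen_section S Jb L = (\<Sum>J\<in>multi_exps r j. mon r (chart_frame r S L) J (if J = fst Jb then snd Jb else 0))"
      using L J finite_multi_exps[of r j] by (simp add: gen_section_def restr_def)
  qed
  moreover have "D.A.vreg ?U (gen_section S Jb)"
    unfolding gen_section_def D.A.vreg_restr
    by (rule chart_mon_vreg[OF S]) (auto intro: D.A.vreg_const[OF UP])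
  ultimately show ?thesis
    using U unfolding desc_Im_chart[OF S U Int_lower2]
    by (intro conjI ballI exI[of _ ?U]) (simp_all add: gen_section_def restr_def)
qed

lemma index_enum:
  obtains N :: nat and h where "bij_betw h {..<N} (multi_exps r j \<times> M_basis)"
proof -
  have "finite (multi_exps r j \<times> M_basis)" using finite_multi_exps M.finite_Basis by blast
  then obtain h where "bij_betw h {0..<card (multi_exps r j \<times> M_basis)} (multi_exps r j \<times> M_basis)"
    using ex_bij_betw_nat_finite by blast
  then show ?thesis using that[of h "card (multi_exps r j \<times> M_basis)"] by (simp add: lessThan_atLeast0)
qed

lemma finite_type_Im: "finite_type sM (Grass_atlas r) X (D.desc (Im_tilde j))"
  unfolding finite_type_def
proof
  fix L0 assume "L0 \<in> X"
  then obtain S where S: "index_set S" "L0 \<in> chart r S" by (rule X_chart)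
  let ?U = "X \<inter> chart r S"
  note U = chart_open[OF S(1)]
  obtain N :: nat and h where h: "bij_betw h {..<N} (multi_exps r j \<times> M_basis)" by (rule index_enum)
  have h_in: "fst (h i) \<in> multi_exps r j" if "i < N" for i
    using bij_betwE[OF h] that by (simp add: mem_Times_iff)
  have cover: "\<exists>V' a. openX V' \<and> L \<in> V' \<and> V' \<subseteq> V \<and> (\<forall>i<N. a i \<in> regular_funs (Grass_atlas r) V') \<and>
      restr V' t = (\<lambda>z. \<Sum>i<N. sM (a i z) (gen_section S (h i) z))"
    if V: "openX V" "V \<subseteq> ?U" and t: "t \<in> D.desc (Im_tilde j) V" and L: "L \<in> V" for V t L
  proof -
    have VS: "V \<subseteq> chart r S" using V(2) by blast
    obtain V' f where V': "openX V'" "L \<in> V'" "V' \<subseteq> V" "\<forall>J\<in>multi_exps r j. D.A.vreg V' (f J)"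
      "\<forall>L\<in>V'. t L = (\<Sum>J\<in>multi_exps r j. mon r (chart_frame r S L) J (f J L))"
      using t L unfolding desc_Im_chart[OF S(1) V(1) VS] by blast
    define a where "a i = restr V' (\<lambda>z. M.bcoord (snd (h i)) (f (fst (h i)) z))" for i
    have "a i \<in> regular_funs (Grass_atlas r) V'" if "i < N" for i
      unfolding a_def D.A.restr_regular_funs
      using V'(4) bij_betwE[OF h] that by (auto simp: D.A.vreg_def mem_Times_iff)
    moreover have "restr V' t z = (\<Sum>i<N. sM (a i z) (gen_section S (h i) z))" for z
    proof (cases "z \<in> V'")
      case True
      have zU: "z \<in> ?U" using True V'(3) V(2) by blast
      have "t z = (\<Sum>J\<in>multi_exps r j. mon r (chart_frame r S z) J (\<Sum>b\<in>M_basis. sM (M.bcoord b (f J z)) b))"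
        using bspec[OF V'(5) True] by (simp only: M.bcoord_expand)
      also have "\<dots> = (\<Sum>J\<in>multi_exps r j. \<Sum>b\<in>M_basis. sM (M.bcoord b (f J z)) (mon r (chart_frame r S z) J b))"
        by (simp only: mon_sum mon_scale)
      also have "\<dots> = (\<Sum>Jb\<in>multi_exps r j \<times> M_basis.
          sM (M.bcoord (snd Jb) (f (fst Jb) z)) (mon r (chart_frame r S z) (fst Jb) (snd Jb)))"
        by (simp add: sum.cartesian_product case_prod_unfold)
      also have "\<dots> = (\<Sum>i<N. sM (M.bcoord (snd (h i)) (f (fst (h i)) z))
          (mon r (chart_frame r S z) (fst (h i)) (snd (h i))))"
        by (rule sum.reindex_bij_betw[OF h, symmetric])
      finally show ?thesis using True zU by (simp add: restr_def a_def gen_section_def)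
    qed (simp add: restr_def a_def)
    ultimately show ?thesis using V'(1-3) by (intro exI[of _ V'] exI[of _ a] conjI ext) simp_all
  qed
  show "\<exists>U. openX U \<and> L0 \<in> U \<and>
        (\<exists>(N::nat) s. (\<forall>i<N. s i \<in> D.desc (Im_tilde j) U) \<and>
           (\<forall>V t. openX V \<and> V \<subseteq> U \<and> t \<in> D.desc (Im_tilde j) V \<longrightarrow>
              (\<forall>y\<in>V. \<exists>V' a. openX V' \<and> y \<in> V' \<and> V' \<subseteq> V \<and>
                 (\<forall>i<N. a i \<in> regular_funs (Grass_atlas r) V') \<and>
                 restr V' t = (\<lambda>z. \<Sum>i<N. sM (a i z) (s i z)))))"
  proof (intro exI conjI)
    show "L0 \<in> ?U" using \<open>L0 \<in> X\<close> S(2) by blast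
    show "\<forall>i<N. gen_section S (h i) \<in> D.desc (Im_tilde j) ?U"
      using gen_section_in[OF S(1) h_in] by blast
    show "\<forall>V t. openX V \<and> V \<subseteq> ?U \<and> t \<in> D.desc (Im_tilde j) V \<longrightarrow>
              (\<forall>y\<in>V. \<exists>V' a. openX V' \<and> y \<in> V' \<and> V' \<subseteq> V \<and>
                 (\<forall>i<N. a i \<in> regular_funs (Grass_atlas r) V') \<and>
                 restr V' t = (\<lambda>z. \<Sum>i<N. sM (a i z) (gen_section S (h i) z)))"
      by (intro allI impI ballI) (elim conjE, rule cover)
  qed (rule U)
qed

text \<open>
  Over a chart, every section of the image sheaf on the torsor is a combination of pull-backs of the
  generators: expand the monomials in \<open>T\<close> into monomials in the normalised basis.
\<close>

lemma Im_tilde_generated: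
  assumes V: "openY V" and t: "t \<in> Im_tilde j V" and y: "y \<in> V"
  shows "\<exists>V' U (N::nat) a s. openY V' \<and> y \<in> V' \<and> V' \<subseteq> V \<and> openX U \<and> quot r ` V' \<subseteq> U \<and>
      (\<forall>i<N. reg (tuple_atlas r) V' (a i) \<and> s i \<in> D.desc (Im_tilde j) U) \<and>
      (\<forall>z\<in>V'. t z = (\<Sum>i<N. sM (a i z) (s i (quot r z))))"
proof -
  have yY: "y \<in> tilde r X" using zar_on_subset[OF V] y by blast
  obtain S where S: "index_set S" "quot r y \<in> chart r S" using X_chart[OF quot_in[OF yY]] .
  let ?U = "X \<inter> chart r S"
  note U = chart_open[OF S(1)]
  obtain V1 f where V1: "openY V1" "y \<in> V1" "V1 \<subseteq> V" "\<forall>J\<in>multi_exps r j. D.B.vreg V1 (f J)"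
    "\<forall>z\<in>V1. t z = (\<Sum>J\<in>multi_exps r j. mon r z J (f J z))"
    using t y unfolding Im_tilde_iff[OF V] by blast
  define V' where "V' = V1 \<inter> D.pre ?U"
  have V': "openY V'" unfolding V'_def by (intro openin_Int V1(1) D.pre_open U)
  have VY: "V' \<subseteq> tilde r X" and VS: "\<And>z. z \<in> V' \<Longrightarrow> quot r z \<in> chart r S" by (auto simp: V'_def)
  obtain N :: nat and h where h: "bij_betw h {..<N} (multi_exps r j \<times> M_basis)" by (rule index_enum)
  have h_in: "fst (h i) \<in> multi_exps r j" if "i < N" for i
    using bij_betwE[OF h] that by (simp add: mem_Times_iff)
  obtain c where c: "\<And>J J'. J \<in> multi_exps r j \<Longrightarrow> c J J' \<in> poly_funs (mat_coords r)"
    "\<And>J T g v. J \<in> multi_exps r j \<Longrightarrow> commuting r T \<Longrightarrow>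
      mon r (tmul r T g) J v = (\<Sum>J'\<in>multi_exps r j. sM (c J J' g) (mon r T J' v))"
    by (rule mon_tmul_family[of j]) (rule that; assumption)
  define a where "a i z = (\<Sum>J\<in>multi_exps r j. M.bcoord (snd (h i)) (f J z) * c J (fst (h i)) (minor S z))" for i z
  have a: "reg (tuple_atlas r) V' (a i)" if "i < N" for i
    unfolding a_def
  proof (rule D.B.reg_sum[OF D.open_points(2)[OF V']], rule D.B.reg_mult)
    fix J assume J: "J \<in> multi_exps r j"
    show "reg (tuple_atlas r) V' (\<lambda>z. M.bcoord (snd (h i)) (f J z))"
    proof (rule reg_mono)
      show "reg (tuple_atlas r) V1 (\<lambda>z. M.bcoord (snd (h i)) (f J z))"
        using V1(4) J bij_betwE[OF h] \<open>i < N\<close> by (simp add: D.B.vreg_def mem_Times_iff)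
    qed (simp add: V'_def)
    show "reg (tuple_atlas r) V' (\<lambda>z. c J (fst (h i)) (minor S z))"
      by (rule reg_mat_poly[OF c(1)[OF J, of "fst (h i)"] VY, of "minor S"])
        (rule reg_minor[OF S(1) VY]; assumption)
  qed
  have "t z = (\<Sum>i<N. sM (a i z) (gen_section S (h i) (quot r z)))" if z: "z \<in> V'" for z
  proof -
    have zY: "z \<in> tilde r X" "z \<in> V1" "quot r z \<in> ?U" using z by (auto simp: V'_def)
    let ?\<sigma> = "chart_frame r S (quot r z)"
    have comm: "commuting r ?\<sigma>" using chart_frame_commuting[OF S(1)] zY(3) by blast
    have mon: "mon r z J v = (\<Sum>J'\<in>multi_exps r j. sM (c J J' (minor S z)) (mon r ?\<sigma> J' v))"
      if "J \<in> multi_exps r j" for J v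
      using c(2)[OF that comm, of "minor S z" v] by (simp only: tilde_tmul[OF S(1) zY(1) VS[OF z]])
    have "t z = (\<Sum>J\<in>multi_exps r j. mon r z J (\<Sum>b\<in>M_basis. sM (M.bcoord b (f J z)) b))"
      using bspec[OF V1(5) zY(2)] by (simp only: M.bcoord_expand)
    also have "\<dots> = (\<Sum>J\<in>multi_exps r j. \<Sum>b\<in>M_basis. sM (M.bcoord b (f J z)) (mon r z J b))"
      by (simp only: mon_sum mon_scale)
    also have "\<dots> = (\<Sum>J\<in>multi_exps r j. \<Sum>b\<in>M_basis. \<Sum>J'\<in>multi_exps r j.
        sM (M.bcoord b (f J z) * c J J' (minor S z)) (mon r ?\<sigma> J' b))"
      by (intro sum.cong refl) (simp add: mon M.scale_sum_right)
    also have "\<dots> = (\<Sum>J\<in>multi_exps r j. \<Sum>J'\<in>multi_exps r j. \<Sum>b\<in>M_basis.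
        sM (M.bcoord b (f J z) * c J J' (minor S z)) (mon r ?\<sigma> J' b))"
      by (intro sum.cong refl) (rule sum.swap)
    also have "\<dots> = (\<Sum>J\<in>multi_exps r j. \<Sum>Jb\<in>multi_exps r j \<times> M_basis.
        sM (M.bcoord (snd Jb) (f J z) * c J (fst Jb) (minor S z)) (mon r ?\<sigma> (fst Jb) (snd Jb)))"
      by (simp add: sum.cartesian_product case_prod_unfold)
    also have "\<dots> = (\<Sum>Jb\<in>multi_exps r j \<times> M_basis. \<Sum>J\<in>multi_exps r j.
        sM (M.bcoord (snd Jb) (f J z) * c J (fst Jb) (minor S z)) (mon r ?\<sigma> (fst Jb) (snd Jb)))"
      by (rule sum.swap)
    also have "\<dots> = (\<Sum>i<N. \<Sum>J\<in>multi_exps r j.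
        sM (M.bcoord (snd (h i)) (f J z) * c J (fst (h i)) (minor S z)) (mon r ?\<sigma> (fst (h i)) (snd (h i))))"
      by (rule sum.reindex_bij_betw[OF h, symmetric])
    also have "\<dots> = (\<Sum>i<N. sM (a i z) (gen_section S (h i) (quot r z)))"
      using zY(3) by (simp add: a_def gen_section_def restr_def M.scale_sum_left)
    finally show ?thesis .
  qed
  then show ?thesis
    using V' y V1(2,3) U yY quot_in[OF yY] S(2) a gen_section_in[OF S(1) h_in]
    by (intro exI[of _ V'] exI[of _ ?U] exI[of _ N] exI[of _ a] exI[of _ "\<lambda>i. gen_section S (h i)"] conjI allI impI ballI)
      (auto simp: V'_def)
qed

lemma Im_descent_eq: "Im_descent r j X = D.desc (Im_tilde j)"
  unfolding Im_descent_def
  by (rule D.descend_eq_desc[OF Im_tilde_submodule finite_type_Im Im_tilde_generated])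

end


section \<open>Interpolation\<close>

text \<open>
  Polynomial functions in a finite set \<open>E\<close> can be recovered on \<open>Z\<close> from their values at finitely many
  points of \<open>Z\<close>, with coefficients that do not depend on the function. Functions are added to \<open>E\<close> one
  by one. If the formula at hand fails for the new function, then it fails at some point, which is added
  to the points; the error, divided by its value there, is the new coefficient.
\<close>

lemma poly_interpolation:
  fixes C :: "('z \<Rightarrow> 'k::field) set"
  assumes "finite E" "E \<subseteq> poly_funs C"
  shows "\<exists>(K::nat) p b. (\<forall>l<K. p l \<in> Z \<and> b l \<in> poly_funs C) \<and>
    (\<forall>e\<in>E. \<forall>g\<in>Z. e g = (\<Sum>l<K. b l g * e (p l)))"
  using assms
proof (induction E)
  case empty
  show ?case by (intro exI[of _ 0]) simp
next
  case (insert d E)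
  then obtain K :: nat and p b where pb: "\<forall>l<K. p l \<in> Z \<and> b l \<in> poly_funs C"
    and E: "\<forall>e\<in>E. \<forall>g\<in>Z. e g = (\<Sum>l<K. b l g * e (p l))" by auto
  define err where "err = (\<lambda>g. d g - (\<Sum>l<K. b l g * d (p l)))"
  show ?case
  proof (cases "\<forall>g\<in>Z. err g = 0")
    case True
    then have "\<forall>e\<in>insert d E. \<forall>g\<in>Z. e g = (\<Sum>l<K. b l g * e (p l))" using E by (simp add: err_def)
    with pb show ?thesis by (intro exI[of _ K] exI[of _ p] exI[of _ b] conjI)
  next
    case False
    then obtain g0 where g0: "g0 \<in> Z" "err g0 \<noteq> 0" by blast
    have "(\<lambda>g. \<Sum>l<K. b l g * d (p l)) \<in> poly_funs C"
      using pb by (intro poly_funs_sum poly_funs.mult poly_funs.const) auto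
    then have "(\<lambda>g. (d g + - (\<Sum>l<K. b l g * d (p l))) * inverse (err g0)) \<in> poly_funs C"
      using insert.prems
      by (intro poly_funs.mult poly_funs.add poly_funs_minus poly_funs.const) auto
    then have bs: "(\<lambda>g. err g / err g0) \<in> poly_funs C"
      by (simp add: err_def divide_inverse)
    \<comment> \<open>the last coefficient makes up for the error; the others are corrected so that the functions in \<open>E\<close> keep their values\<close>
    define b' where "b' l = (if l < K then (\<lambda>g. b l g + - (b l g0 * (err g / err g0))) else (\<lambda>g. err g / err g0))" for l
    define p' where "p' l = (if l < K then p l else g0)" for l
    have "b' l \<in> poly_funs C" if "l < Suc K" for l
    proof (cases "l < K")
      case True
      then have "(\<lambda>g. b l g + - (b l g0 * (err g / err g0))) \<in> poly_funs C"
        using pb bs by (intro poly_funs.add poly_funs_minus poly_funs.mult poly_funs.const) simp_all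
      then show ?thesis by (simp only: b'_def True if_True)
    next
      case False
      then show ?thesis by (simp only: b'_def if_False bs)
    qed
    moreover have "p' l \<in> Z" if "l < Suc K" for l using pb g0 by (auto simp: p'_def)
    moreover have "e g = (\<Sum>l<Suc K. b' l g * e (p' l))" if e: "e \<in> insert d E" and g: "g \<in> Z" for e g
    proof -
      have "(\<Sum>l<Suc K. b' l g * e (p' l)) =
          (\<Sum>l<K. b l g * e (p l)) + err g / err g0 * (e g0 - (\<Sum>l<K. b l g0 * e (p l)))"
        by (simp add: b'_def p'_def algebra_simps sum_subtractf sum_distrib_left)
      also have "\<dots> = e g"
      proof (cases "e = d")
        case True
        have "e g0 - (\<Sum>l<K. b l g0 * e (p l)) = err g0" using True by (simp add: err_def)
        then show ?thesis using g0(2) True by (simp add: err_def)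
      next
        case False
        then have "e \<in> E" using e by simp
        then have "e g = (\<Sum>l<K. b l g * e (p l))" "e g0 = (\<Sum>l<K. b l g0 * e (p l))"
          using E g g0(1) by blast+
        then show ?thesis by simp
      qed
      finally show ?thesis by (rule sym)
    qed
    ultimately show ?thesis by (intro exI[of _ "Suc K"] exI[of _ p'] exI[of _ b']) simp
  qed
qed

lemma sum_list_product:
  fixes F H :: "'a \<Rightarrow> 'k::comm_ring_1"
  shows "(\<Sum>pq\<leftarrow>List.product xs ys. F (fst pq) * H (snd pq)) = sum_list (map F xs) * sum_list (map H ys)"
  by (induction xs) (simp_all add: comp_def sum_list_const_mult distrib_right)

context restricted_module
begin

lemma poly_tmul_separate:
  assumes "P \<in> poly_funs (tuple_coords r)"
  shows "\<exists>xs. (\<forall>ue\<in>set xs. snd ue \<in> poly_funs (mat_coords r)) \<and>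
    (\<forall>T g. P (tmul r T g) = (\<Sum>ue\<leftarrow>xs. fst ue T * snd ue g))"
  using assms
proof induction
  case (const c)
  show ?case by (intro exI[of _ "[(\<lambda>_. c, \<lambda>_. 1)]"]) (simp add: poly_funs.const)
next
  case (coord f)
  then obtain i s where f: "f = tuple_coord i s" "i \<in> {1..n}" "s \<in> {1..r}" by (auto simp: tuple_coords_def)
  have "tuple_coord i s (tmul r T g) = (\<Sum>t\<leftarrow>[1..<Suc r]. coord i (T t) * g t s)" for T g
    using f(3) by (simp add: tuple_coord_def coord_tmul sum_list_distinct_conv_sum_set
        atLeastLessThanSuc_atLeastAtMost del: upt_Suc)
  then show ?case using f
    by (intro exI[of _ "map (\<lambda>t. (\<lambda>T. coord i (T t), \<lambda>g. g t s)) [1..<Suc r]"])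
      (auto simp: comp_def intro: mat_coord_poly simp del: upt_Suc)
next
  case (add f h)
  then obtain xs ys where "\<forall>ue\<in>set xs. snd ue \<in> poly_funs (mat_coords r)"
    "\<forall>T g. f (tmul r T g) = (\<Sum>ue\<leftarrow>xs. fst ue T * snd ue g)"
    "\<forall>ue\<in>set ys. snd ue \<in> poly_funs (mat_coords r)"
    "\<forall>T g. h (tmul r T g) = (\<Sum>ue\<leftarrow>ys. fst ue T * snd ue g)" by blast
  then show ?case by (intro exI[of _ "xs @ ys"]) auto
next
  case (mult f h)
  then obtain xs ys where *: "\<forall>ue\<in>set xs. snd ue \<in> poly_funs (mat_coords r)"
    "\<forall>T g. f (tmul r T g) = (\<Sum>ue\<leftarrow>xs. fst ue T * snd ue g)"
    "\<forall>ue\<in>set ys. snd ue \<in> poly_funs (mat_coords r)"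
    "\<forall>T g. h (tmul r T g) = (\<Sum>ue\<leftarrow>ys. fst ue T * snd ue g)" by blast
  let ?m = "\<lambda>pq. (\<lambda>T. fst (fst pq) T * fst (snd pq) T, \<lambda>g. snd (fst pq) g * snd (snd pq) g)"
  have "f (tmul r T g) * h (tmul r T g) =
      (\<Sum>pq\<leftarrow>List.product xs ys. (fst (fst pq) T * snd (fst pq) g) * (fst (snd pq) T * snd (snd pq) g))" for T g
    unfolding *(2)[rule_format] *(4)[rule_format]
    by (rule sum_list_product[symmetric, where F = "\<lambda>ue. fst ue T * snd ue g" and H = "\<lambda>ue. fst ue T * snd ue g"])
  then have "f (tmul r T g) * h (tmul r T g) = (\<Sum>ue\<leftarrow>map ?m (List.product xs ys). fst ue T * snd ue g)" for T g
    by (simp add: comp_def mult_ac)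
  moreover have "\<forall>ue\<in>set (map ?m (List.product xs ys)). snd ue \<in> poly_funs (mat_coords r)"
    using *(1,3) by (auto intro!: poly_funs.mult)
  ultimately show ?case by (intro exI[of _ "map ?m (List.product xs ys)"] conjI allI)
qed

text \<open>
  Interpolate the finitely many functions of \<open>g\<close> that occur when the variables are separated.
\<close>

lemma tmul_interpolation:
  assumes "finite I" "\<And>i. i \<in> I \<Longrightarrow> P i \<in> poly_funs (tuple_coords r)"
  obtains K :: nat and p b where "\<And>l. l < K \<Longrightarrow> p l \<in> Z" "\<And>l. l < K \<Longrightarrow> b l \<in> poly_funs (mat_coords r)"
    "\<And>i T g. i \<in> I \<Longrightarrow> g \<in> Z \<Longrightarrow> P i (tmul r T g) = (\<Sum>l<K. b l g * P i (tmul r T (p l)))"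
proof -
  have "\<forall>i\<in>I. \<exists>xs. (\<forall>ue\<in>set xs. snd ue \<in> poly_funs (mat_coords r)) \<and>
    (\<forall>T g. P i (tmul r T g) = (\<Sum>ue\<leftarrow>xs. fst ue T * snd ue g))"
    using poly_tmul_separate assms(2) by blast
  then obtain xs where xs: "\<forall>i\<in>I. (\<forall>ue\<in>set (xs i). snd ue \<in> poly_funs (mat_coords r)) \<and>
    (\<forall>T g. P i (tmul r T g) = (\<Sum>ue\<leftarrow>xs i. fst ue T * snd ue g))"
    by (rule bchoice[THEN exE])
  define E where "E = (\<Union>i\<in>I. snd ` set (xs i))"
  have "finite E" "E \<subseteq> poly_funs (mat_coords r)" using assms(1) xs by (auto simp: E_def)
  then obtain K :: nat and p b where pb: "\<forall>l<K. p l \<in> Z \<and> b l \<in> poly_funs (mat_coords r)"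
    and E: "\<forall>e\<in>E. \<forall>g\<in>Z. e g = (\<Sum>l<K. b l g * e (p l))"
    using poly_interpolation[of E "mat_coords r" Z] by blast
  show ?thesis
  proof (rule that[of K p b])
    fix i T g assume i: "i \<in> I" and g: "g \<in> Z"
    have P: "P i (tmul r T g) = (\<Sum>ue\<leftarrow>xs i. fst ue T * snd ue g)" for g using bspec[OF xs i] by simp
    have sub: "set zs \<subseteq> set (xs i) \<Longrightarrow>
      (\<Sum>ue\<leftarrow>zs. fst ue T * snd ue g) = (\<Sum>l<K. b l g * (\<Sum>ue\<leftarrow>zs. fst ue T * snd ue (p l)))" for zs
    proof (induction zs)
      case (Cons ue zs)
      have "snd ue \<in> E" using Cons.prems i by (auto simp: E_def)
      then have "snd ue g = (\<Sum>l<K. b l g * snd ue (p l))" using E g by blast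
      then show ?case using Cons by (simp add: distrib_left sum.distrib sum_distrib_left mult.left_commute)
    qed simp
    show "P i (tmul r T g) = (\<Sum>l<K. b l g * P i (tmul r T (p l)))" unfolding P by (rule sub) simp
  qed (use pb in simp_all)
qed

end


section \<open>The kernel sheaf descends\<close>

context elementary_family
begin

text \<open>
  All bases of \<open>L\<close> are considered at once, which gives a description of the sheaf without charts.
\<close>

definition ker_fibre :: "nat \<Rightarrow> 'g set \<Rightarrow> 'm set" where
  "ker_fibre j L = {v. \<forall>z\<in>tilde r X. quot r z = L \<longrightarrow> (\<forall>J\<in>multi_exps r j. mon r z J v = 0)}"

lemma ker_fibre_chart:
  assumes "index_set S" "L \<in> X" "L \<in> chart r S"
  shows "v \<in> ker_fibre j L \<longleftrightarrow> (\<forall>J\<in>multi_exps r j. mon r (chart_frame r S L) J v = 0)"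
  using chart_frame_tilde[OF assms] mon_kernel_eq[OF assms(1), of _ j v] assms(3)
  unfolding ker_fibre_def by blast

lemma desc_Ker_iff:
  assumes U: "openX U"
  shows "t \<in> D.desc (Ker_tilde j) U \<longleftrightarrow>
    (\<forall>L. L \<notin> U \<longrightarrow> t L = 0) \<and> D.A.vreg U t \<and> (\<forall>L\<in>U. t L \<in> ker_fibre j L)"
proof -
  have "restr (D.pre U) (\<lambda>y. t (quot r y)) \<in> Ker_tilde j (D.pre U) \<longleftrightarrow> (\<forall>L\<in>U. t L \<in> ker_fibre j L)"
    if reg: "D.A.vreg U t"
  proof -
    have "D.B.vreg (D.pre U) (\<lambda>y. t (quot r y))" by (rule D.vreg_pullback[OF D.q reg]) auto
    then show ?thesis
      unfolding Ker_tilde_iff[OF D.pre_open[OF U]] D.B.vreg_restr ker_fibre_def by (auto simp: restr_def)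
  qed
  then show ?thesis unfolding D.desc_iff[OF U] by blast
qed

lemma finite_type_Ker: "finite_type sM (Grass_atlas r) X (D.desc (Ker_tilde j))"
proof -
  obtain h where h: "bij_betw h {0..<card M_basis} M_basis"
    using ex_bij_betw_nat_finite[OF M.finite_Basis] by blast
  define N where "N = card M_basis"
  have h: "bij_betw h {..<N} M_basis" using h by (simp add: N_def lessThan_atLeast0)
  show ?thesis
  proof (rule D.A.finite_type_pointwise[of sM X _ N h "ker_fibre j"])
    show "vector_space sM" by unfold_locales
    show "X \<subseteq> points (Grass_atlas r)" using X_Grass points_Grass by simp
    fix V t assume V: "openX V"
    have "D.A.vreg V t \<longleftrightarrow> (\<exists>a. (\<forall>i<N. reg (Grass_atlas r) V (a i)) \<and> (\<forall>L\<in>V. t L = (\<Sum>i<N. sM (a i L) (h i))))"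
      (is "?l \<longleftrightarrow> ?r")
    proof
      assume l: ?l
      have "t L = (\<Sum>i<N. sM (M.bcoord (h i) (t L)) (h i))" for L
        using sum.reindex_bij_betw[OF h, of "\<lambda>b. sM (M.bcoord b (t L)) b"] by (simp add: M.bcoord_expand)
      then show ?r
        using l bij_betwE[OF h]
        by (intro exI[of _ "\<lambda>i L. M.bcoord (h i) (t L)"]) (auto simp: D.A.vreg_def)
    next
      assume ?r
      then obtain a where a: "\<forall>i<N. reg (Grass_atlas r) V (a i)" "\<forall>L\<in>V. t L = (\<Sum>i<N. sM (a i L) (h i))"
        by blast
      note VP = D.open_points(1)[OF V]
      have "D.A.vreg V (\<lambda>L. \<Sum>i<N. sM (a i L) (h i))"
        using a(1) by (intro D.A.vreg_sum[OF VP] D.A.vreg_scale D.A.vreg_const[OF VP]) auto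
      then show ?l by (rule D.A.vreg_cong) (use a(2) in auto)
    qed
    then show "t \<in> D.desc (Ker_tilde j) V \<longleftrightarrow> (\<forall>L. L \<notin> V \<longrightarrow> t L = 0) \<and>
        (\<exists>a. (\<forall>i<N. reg (Grass_atlas r) V (a i)) \<and> (\<forall>L\<in>V. t L = (\<Sum>i<N. sM (a i L) (h i)))) \<and>
        (\<forall>L\<in>V. t L \<in> ker_fibre j L)"
      unfolding desc_Ker_iff[OF V] by simp
  qed (auto simp: ker_fibre_def mon_zero mon_add mon_scale)
qed

lemma tuple_expand:
  assumes "index_set S" "L \<in> X" "L \<in> chart r S" "mdet r g \<noteq> 0"
  shows "tmul r (chart_frame r S L) g \<in> tilde r X" "quot r (tmul r (chart_frame r S L) g) = L"
  using frame_tmul[of S r L g] assms by (auto simp: tilde_iff quot_def)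

text \<open>
  Write a section \<open>t\<close> of the kernel sheaf near \<open>y\<close> as \<open>p / Q\<close> with a polynomial \<open>p\<close>, and \<open>T\<close> as
  \<open>\<sigma> L \<cdot> g\<close>, where \<open>\<sigma> L\<close> is the normalised basis of \<open>L\<close>. Interpolation at points \<open>g\<^sub>l\<close> expresses
  \<open>p (\<sigma> L \<cdot> g)\<close> through the sections \<open>L \<mapsto> p (\<sigma> L \<cdot> g\<^sub>l)\<close>. For \<open>L\<close> near the image of \<open>y\<close> these lie in
  the kernel if the \<open>g\<^sub>l\<close> are taken from those \<open>g\<close> for which \<open>\<sigma> L \<cdot> g\<close> is in the domain of \<open>t\<close>
  already for \<open>L\<close> the image of \<open>y\<close>.
\<close>

lemma Ker_tilde_generated:
  assumes V: "openY V" and t: "t \<in> Ker_tilde j V" and y: "y \<in> V"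
  shows "\<exists>V' U (N::nat) a s. openY V' \<and> y \<in> V' \<and> V' \<subseteq> V \<and> openX U \<and> quot r ` V' \<subseteq> U \<and>
      (\<forall>i<N. reg (tuple_atlas r) V' (a i) \<and> s i \<in> D.desc (Ker_tilde j) U) \<and>
      (\<forall>z\<in>V'. t z = (\<Sum>i<N. sM (a i z) (s i (quot r z))))"
proof -
  have VY: "V \<subseteq> tilde r X" using zar_on_subset[OF V] .
  have yY: "y \<in> tilde r X" using VY y by blast
  have yT: "y \<in> tuple_space r" using yY tilde_tuple by blast
  define L0 where "L0 = quot r y"
  have L0X: "L0 \<in> X" using quot_in[OF yY] by (simp add: L0_def)
  obtain S where S: "index_set S" "L0 \<in> chart r S" using X_chart[OF L0X] .
  let ?U0 = "X \<inter> chart r S"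
  let ?\<sigma> = "chart_frame r S"
  note U0 = chart_open[OF S(1)]
  have tV: "D.B.vreg V t" and tK: "\<And>z J. z \<in> V \<Longrightarrow> J \<in> multi_exps r j \<Longrightarrow> mon r z J (t z) = 0"
    using t unfolding Ker_tilde_iff[OF V] by blast+
  obtain Q p where Q: "Q \<in> poly_funs (tuple_coords r)" "Q y \<noteq> 0"
    and p: "M.vpoly (tuple_coords r) p"
      "\<And>z. z \<in> V \<inter> tuple_space r \<Longrightarrow> Q z \<noteq> 0 \<Longrightarrow> sM (Q z) (t z) = p z"
  proof -
    obtain Q P where *: "Q \<in> poly_funs (tuple_coords r)" "Q y \<noteq> 0"
      "\<And>i. i \<in> {()} \<Longrightarrow> M.vpoly (tuple_coords r) (P i)"
      "\<And>i z. i \<in> {()} \<Longrightarrow> z \<in> V \<inter> tuple_space r \<Longrightarrow> Q z \<noteq> 0 \<Longrightarrow> sM (Q z) (t z) = P i z"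
      by (rule D.B.vreg_common_denominator[of "{()}" V "\<lambda>_. t", OF _ _ tuple_chart y yT])
        (use tV in \<open>auto\<close>)
    show ?thesis by (rule that[of Q "P ()"]) (use * in auto)
  qed
  define V1 where "V1 = V \<inter> {z \<in> tilde r X \<inter> tuple_space r. Q z \<noteq> 0}"
  have V1: "openY V1" unfolding V1_def by (intro openin_Int V D.B.basic_open[OF tuple_chart Q(1)])
  have yV1: "y \<in> V1" using y yY yT Q(2) by (simp add: V1_def)
  have V1Y: "V1 \<subseteq> tilde r X" by (auto simp: V1_def)
  have pt: "p z = sM (Q z) (t z)" if "z \<in> V1" for z using p(2)[of z] that by (auto simp: V1_def)
  have pK: "mon r z J (p z) = 0" if "z \<in> V1" "J \<in> multi_exps r j" for z J
    using pt[OF that(1)] tK[OF _ that(2), of z] that(1) by (simp add: mon_scale V1_def)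
  \<comment> \<open>the matrices \<open>g\<close> such that \<open>\<sigma> L0 \<cdot> g\<close> is in the domain \<open>V1\<close>\<close>
  define O' where "O' = minor S ` {z \<in> V1. quot r z = L0}"
  obtain K :: nat and g b where g: "\<And>l. l < K \<Longrightarrow> g l \<in> O'" and b: "\<And>l. l < K \<Longrightarrow> b l \<in> poly_funs (mat_coords r)"
    and interp: "\<And>c T h. c \<in> M_basis \<Longrightarrow> h \<in> O' \<Longrightarrow>
      M.bcoord c (p (tmul r T h)) = (\<Sum>l<K. b l h * M.bcoord c (p (tmul r T (g l))))"
  proof -
    have pc: "(\<lambda>z. M.bcoord c (p z)) \<in> poly_funs (tuple_coords r)" if "c \<in> M_basis" for c
      using p(1) that by (simp add: M.vpoly_def)
    note result = that
    show ?thesis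
    proof (rule tmul_interpolation[OF M.finite_Basis, of "\<lambda>c z. M.bcoord c (p z)" r O'])
      fix K :: nat and g b
      assume "\<And>l. l < K \<Longrightarrow> g l \<in> O'" "\<And>l. l < K \<Longrightarrow> b l \<in> poly_funs (mat_coords r)"
        "\<And>c T h. c \<in> M_basis \<Longrightarrow> h \<in> O' \<Longrightarrow>
          M.bcoord c (p (tmul r T h)) = (\<Sum>l<K. b l h * M.bcoord c (p (tmul r T (g l))))"
      then show ?thesis by (rule result)
    qed (rule pc)
  qed
  have gdet: "mdet r (g l) \<noteq> 0" and gV1: "tmul r (?\<sigma> L0) (g l) \<in> V1" if l: "l < K" for l
  proof -
    obtain z where z: "z \<in> V1" "quot r z = L0" "g l = minor S z" using g[OF l] by (auto simp: O'_def)
    have zY: "z \<in> tilde r X" using z(1) V1Y by blast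
    show "mdet r (g l) \<noteq> 0" using quot_chart_iff[OF S(1) zY] S(2) z(2,3) by simp
    show "tmul r (?\<sigma> L0) (g l) \<in> V1" using tilde_tmul[OF S(1) zY] S(2) z by simp
  qed
  have reg\<sigma>: "reg (Grass_atlas r) ?U0 (\<lambda>L. coord i (tmul r (?\<sigma> L) h s))" if "i \<in> {1..n}" "s \<in> {1..r}" for i s h
    unfolding coord_tmul[OF that(2)]
  proof (rule D.A.reg_sum[OF D.open_points(1)[OF U0]], rule D.A.reg_mult)
    fix u assume "u \<in> {1..r}"
    then show "reg (Grass_atlas r) ?U0 (\<lambda>L. coord i (?\<sigma> L u))"
      using that(1) by (intro reg_chart_frame[OF S(1)]) auto
  qed (rule D.A.reg_const[OF D.open_points(1)[OF U0]])
  have morph_g: "morph (tuple_atlas r) (tilde r X) (Grass_atlas r) ?U0 (\<lambda>L. tmul r (?\<sigma> L) (g l))" if "l < K" for l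
  proof (rule morph_tuple[OF nice_Grass])
    show "?U0 \<subseteq> points (Grass_atlas r)" by (rule D.open_points(1)[OF U0])
    show "(\<lambda>L. tmul r (?\<sigma> L) (g l)) ` ?U0 \<subseteq> tilde r X"
      using tuple_expand(1)[OF S(1) _ _ gdet[OF that]] by blast
  qed (rule tilde_tuple, rule reg\<sigma>)
  \<comment> \<open>over \<open>U\<close>, the interpolation points stay in the domain\<close>
  define U where "U = ?U0 \<inter> (\<Inter>l<K. {L \<in> ?U0. tmul r (?\<sigma> L) (g l) \<in> V1})"
  have U: "openX U"
  proof -
    have "openX {L \<in> ?U0. tmul r (?\<sigma> L) (g l) \<in> V1}" if "l < K" for l
      using D.BA.morph_open[OF morph_g[OF that] V1] zar_on_open_sub[OF U0] by blast
    then have "openX (?U0 \<inter> (\<Inter>l<k. {L \<in> ?U0. tmul r (?\<sigma> L) (g l) \<in> V1}))" if "k \<le> K" for k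
      using that
    proof (induction k)
      case (Suc k)
      have "openX ((?U0 \<inter> (\<Inter>l<k. {L \<in> ?U0. tmul r (?\<sigma> L) (g l) \<in> V1})) \<inter> {L \<in> ?U0. tmul r (?\<sigma> L) (g k) \<in> V1})"
        by (rule openin_Int) (use Suc in simp_all)
      also have "(?U0 \<inter> (\<Inter>l<k. {L \<in> ?U0. tmul r (?\<sigma> L) (g l) \<in> V1})) \<inter> {L \<in> ?U0. tmul r (?\<sigma> L) (g k) \<in> V1} =
          ?U0 \<inter> (\<Inter>l<Suc k. {L \<in> ?U0. tmul r (?\<sigma> L) (g l) \<in> V1})"
        by (auto simp: less_Suc_eq)
      finally show ?case .
    qed (simp add: U0)
    then show ?thesis by (simp add: U_def)
  qed
  have UU0: "U \<subseteq> ?U0" by (auto simp: U_def)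
  have UV1: "tmul r (?\<sigma> L) (g l) \<in> V1" if "L \<in> U" "l < K" for L l using that by (auto simp: U_def)
  have L0U: "L0 \<in> U" using L0X S(2) gV1 by (auto simp: U_def)
  define s where "s l = restr U (\<lambda>L. p (tmul r (?\<sigma> L) (g l)))" for l
  have s: "s l \<in> D.desc (Ker_tilde j) U" if l: "l < K" for l
    unfolding desc_Ker_iff[OF U]
  proof (intro conjI ballI)
    show "\<forall>L. L \<notin> U \<longrightarrow> s l L = 0" by (simp add: s_def restr_def)
    have "D.B.vreg (tilde r X) p"
      by (rule D.B.vreg_vpoly[OF p(1) tuple_chart]) (rule tilde_tuple)
    then have "D.A.vreg U (\<lambda>L. p (tmul r (?\<sigma> L) (g l)))"
      using UV1[OF _ l] V1Y UU0 by (intro D.vreg_section[OF morph_g[OF l], of "tilde r X" p]) auto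
    then show "D.A.vreg U (s l)" by (simp add: s_def D.A.vreg_restr)
    fix L assume L: "L \<in> U"
    have LS: "L \<in> X" "L \<in> chart r S" using L UU0 by auto
    let ?z = "tmul r (?\<sigma> L) (g l)"
    have z: "?z \<in> tilde r X" "quot r ?z = L" using tuple_expand[OF S(1) LS gdet[OF l]] by auto
    have "\<forall>J\<in>multi_exps r j. mon r ?z J (p ?z) = 0" using pK UV1[OF L l] by blast
    then have "\<forall>J\<in>multi_exps r j. mon r (?\<sigma> L) J (p ?z) = 0"
      using mon_kernel_eq[OF S(1) z(1), of j "p ?z"] z(2) LS(2) by simp
    then show "s l L \<in> ker_fibre j L" using L by (simp add: ker_fibre_chart[OF S(1) LS] s_def restr_def)
  qed
  define Y0 where "Y0 = D.pre ?U0"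
  have Y0: "openY Y0" unfolding Y0_def by (rule D.pre_open[OF U0])
  have Y0Y: "Y0 \<subseteq> tilde r X" by (auto simp: Y0_def)
  \<comment> \<open>the point over \<open>L0\<close> with the same matrix as \<open>z\<close>; \<open>\<tau> z\<close> in \<open>V1\<close> means that the matrix of \<open>z\<close> is in \<open>O'\<close>\<close>
  define \<tau> where "\<tau> z = tmul r (?\<sigma> L0) (minor S z)" for z
  have \<tau>det: "mdet r (minor S z) \<noteq> 0" if "z \<in> Y0" for z
    using quot_chart_iff[OF S(1), of z] that by (auto simp: Y0_def)
  have morph_\<tau>: "morph (tuple_atlas r) (tilde r X) (tuple_atlas r) Y0 \<tau>"
  proof (rule morph_tuple[OF nice_tuple])
    show "Y0 \<subseteq> points (tuple_atlas r)" by (rule D.open_points(2)[OF Y0])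
    show "\<tau> ` Y0 \<subseteq> tilde r X" using tuple_expand(1)[OF S(1) L0X S(2) \<tau>det] by (auto simp: \<tau>_def)
    show "reg (tuple_atlas r) Y0 (\<lambda>z. coord i (\<tau> z s))" if "i \<in> {1..n}" "s \<in> {1..r}" for i s
      unfolding \<tau>_def coord_tmul[OF that(2)]
    proof (rule D.B.reg_sum[OF D.open_points(2)[OF Y0]], rule D.B.reg_mult)
      show "reg (tuple_atlas r) Y0 (\<lambda>z. coord i (?\<sigma> L0 u))" for u
        by (rule D.B.reg_const[OF D.open_points(2)[OF Y0]])
      show "reg (tuple_atlas r) Y0 (\<lambda>z. minor S z u s)" if "u \<in> {1..r}" for u
        by (rule reg_minor[OF S(1) Y0Y that \<open>s \<in> {1..r}\<close>])
    qed
  qed (rule tilde_tuple)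
  interpret BB: atlas_pair "tuple_atlas r" "tuple_atlas r" by unfold_locales
  define V' where "V' = V1 \<inter> {z \<in> Y0. \<tau> z \<in> V1} \<inter> D.pre U"
  have V': "openY V'"
    unfolding V'_def
  proof (intro openin_Int V1 D.pre_open[OF U])
    show "openY {z \<in> Y0. \<tau> z \<in> V1}"
      using BB.morph_open[OF morph_\<tau> V1] zar_on_open_sub[OF Y0] by blast
  qed
  have yV': "y \<in> V'"
  proof -
    have "\<tau> y = y" using tilde_tmul[OF S(1) yY] S(2) by (simp add: \<tau>_def L0_def)
    then show ?thesis using yV1 yY L0X S(2) L0U by (simp add: V'_def Y0_def L0_def)
  qed
  define a where "a l = (\<lambda>z. b l (minor S z) / Q z)" for l
  have a: "reg (tuple_atlas r) V' (a l)" if "l < K" for l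
    unfolding a_def
  proof (rule D.B.reg_divide)
    have V'Y: "V' \<subseteq> tilde r X" using V1Y by (auto simp: V'_def)
    show "reg (tuple_atlas r) V' (\<lambda>z. b l (minor S z))"
      by (rule reg_mat_poly[OF b[OF that] V'Y, of "minor S"]) (rule reg_minor[OF S(1) V'Y]; assumption)
    show "reg (tuple_atlas r) V' Q" by (rule reg_tuple[OF Q(1) V'Y])
    show "Q z \<noteq> 0" if "z \<in> V'" for z using that by (auto simp: V'_def V1_def)
  qed
  have "t z = (\<Sum>l<K. sM (a l z) (s l (quot r z)))" if z: "z \<in> V'" for z
  proof -
    have zV: "z \<in> V1" "z \<in> Y0" "\<tau> z \<in> V1" "quot r z \<in> U" using z by (auto simp: V'_def)
    then have zY: "z \<in> tilde r X" "quot r z \<in> chart r S" "Q z \<noteq> 0" by (auto simp: Y0_def V1_def)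
    have "quot r (\<tau> z) = L0" unfolding \<tau>_def by (rule tuple_expand(2)[OF S(1) L0X S(2) \<tau>det[OF zV(2)]])
    moreover have "minor S (\<tau> z) t s = minor S z t s" if "t \<in> {1..r}" "s \<in> {1..r}" for t s
      unfolding \<tau>_def using S that by (intro minor_tmul) auto
    ultimately have "minor S (\<tau> z) \<in> O'" using zV(3) by (auto simp: O'_def)
    let ?m = "minor S (\<tau> z)"
    have tm: "tmul r T ?m = tmul r T (minor S z)" for T
      using \<open>\<And>t s. t \<in> {1..r} \<Longrightarrow> s \<in> {1..r} \<Longrightarrow> minor S (\<tau> z) t s = minor S z t s\<close>
      by (auto simp: tmul_def fun_eq_iff intro!: sum.cong)
    have bm: "b l ?m = b l (minor S z)" if "l < K" for l
    proof -
      have "f ?m = f (minor S z)" if "f \<in> poly_funs (mat_coords r)" for f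
        using that
        by induction (auto simp: mat_coords_def \<open>\<And>t s. t \<in> {1..r} \<Longrightarrow> s \<in> {1..r} \<Longrightarrow> minor S (\<tau> z) t s = minor S z t s\<close>)
      then show ?thesis using b[OF that] by blast
    qed
    have "tmul r (?\<sigma> (quot r z)) ?m = z" unfolding tm by (rule tilde_tmul[OF S(1) zY(1,2)])
    then have interp_z: "M.bcoord c (p z) = (\<Sum>l<K. b l ?m * M.bcoord c (p (tmul r (?\<sigma> (quot r z)) (g l))))"
      if "c \<in> M_basis" for c
      using interp[OF that \<open>?m \<in> O'\<close>, of "?\<sigma> (quot r z)"] by (simp only:)
    let ?w = "\<Sum>l<K. sM (b l (minor S z)) (s l (quot r z))"
    have eq: "M.bcoord c (p z) = M.bcoord c ?w" if "c \<in> M_basis" for c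
      unfolding interp_z[OF that] M.bcoord_sum M.bcoord_scale
      using zV(4) bm by (intro sum.cong refl) (simp add: s_def restr_def)
    have "p z = (\<Sum>c\<in>M_basis. sM (M.bcoord c (p z)) c)" by (simp only: M.bcoord_expand)
    also have "\<dots> = (\<Sum>c\<in>M_basis. sM (M.bcoord c ?w) c)"
      by (intro sum.cong refl) (simp only: eq)
    also have "\<dots> = ?w" by (rule M.bcoord_expand)
    finally have "p z = ?w" .
    moreover have "t z = sM (inverse (Q z)) (p z)" using pt[OF zV(1)] zY(3) by simp
    ultimately show ?thesis
      by (simp add: a_def M.scale_sum_right divide_inverse mult.commute)
  qed
  then show ?thesis
    using V' yV' U a s
    by (intro exI[of _ V'] exI[of _ U] exI[of _ K] exI[of _ a] exI[of _ s] conjI allI impI ballI)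
      (auto simp: V'_def V1_def)
qed

lemma Ker_descent_eq: "Ker_descent r j X = D.desc (Ker_tilde j)"
  unfolding Ker_descent_def
  by (rule D.descend_eq_desc[OF Ker_tilde_submodule finite_type_Ker Ker_tilde_generated])

end


section \<open>Comparison with the sheaves defined by charts\<close>

context elementary_family
begin

lemma op_chart:
  assumes "index_set S"
  shows "op_monomial (Theta (chart_fun r S Z)) r J f L = mon r (if L \<in> Z then chart_frame r S L else (\<lambda>_. 0)) J (f L)"
proof (rule op_monomial_Theta)
  fix s v assume s: "s \<in> {1..r}"
  show "(\<Sum>i=1..n. sM (chart_fun r S Z i s L) (act (x i) v)) = act ((if L \<in> Z then chart_frame r S L else (\<lambda>_. 0)) s) v"
    using s act_sum_left[of "\<lambda>i. chart_matrix r S L i s" x "{1..n}" v] act_scale_left[of 0 0 v]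
    by (simp add: chart_fun_def restr_def chart_frame_def)
qed

lemma section_form_vreg:
  assumes S: "index_set S" and U: "openX U" "U \<subseteq> chart r S" and t: "section_form S j U t"
  shows "D.A.vreg U t"
proof -
  note UP = D.open_points(1)[OF U(1)]
  obtain f where f: "\<forall>J\<in>multi_exps r j. D.A.vreg U (f J)"
    "\<forall>L\<in>U. t L = (\<Sum>J\<in>multi_exps r j. mon r (chart_frame r S L) J (f J L))" using t by blast
  have "D.A.vreg U (\<lambda>L. \<Sum>J\<in>multi_exps r j. mon r (chart_frame r S L) J (f J L))"
    by (rule D.A.vreg_sum[OF UP], rule chart_mon_vreg[OF S zar_on_subset[OF U(1)] U(2)]) (use f(1) in blast)
  then show ?thesis by (rule D.A.vreg_cong) (use f(2) in auto)
qed

context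
  fixes S :: "nat set" and W :: "'g set set"
  assumes S: "index_set S" and W: "openin (zar_on (Grass_atlas r) W) X"
begin

abbreviation openZ :: "'g set set \<Rightarrow> bool" where
  "openZ \<equiv> openin (zar_on (Grass_atlas r) (W \<inter> chart r S))"

lemma X_sub_W: "X \<subseteq> W"
  by (rule zar_on_subset[OF W])

lemma openZ_iff:
  assumes "V \<subseteq> X \<inter> chart r S"
  shows "openZ V \<longleftrightarrow> openX V"
proof -
  have "openZ (X \<inter> (W \<inter> chart r S))" by (rule zar_on_restrict[OF W]) blast
  moreover have "X \<inter> (W \<inter> chart r S) = X \<inter> chart r S" using X_sub_W by blast
  ultimately have "openZ (X \<inter> chart r S)" by simp
  then show ?thesis
    using zar_on_open_sub[of "Grass_atlas r" "W \<inter> chart r S" "X \<inter> chart r S" V]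
      zar_on_open_sub[OF chart_open[OF S], of V] assms by blast
qed

lemma assoc_iff:
  assumes V: "openX V" "V \<subseteq> chart r S"
  shows "t \<in> assoc_sheaf sM (Grass_atlas r) (W \<inter> chart r S) (coord_ring (chart_coords r S) (W \<inter> chart r S)) N V \<longleftrightarrow>
    (\<forall>L. L \<notin> V \<longrightarrow> t L = 0) \<and> (\<forall>y\<in>V. \<exists>V' m q. openX V' \<and> y \<in> V' \<and> V' \<subseteq> V \<and> m \<in> N \<and>
      q \<in> poly_funs (chart_coords r S) \<and> (\<forall>L\<in>V'. q L \<noteq> 0 \<and> t L = sM (inverse (q L)) (m L)))"
proof -
  have VX: "V \<subseteq> X \<inter> chart r S" using zar_on_subset[OF V(1)] V(2) by blast
  have VZ: "V \<subseteq> W \<inter> chart r S" using VX X_sub_W by blast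
  let ?A = "\<lambda>y. \<exists>V' m g. openZ V' \<and> y \<in> V' \<and> V' \<subseteq> V \<and> m \<in> N \<and> g \<in> coord_ring (chart_coords r S) (W \<inter> chart r S) \<and>
            (\<forall>z\<in>V'. g z \<noteq> 0 \<and> t z = sM (inverse (g z)) (m z))"
  let ?B = "\<lambda>y. \<exists>V' m q. openX V' \<and> y \<in> V' \<and> V' \<subseteq> V \<and> m \<in> N \<and>
      q \<in> poly_funs (chart_coords r S) \<and> (\<forall>L\<in>V'. q L \<noteq> 0 \<and> t L = sM (inverse (q L)) (m L))"
  have "?A y \<longleftrightarrow> ?B y" for y
  proof
    assume "?A y"
    then obtain V' m g where 1: "openZ V'" "y \<in> V'" "V' \<subseteq> V" "m \<in> N"
      "g \<in> coord_ring (chart_coords r S) (W \<inter> chart r S)"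
      "\<forall>z\<in>V'. g z \<noteq> 0 \<and> t z = sM (inverse (g z)) (m z)" by blast
    then obtain q where q: "q \<in> poly_funs (chart_coords r S)" "g = restr (W \<inter> chart r S) q"
      by (auto simp: coord_ring_def)
    have "g z = q z" if "z \<in> V'" for z using that 1(3) VZ by (auto simp: q(2) restr_def)
    then have "\<forall>L\<in>V'. q L \<noteq> 0 \<and> t L = sM (inverse (q L)) (m L)" using 1(6) by simp
    moreover have "openX V'" using 1(1,3) VX openZ_iff[of V'] by blast
    ultimately show "?B y" using 1(2-4) q(1) by (intro exI[of _ V'] exI[of _ m] exI[of _ q] conjI)
  next
    assume "?B y"
    then obtain V' m q where 1: "openX V'" "y \<in> V'" "V' \<subseteq> V" "m \<in> N" "q \<in> poly_funs (chart_coords r S)"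
      "\<forall>L\<in>V'. q L \<noteq> 0 \<and> t L = sM (inverse (q L)) (m L)" by blast
    have "restr (W \<inter> chart r S) q z = q z" if "z \<in> V'" for z using that 1(3) VZ by (auto simp: restr_def)
    then have "\<forall>z\<in>V'. restr (W \<inter> chart r S) q z \<noteq> 0 \<and> t z = sM (inverse (restr (W \<inter> chart r S) q z)) (m z)"
      using 1(6) by simp
    moreover have "openZ V'" using 1(1,3) VX openZ_iff[of V'] by blast
    moreover have "restr (W \<inter> chart r S) q \<in> coord_ring (chart_coords r S) (W \<inter> chart r S)"
      using 1(5) by (simp add: coord_ring_def)
    ultimately show "?A y"
      using 1(2-4) by (intro exI[of _ V'] exI[of _ m] exI[of _ "restr (W \<inter> chart r S) q"] conjI)
  qed
  moreover have "openZ V" using V(1) openZ_iff[OF VX] by simp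
  ultimately show ?thesis unfolding assoc_sheaf_def by simp
qed

text \<open>
  Locally the sections \<open>f J\<close> with \<open>t = \<Sum>J. \<Theta>\<^sup>J (f J)\<close> have a common denominator, and their numerators
  are defined on the whole chart.
\<close>

lemma Im_chart_eq:
  assumes V: "openX V" "V \<subseteq> chart r S"
  shows "D.desc (Im_tilde j) V = Im_chart r j S W V"
proof (rule Set.set_eqI)
  fix t
  let ?Z = "W \<inter> chart r S"
  let ?R = "coord_ring (chart_coords r S) ?Z"
  let ?N = "im_module (Theta (chart_fun r S ?Z)) r j (tens sM ?R)"
  note at = chart_atlas[OF S]
  have VX: "V \<subseteq> X" by (rule zar_on_subset[OF V(1)])
  have ZI: "L \<in> ?Z" if "L \<in> V" for L using that VX X_sub_W V(2) by blast
  have "t \<in> D.desc (Im_tilde j) V \<longleftrightarrow> t \<in> assoc_sheaf sM (Grass_atlas r) ?Z ?R ?N V"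
  proof
    assume t: "t \<in> D.desc (Im_tilde j) V"
    note t' = t[unfolded desc_Im_chart[OF S V]]
    show "t \<in> assoc_sheaf sM (Grass_atlas r) ?Z ?R ?N V"
      unfolding assoc_iff[OF V]
    proof (intro conjI ballI)
      show "\<forall>L. L \<notin> V \<longrightarrow> t L = 0" using t' by blast
      fix y assume y: "y \<in> V"
      obtain U f where U: "openX U" "y \<in> U" "U \<subseteq> V" and f: "\<forall>J\<in>multi_exps r j. D.A.vreg U (f J)"
        "\<forall>L\<in>U. t L = (\<Sum>J\<in>multi_exps r j. mon r (chart_frame r S L) J (f J L))"
        using bspec[OF conjunct2[OF conjunct2[OF t']] y] by blast
      have yS: "y \<in> chart r S" using y V(2) by blast
      obtain Q P where Q: "Q \<in> poly_funs (chart_coords r S)" "Q y \<noteq> 0"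
        and P: "\<And>J. J \<in> multi_exps r j \<Longrightarrow> M.vpoly (chart_coords r S) (P J)"
          "\<And>J L. J \<in> multi_exps r j \<Longrightarrow> L \<in> U \<inter> chart r S \<Longrightarrow> Q L \<noteq> 0 \<Longrightarrow> sM (Q L) (f J L) = P J L"
      proof -
        note result = that
        show ?thesis
        proof (rule D.A.vreg_common_denominator[OF finite_multi_exps, of r j U f, OF _ at U(2) yS])
          show "D.A.vreg U (f J)" if "J \<in> multi_exps r j" for J using f(1) that by blast
        qed (rule result; assumption)
      qed
      define U' where "U' = U \<inter> {L \<in> X \<inter> chart r S. Q L \<noteq> 0}"
      have U': "openX U'" unfolding U'_def by (intro openin_Int U(1) D.A.basic_open[OF at Q(1)])
      define F where "F J = restr ?Z (P J)" for J
      define m where "m = (\<Sum>J\<in>multi_exps r j. op_monomial (Theta (chart_fun r S ?Z)) r J (F J))"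
      have "m \<in> ?N"
        unfolding im_module_def m_def using P(1)
        by (intro CollectI exI[of _ F] conjI refl) (auto simp: F_def M.tens_coord_ring)
      moreover have "Q L \<noteq> 0 \<and> t L = sM (inverse (Q L)) (m L)" if L: "L \<in> U'" for L
      proof
        have LU: "L \<in> U" "L \<in> chart r S" "L \<in> ?Z" and QL: "Q L \<noteq> 0" using L U(3) ZI by (auto simp: U'_def)
        show "Q L \<noteq> 0" by (rule QL)
        have "m L = (\<Sum>J\<in>multi_exps r j. mon r (chart_frame r S L) J (P J L))"
          using LU(3) by (simp add: m_def sum_fun_apply op_chart[OF S] F_def restr_def)
        also have "\<dots> = (\<Sum>J\<in>multi_exps r j. sM (Q L) (mon r (chart_frame r S L) J (f J L)))"
          using P(2)[of _ L] LU QL by (intro sum.cong refl) (simp flip: mon_scale)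
        also have "\<dots> = sM (Q L) (t L)" using bspec[OF f(2) LU(1)] by (simp add: M.scale_sum_right)
        finally show "t L = sM (inverse (Q L)) (m L)" using QL by simp
      qed
      ultimately show "\<exists>V' m q. openX V' \<and> y \<in> V' \<and> V' \<subseteq> V \<and> m \<in> ?N \<and>
          q \<in> poly_funs (chart_coords r S) \<and> (\<forall>L\<in>V'. q L \<noteq> 0 \<and> t L = sM (inverse (q L)) (m L))"
        using U' U(2,3) Q yS y VX by (intro exI[of _ U'] exI[of _ m] exI[of _ Q] conjI ballI) (auto simp: U'_def)
    qed
  next
    assume t: "t \<in> assoc_sheaf sM (Grass_atlas r) ?Z ?R ?N V"
    note t' = t[unfolded assoc_iff[OF V]]
    have form: "\<exists>U. openX U \<and> y \<in> U \<and> U \<subseteq> V \<and> section_form S j U t" if y: "y \<in> V" for y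
    proof -
      obtain U m q where U: "openX U" "y \<in> U" "U \<subseteq> V" and m: "m \<in> ?N" and q: "q \<in> poly_funs (chart_coords r S)"
        and tm: "\<forall>L\<in>U. q L \<noteq> 0 \<and> t L = sM (inverse (q L)) (m L)"
        using bspec[OF conjunct2[OF t'] y] by blast
      obtain F where F: "m = (\<Sum>J\<in>multi_exps r j. op_monomial (Theta (chart_fun r S ?Z)) r J (F J))"
        "\<forall>J\<in>multi_exps r j. F J \<in> tens sM ?R" using m unfolding im_module_def by blast
      have US: "U \<subseteq> chart r S" using U(3) V(2) by blast
      have F_reg: "D.A.vreg U (F J)" if J: "J \<in> multi_exps r j" for J
      proof -
        obtain p where p: "M.vpoly (chart_coords r S) p" "F J = restr ?Z p"
          using F(2) J by (auto simp: M.tens_coord_ring)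
        show ?thesis
          by (rule D.A.vreg_cong[OF D.A.vreg_vpoly[OF p(1) at US] order_refl])
            (use ZI U(3) in \<open>auto simp: p(2) restr_def\<close>)
      qed
      have inv: "reg (Grass_atlas r) U (\<lambda>L. inverse (q L))"
        using tm by (intro D.A.reg_inverse D.A.reg_poly[OF q at US]) blast
      have "section_form S j U t"
      proof (intro exI[of _ "\<lambda>J L. sM (inverse (q L)) (F J L)"] conjI ballI)
        show "D.A.vreg U (\<lambda>L. sM (inverse (q L)) (F J L))" if "J \<in> multi_exps r j" for J
          by (rule D.A.vreg_scale[OF inv F_reg[OF that]])
        fix L assume L: "L \<in> U"
        have "t L = sM (inverse (q L)) (m L)" using bspec[OF tm L] by (rule conjunct2)
        moreover have "L \<in> ?Z" using ZI L U(3) by blast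
        ultimately show "t L = (\<Sum>J\<in>multi_exps r j. mon r (chart_frame r S L) J (sM (inverse (q L)) (F J L)))"
          by (simp add: F(1) sum_fun_apply op_chart[OF S] mon_scale M.scale_sum_right)
      qed
      then show ?thesis using U by (intro exI[of _ U] conjI)
    qed
    have "D.A.vreg V t"
    proof (rule D.A.vreg_local[OF VX])
      fix y assume "y \<in> V"
      from form[OF this] obtain U where U: "openX U \<and> y \<in> U \<and> U \<subseteq> V \<and> section_form S j U t"
        by (elim exE) (rule that; assumption)
      then have "D.A.vreg U t" using V(2) by (intro section_form_vreg[OF S, of U j t]) auto
      moreover have "U \<inter> V = U" using U by blast
      ultimately show "\<exists>T. openX T \<and> y \<in> T \<and> D.A.vreg (T \<inter> V) t"
        using U by (intro exI[of _ U]) simp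
    qed
    then show "t \<in> D.desc (Im_tilde j) V"
      unfolding desc_Im_chart[OF S V] using conjunct1[OF t'] form by (intro conjI ballI)
  qed
  then show "t \<in> D.desc (Im_tilde j) V \<longleftrightarrow> t \<in> Im_chart r j S W V"
    by (simp only: Im_chart_def Let_def)
qed

text \<open>
  A local section of the kernel is a quotient of polynomial sections; after multiplication with a
  function that vanishes outside its domain, the numerator lies in the kernel on the whole chart.
\<close>

lemma Ker_chart_eq:
  assumes V: "openX V" "V \<subseteq> chart r S"
  shows "D.desc (Ker_tilde j) V = Ker_chart r j S W V"
proof (rule Set.set_eqI)
  fix t
  let ?Z = "W \<inter> chart r S"
  let ?R = "coord_ring (chart_coords r S) ?Z"
  let ?N = "ker_module (Theta (chart_fun r S ?Z)) r j (tens sM ?R)"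
  note at = chart_atlas[OF S]
  have VX: "V \<subseteq> X" by (rule zar_on_subset[OF V(1)])
  have ZI: "L \<in> ?Z" if "L \<in> V" for L using that VX X_sub_W V(2) by blast
  have VZ: "openZ V" using openZ_iff[of V] V VX by blast
  have fibre: "v \<in> ker_fibre j L \<longleftrightarrow> (\<forall>J\<in>multi_exps r j. mon r (chart_frame r S L) J v = 0)" if "L \<in> V" for L v
    using that VX V(2) by (intro ker_fibre_chart[OF S]) auto
  have "t \<in> D.desc (Ker_tilde j) V \<longleftrightarrow> t \<in> assoc_sheaf sM (Grass_atlas r) ?Z ?R ?N V"
  proof
    assume t: "t \<in> D.desc (Ker_tilde j) V"
    note t' = t[unfolded desc_Ker_iff[OF V(1)]]
    show "t \<in> assoc_sheaf sM (Grass_atlas r) ?Z ?R ?N V"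
      unfolding assoc_iff[OF V]
    proof (intro conjI ballI)
      show "\<forall>L. L \<notin> V \<longrightarrow> t L = 0" using t' by blast
      fix y assume y: "y \<in> V"
      have yS: "y \<in> chart r S" using y V(2) by blast
      obtain Q p where Q: "Q \<in> poly_funs (chart_coords r S)" "Q y \<noteq> 0"
        and p: "M.vpoly (chart_coords r S) p"
          "\<And>L. L \<in> V \<inter> chart r S \<Longrightarrow> Q L \<noteq> 0 \<Longrightarrow> sM (Q L) (t L) = p L"
      proof -
        obtain Q P where *: "Q \<in> poly_funs (chart_coords r S)" "Q y \<noteq> 0"
          "\<And>i. i \<in> {()} \<Longrightarrow> M.vpoly (chart_coords r S) (P i)"
          "\<And>i z. i \<in> {()} \<Longrightarrow> z \<in> V \<inter> chart r S \<Longrightarrow> Q z \<noteq> 0 \<Longrightarrow> sM (Q z) (t z) = P i z"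
          by (rule D.A.vreg_common_denominator[of "{()}" V "\<lambda>_. t", OF _ _ at y yS])
            (use t' in \<open>auto\<close>)
        show ?thesis by (rule that[of Q "P ()"]) (use * in auto)
      qed
      obtain h where h: "h \<in> poly_funs (chart_coords r S)" "h y \<noteq> 0" "{L \<in> ?Z \<inter> chart r S. h L \<noteq> 0} \<subseteq> V"
        by (rule D.A.open_basic[OF VZ at y yS])
      define H where "H = (\<lambda>L. h L * Q L)"
      have H: "H \<in> poly_funs (chart_coords r S)" using h(1) Q(1) by (auto simp: H_def intro: poly_funs.mult)
      define m where "m = restr ?Z (\<lambda>L. sM (H L) (p L))"
      define q where "q = (\<lambda>L. H L * Q L)"
      define U where "U = {L \<in> X \<inter> chart r S. H L \<noteq> 0}"
      have U: "openX U" unfolding U_def by (rule D.A.basic_open[OF at H])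
      have UV: "U \<subseteq> V" using h(3) X_sub_W by (auto simp: U_def H_def)
      have m_eq: "m L = sM (q L) (t L)" if "L \<in> V" "H L \<noteq> 0" for L
      proof -
        have "p L = sM (Q L) (t L)" using p(2)[of L] that V(2) by (auto simp: H_def)
        then show ?thesis using ZI[OF that(1)] by (simp add: m_def restr_def q_def)
      qed
      have "m \<in> ?N"
        unfolding ker_module_def mem_Collect_eq
      proof (intro conjI ballI ext)
        show "m \<in> tens sM ?R"
          unfolding M.tens_coord_ring m_def using M.vpoly_scale[OF H p(1)] by blast
        fix J L assume J: "J \<in> multi_exps r j"
        show "op_monomial (Theta (chart_fun r S ?Z)) r J m L = 0 L"
        proof (cases "L \<in> ?Z \<and> H L \<noteq> 0")
          case True
          then have LV: "L \<in> V" using h(3) by (auto simp: H_def)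
          have "mon r (chart_frame r S L) J (t L) = 0"
            using t' LV fibre[OF LV] J by blast
          then show ?thesis using True m_eq[OF LV] by (simp add: op_chart[OF S] mon_scale)
        next
          case False
          then have "m L = 0" by (auto simp: m_def restr_def)
          then show ?thesis by (simp add: op_chart[OF S] mon_zero)
        qed
      qed
      moreover have "q \<in> poly_funs (chart_coords r S)"
        unfolding q_def by (rule poly_funs.mult[OF H Q(1)])
      moreover have "q L \<noteq> 0 \<and> t L = sM (inverse (q L)) (m L)" if "L \<in> U" for L
      proof -
        have L: "L \<in> V" "H L \<noteq> 0" using that UV by (auto simp: U_def)
        then have "q L \<noteq> 0" by (auto simp: q_def H_def)
        then show ?thesis by (simp add: m_eq[OF L])
      qed
      moreover have "y \<in> U" using y VX yS h(2) Q(2) by (auto simp: U_def H_def)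
      ultimately show "\<exists>V' m q. openX V' \<and> y \<in> V' \<and> V' \<subseteq> V \<and> m \<in> ?N \<and>
          q \<in> poly_funs (chart_coords r S) \<and> (\<forall>L\<in>V'. q L \<noteq> 0 \<and> t L = sM (inverse (q L)) (m L))"
        using U UV by (intro exI[of _ U] exI[of _ m] exI[of _ q] conjI ballI) auto
    qed
  next
    assume t: "t \<in> assoc_sheaf sM (Grass_atlas r) ?Z ?R ?N V"
    note t' = t[unfolded assoc_iff[OF V]]
    have local: "\<exists>U. openX U \<and> y \<in> U \<and> U \<subseteq> V \<and> D.A.vreg U t \<and> t y \<in> ker_fibre j y" if y: "y \<in> V" for y
    proof -
      obtain U m q where U: "openX U" "y \<in> U" "U \<subseteq> V" and m: "m \<in> ?N" and q: "q \<in> poly_funs (chart_coords r S)"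
        and tm: "\<forall>L\<in>U. q L \<noteq> 0 \<and> t L = sM (inverse (q L)) (m L)"
        using bspec[OF conjunct2[OF t'] y] by blast
      have US: "U \<subseteq> chart r S" using U(3) V(2) by blast
      have mR: "m \<in> tens sM ?R" and mK: "\<And>J. J \<in> multi_exps r j \<Longrightarrow> op_monomial (Theta (chart_fun r S ?Z)) r J m = 0"
        using m by (auto simp: ker_module_def)
      obtain p where p: "M.vpoly (chart_coords r S) p" "m = restr ?Z p" using mR by (auto simp: M.tens_coord_ring)
      have "D.A.vreg U m"
        by (rule D.A.vreg_cong[OF D.A.vreg_vpoly[OF p(1) at US] order_refl])
          (use ZI U(3) in \<open>auto simp: p(2) restr_def\<close>)
      moreover have "reg (Grass_atlas r) U (\<lambda>L. inverse (q L))"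
        using tm by (intro D.A.reg_inverse D.A.reg_poly[OF q at US]) blast
      ultimately have "D.A.vreg U (\<lambda>L. sM (inverse (q L)) (m L))" by (intro D.A.vreg_scale)
      then have tv: "D.A.vreg U t" by (rule D.A.vreg_cong) (use tm in auto)
      have "mon r (chart_frame r S y) J (t y) = 0" if "J \<in> multi_exps r j" for J
      proof -
        have "mon r (chart_frame r S y) J (m y) = 0"
          using fun_cong[OF mK[OF that], of y] ZI[OF y] by (simp add: op_chart[OF S])
        moreover have "t y = sM (inverse (q y)) (m y)" using bspec[OF tm U(2)] by (rule conjunct2)
        ultimately show ?thesis by (simp add: mon_scale)
      qed
      then have "t y \<in> ker_fibre j y" unfolding fibre[OF y] by (rule ballI)
      then show ?thesis by (intro exI[of _ U] conjI U tv)
    qed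
    have "D.A.vreg V t"
    proof (rule D.A.vreg_local[OF VX])
      fix y assume "y \<in> V"
      from local[OF this] obtain U where U: "openX U" "y \<in> U" "U \<subseteq> V" "D.A.vreg U t" by blast
      moreover have "U \<inter> V = U" using U(3) by blast
      ultimately show "\<exists>T. openX T \<and> y \<in> T \<and> D.A.vreg (T \<inter> V) t" by (intro exI[of _ U]) simp
    qed
    moreover have "t L \<in> ker_fibre j L" if "L \<in> V" for L using local[OF that] by (elim exE conjE)
    ultimately show "t \<in> D.desc (Ker_tilde j) V"
      unfolding desc_Ker_iff[OF V(1)] using conjunct1[OF t'] by (intro conjI ballI)
  qed
  then show "t \<in> D.desc (Ker_tilde j) V \<longleftrightarrow> t \<in> Ker_chart r j S W V"
    by (simp only: Ker_chart_def Let_def)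
qed

lemma restrict_sheaf_eq:
  "restrict_sheaf (Grass_atlas r) (X \<inter> chart r S) (Im_descent r j X) =
     restrict_sheaf (Grass_atlas r) (X \<inter> chart r S) (Im_chart r j S W)"
  "restrict_sheaf (Grass_atlas r) (X \<inter> chart r S) (Ker_descent r j X) =
     restrict_sheaf (Grass_atlas r) (X \<inter> chart r S) (Ker_chart r j S W)"
proof -
  have "openX V \<and> V \<subseteq> chart r S" if "openin (zar_on (Grass_atlas r) (X \<inter> chart r S)) V" for V
    using that unfolding zar_on_open_sub[OF chart_open[OF S]] by blast
  then show "restrict_sheaf (Grass_atlas r) (X \<inter> chart r S) (Im_descent r j X) =
     restrict_sheaf (Grass_atlas r) (X \<inter> chart r S) (Im_chart r j S W)"
    "restrict_sheaf (Grass_atlas r) (X \<inter> chart r S) (Ker_descent r j X) =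
     restrict_sheaf (Grass_atlas r) (X \<inter> chart r S) (Ker_chart r j S W)"
    unfolding restrict_sheaf_def Im_descent_eq Ker_descent_eq
    using Im_chart_eq Ker_chart_eq by (auto simp: fun_eq_iff)
qed

end

end

theorem theorem2p10:
  fixes sG :: "'k::alg_closed_field \<Rightarrow> 'g::ab_group_add \<Rightarrow> 'g"
    and br :: "'g \<Rightarrow> 'g \<Rightarrow> 'g" and pm :: "'g \<Rightarrow> 'g"
    and x :: "nat \<Rightarrow> 'g" and n r j :: nat
    and sM :: "'k \<Rightarrow> 'm::ab_group_add \<Rightarrow> 'm"
    and \<rho> :: "('g list \<Rightarrow> 'k) set \<Rightarrow> 'm \<Rightarrow> 'm"
    and X W :: "'g set set" and S :: "nat set"
  assumes "restricted_module sG br pm x n sM \<rho>"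
    and "0 < r" "0 < j" "r < n" "j \<le> (CHAR('k) - 1) * r"
    and "locally_closed_in (restricted_module.Elem_top sG br pm x n r) X"
    and "W = restricted_module.Elem_top sG br pm x n r closure_of X"
    and "S \<subseteq> {1..n}" "card S = r"
  shows "restrict_sheaf (restricted_module.Grass_atlas sG x n r)
           (X \<inter> restricted_module.chart sG x n r S)
           (restricted_module.Im_descent sG br pm x n sM \<rho> r j X)
         = restrict_sheaf (restricted_module.Grass_atlas sG x n r)
           (X \<inter> restricted_module.chart sG x n r S)
           (restricted_module.Im_chart sG br pm x n sM \<rho> r j S W)
       \<and> restrict_sheaf (restricted_module.Grass_atlas sG x n r)
           (X \<inter> restricted_module.chart sG x n r S)
           (restricted_module.Ker_descent sG br pm x n sM \<rho> r j X)
         = restrict_sheaf (restricted_module.Grass_atlas sG x n r)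
           (X \<inter> restricted_module.chart sG x n r S)
           (restricted_module.Ker_chart sG br pm x n sM \<rho> r j S W)"
proof -
  interpret R: restricted_module sG br pm x n sM \<rho> by fact
  let ?T = "R.Elem_top r"
  obtain A B where AB: "openin ?T A" "closedin ?T B" "X = A \<inter> B"
    using assms(6) unfolding locally_closed_in_def by blast
  have top: "topspace ?T \<subseteq> R.Elem r" by (auto simp: R.Elem_top_def)
  have XT: "X \<subseteq> topspace ?T" using AB(2,3) closedin_subset by blast
  interpret E: elementary_family sG br pm x n sM \<rho> r X
    by unfold_locales (use XT top in blast)
  have WE: "W \<subseteq> R.Elem r" using top closure_of_subset_topspace[of ?T X] assms(7) by blast
  have "X \<subseteq> W" unfolding assms(7) by (rule closure_of_subset[OF XT])
  moreover have "W \<subseteq> B" unfolding assms(7) by (rule closure_of_minimal[OF _ AB(2)]) (use AB(3) in blast)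
  \<comment> \<open>a locally closed set is open in its closure\<close>
  ultimately have X_eq: "X = A \<inter> W" using AB(3) by blast
  have sub: "subtopology ?T W = zar_on (R.Grass_atlas r) W"
    using WE by (simp add: R.Elem_top_def subtopology_subtopology inf.absorb2)
  have "openin (subtopology ?T W) X"
    unfolding X_eq openin_subtopology using AB(1) by blast
  then have "openin (zar_on (R.Grass_atlas r) W) X" by (simp only: sub)
  then show ?thesis
    using E.restrict_sheaf_eq[of S W j] assms(8,9) by simp
qed

end
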